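(* For all $i\in\{0,\dots,n\}$, with $q=e^{-\delta}$ and the colours specialised as in the context, $$\sum_{\pi\in\mathcal P^{\omega_i}_{\mathcal S}}C(\pi)q^{|\pi|}=e^{-\Lambda_i}\mathrm{ch}(L(\Lambda_i)),$$ where fictitious parts are not counted in $C(\pi)q^{|\pi|}$.
   Context: $\mathfrak g$: affine Lie algebra of type $C_n^{(1)}$, simple roots $\alpha_0,\dots,\alpha_n$, fundamental weights $\Lambda_i$, null root $\delta=\alpha_0+2\sum_{j=1}^{n-1}\alpha_j+\alpha_n$, $L(\Lambda)$ irreducible highest weight module, $\mathrm{ch}$ its character. $\mathcal O=\overline{[n]}=\{1<\dots<n<\overline n<\dots<\overline 1\}$, $\overline{\overline k}=k$, $\overline{n+1}:=n$; $m=2n$. Primary-coloured integers $k_{c_u}$ ($k\in\mathbb Z,u\in\mathcal O$) ordered by $k_{c_u}\ge l_{c_v}$ iff $k-l\ge\chi(u<v)$, strictly $k_{c_u}>l_{c_v}$ iff $k-l\ge\chi(u\le v)$; $k_c+1=(k+1)_c$. $succ(k_{c_u})=k_{c_{u^+}}$ where $u^+$ is the successor of $u$ in $\mathcal O$ if $u\ne\overline1$, and $succ(k_{c_{\overline1}})=(k+1)_{c_1}$. Secondary colours $c_{x,y}=c_xc_y$ ($x\le y\in\mathcal O$); $\mathbb Z_{\mathcal S}$ = secondary-coloured integers $k_{c_{x,y}}$. Decomposition: $\eta(2k_{c_{x,y}})=k_{c_y}$, $\zeta(2k_{c_{x,y}})=k_{c_x}$, $\eta((2k+1)_{c_{x,y}})=(k+1)_{c_x}$,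 $\zeta((2k+1)_{c_{x,y}})=k_{c_y}$. One has $\zeta(e)\le\eta(e)\le\zeta(e)+1$, and conversely each pair of primary-coloured integers $(a,b)$ with $b\le a\le b+1$ equals $(\eta(e),\zeta(e))$ for exactly one $e\in\mathbb Z_{\mathcal S}$; moreover $\eta(e)=succ^u(\zeta(e))$ for a unique $u\in\{0,\dots,m\}$. Order on $\mathbb Z_{\mathcal S}$: $e\ge e'$ iff $\eta(e)>\eta(e')$, or $\eta(e)=\eta(e')$ and $\zeta(e)\le\zeta(e')$. For $e$ with $\eta(e)=succ^u(\zeta(e))$, $u\le m-1$: $d(e)$ is the element with $\eta(d(e))=\eta(e)$, $\zeta(d(e))=succ^{-1}(\zeta(e))$, and $f(e)$ the element with $\eta(f(e))=succ(\eta(e))$, $\zeta(f(e))=\zeta(e)$. A path is a sequence $(e_0,\dots,e_m)$ in $\mathbb Z_{\mathcal S}$ with $e_{j+1}\in\{d(e_j),f(e_j)\}$ (both defined where used) for all $j<m$; a path in a set $X$ has all $e_j\in X$. Let $\omega_0=(-1)_{c_{\overline1,\overline1}}$, $\omega_j=0_{c_{j,\overline{j+1}}}$ ($1\le j\le n$), $\Omega=\{\omega_0,\dots,\omega_n\}\sqcup\{0_{c_{u,\overline u}}:1\le u\le n\}$, and $\mathbb Z^+_{\mathcal S}=\{0_{c_{x,y}}:\overline y<x\le y\}\sqcup\{k_{c}:k>0,\ c \text{ secondary}\}$. For $\omega\in\Omega$, $\mathcal P^{\omega}_{\mathcal S}$ is the set of finite multisets (partitions) of elements of $\mathbb Z^+_{\mathcal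 S}$ whose frequencies $(f_u)$, extended by $f_u=\chi(u=\omega)$ for $u\in\Omega$, satisfy $f_{e_0}+\dots+f_{e_m}\le1$ for every path $(e_0,\dots,e_m)$ in $\Omega\sqcup\mathbb Z^+_{\mathcal S}$. $C(\pi)q^{|\pi|}=\prod_{u\in\mathbb Z^+_{\mathcal S}}(c(u)q^{|u|})^{f_u}$ with $c(k_{c_{x,y}})=c_{x,y}$, $|k_c|=k$. Specialisation: $c_{x,y}=c_xc_y$, $c_j=e^{\frac12\alpha_n+\sum_{u=j}^{n-1}\alpha_u}$, $c_{\overline j}=c_j^{-1}$. *)

theory Defs
  imports
    "HOL-Analysis.Infinite_Sum"
    "HOL-Library.Multiset"
    "HOL-Library.Poly_Mapping"
    "HOL-Library.Function_Algebras"
begin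

locale complex_lie_algebra = vector_space scale
  for scale :: "complex \<Rightarrow> 'g::ab_group_add \<Rightarrow> 'g" +
  fixes brk :: "'g \<Rightarrow> 'g \<Rightarrow> 'g"
  assumes brk_add_left: "brk (x + y) z = brk x z + brk y z"
    and brk_add_right: "brk x (y + z) = brk x y + brk x z"
    and brk_scale_left: "brk (scale c x) y = scale c (brk x y)"
    and brk_scale_right: "brk x (scale c y) = scale c (brk x y)"
    and brk_self: "brk x x = 0"
    and jacobi: "brk x (brk y z) + brk y (brk z x) + brk z (brk x y) = 0"
begin

definition lie_subalgebra :: "'g set \<Rightarrow> bool" where
  "lie_subalgebra S \<longleftrightarrow> subspace S \<and> (\<forall>x\<in>S. \<forall>y\<in>S. brk x y \<in> S)"

definition lie_ideal :: "'g set \<Rightarrow> bool" where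
  "lie_ideal I \<longleftrightarrow> subspace I \<and> (\<forall>x. \<forall>y\<in>I. brk x y \<in> I)"

end

text \<open>Rank of the \<open>N \<times> N\<close> matrix \<open>(A i j)\<close>, \<open>i, j < N\<close>, as the dimension of its row space.\<close>

definition matrix_rank :: "nat \<Rightarrow> (nat \<Rightarrow> nat \<Rightarrow> int) \<Rightarrow> nat" where
  "matrix_rank N A =
     vector_space.dim (\<lambda>(c::complex) (v::nat \<Rightarrow> complex) j. c * v j)
       ((\<lambda>i j. if j < N then of_int (A i j) else 0) ` {..<N})"

text \<open>A realization \<open>(\<hh>, \<Pi>, \<Pi>\<^sup>\<or>)\<close> of the \<open>N \<times> N\<close> matrix \<open>A\<close> in the sense of Kac, with
  \<open>\<hh>\<close> the whole type \<open>'h\<close>, \<open>\<Pi> = {\<alpha> j}\<close>, \<open>\<Pi>\<^sup>\<or> = {\<alpha>\<^sup>\<or> i}\<close> and the convention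
  \<open>A i j = \<langle>\<alpha>\<^sup>\<or> i, \<alpha> j\<rangle>\<close>. Indices run over \<open>0, \<dots>, N - 1\<close>.\<close>

locale cartan_realization = vector_space scale
  for scale :: "complex \<Rightarrow> 'h::ab_group_add \<Rightarrow> 'h" +
  fixes N :: nat
    and A :: "nat \<Rightarrow> nat \<Rightarrow> int"
    and \<alpha> :: "nat \<Rightarrow> 'h \<Rightarrow> complex"
    and coroot :: "nat \<Rightarrow> 'h"
  assumes root_linear: "j < N \<Longrightarrow> Vector_Spaces.linear scale (*) (\<alpha> j)"
    and pairing: "i < N \<Longrightarrow> j < N \<Longrightarrow> \<alpha> j (coroot i) = of_int (A i j)"
    and roots_independent:
      "(\<And>h. (\<Sum>j<N. c j * \<alpha> j h) = 0) \<Longrightarrow> j < N \<Longrightarrow> c j = 0"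
    and coroots_independent:
      "(\<Sum>i<N. scale (c i) (coroot i)) = 0 \<Longrightarrow> i < N \<Longrightarrow> c i = 0"
    and dim_cartan: "int (dim UNIV) = 2 * int N - int (matrix_rank N A)"

text \<open>The Kac--Moody algebra \<open>\<gg>(A)\<close>: the Lie algebra generated by \<open>\<hh>\<close> (embedded by \<open>\<iota>\<close>) and the
  Chevalley generators \<open>e i\<close>, \<open>f i\<close>, subject to the relations below, in which the maximal ideal
  intersecting \<open>\<hh>\<close> trivially is zero. This determines \<open>\<gg>(A)\<close> up to isomorphism.\<close>

locale kac_moody_algebra =
  H: cartan_realization scaleh N A \<alpha> coroot + complex_lie_algebra scaleg brk
  for scaleh :: "complex \<Rightarrow> 'h::ab_group_add \<Rightarrow> 'h"
    and N :: nat
    and A :: "nat \<Rightarrow> nat \<Rightarrow> int"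
    and \<alpha> :: "nat \<Rightarrow> 'h \<Rightarrow> complex"
    and coroot :: "nat \<Rightarrow> 'h"
    and scaleg :: "complex \<Rightarrow> 'g::ab_group_add \<Rightarrow> 'g"
    and brk :: "'g \<Rightarrow> 'g \<Rightarrow> 'g" +
  fixes \<iota> :: "'h \<Rightarrow> 'g"
    and e f :: "nat \<Rightarrow> 'g"
  assumes embed_linear: "Vector_Spaces.linear scaleh scaleg \<iota>"
    and embed_inj: "inj \<iota>"
    and rel_hh: "brk (\<iota> h) (\<iota> h') = 0"
    and rel_ef: "i < N \<Longrightarrow> j < N \<Longrightarrow> brk (e i) (f j) = (if i = j then \<iota> (coroot i) else 0)"
    and rel_he: "i < N \<Longrightarrow> brk (\<iota> h) (e i) = scaleg (\<alpha> i h) (e i)"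
    and rel_hf: "i < N \<Longrightarrow> brk (\<iota> h) (f i) = scaleg (- \<alpha> i h) (f i)"
    and generated:
      "lie_subalgebra S \<Longrightarrow> range \<iota> \<subseteq> S \<Longrightarrow> e ` {..<N} \<subseteq> S \<Longrightarrow> f ` {..<N} \<subseteq> S \<Longrightarrow> S = UNIV"
    and no_ideal: "lie_ideal I \<Longrightarrow> I \<inter> range \<iota> = {0} \<Longrightarrow> I = {0}"

text \<open>Cartan matrix of type \<open>C\<^sub>n\<^sup>(\<^sup>1\<^sup>)\<close>, nodes \<open>0, \<dots>, n\<close>, diagram
  \<open>0 \<Rightarrow> 1 - \<dots> - (n - 1) \<Leftarrow> n\<close>. For \<open>n = 1\<close> it is the matrix of \<open>A\<^sub>1\<^sup>(\<^sup>1\<^sup>)\<close>.\<close>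

definition cartan_C1 :: "nat \<Rightarrow> nat \<Rightarrow> nat \<Rightarrow> int" where
  "cartan_C1 n i j =
     (if i = j then 2
      else if (i = 1 \<and> j = 0) \<or> (Suc i = n \<and> j = n) then - 2
      else if i = Suc j \<or> j = Suc i then - 1
      else 0)"

definition null_root :: "nat \<Rightarrow> (nat \<Rightarrow> 'h \<Rightarrow> complex) \<Rightarrow> 'h \<Rightarrow> complex" where
  "null_root n \<alpha> = (\<lambda>h. \<alpha> 0 h + 2 * (\<Sum>j=1..<n. \<alpha> j h) + \<alpha> n h)"

text \<open>The conditions fix a fundamental weight only modulo multiples of the null root (unless a
  scaling element is chosen); \<open>e\<^bsup>-\<Lambda>\<^esup> ch L(\<Lambda>)\<close> does not depend on that choice.\<close>

definition (in cartan_realization) fundamental_weight :: "nat \<Rightarrow> ('h \<Rightarrow> complex) \<Rightarrow> bool" where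
  "fundamental_weight i \<Lambda> \<longleftrightarrow> Vector_Spaces.linear scale (*) \<Lambda> \<and>
     (\<forall>j<N. \<Lambda> (coroot j) = (if j = i then 1 else 0))"

locale lie_module = complex_lie_algebra scaleg brk + V: vector_space scalev
  for scaleg :: "complex \<Rightarrow> 'g::ab_group_add \<Rightarrow> 'g"
    and brk :: "'g \<Rightarrow> 'g \<Rightarrow> 'g"
    and scalev :: "complex \<Rightarrow> 'v::ab_group_add \<Rightarrow> 'v" +
  fixes act :: "'g \<Rightarrow> 'v \<Rightarrow> 'v"
  assumes act_add_left: "act (x + y) v = act x v + act y v"
    and act_add_right: "act x (v + w) = act x v + act x w"
    and act_scale_left: "act (scaleg c x) v = scalev c (act x v)"
    and act_scale_right: "act x (scalev c v) = scalev c (act x v)"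
    and act_brk: "act (brk x y) v = act x (act y v) - act y (act x v)"
begin

definition submodule :: "'v set \<Rightarrow> bool" where
  "submodule W \<longleftrightarrow> V.subspace W \<and> (\<forall>x. \<forall>w\<in>W. act x w \<in> W)"

definition irreducible_module :: bool where
  "irreducible_module \<longleftrightarrow>
     (UNIV :: 'v set) \<noteq> {0} \<and> (\<forall>W. submodule W \<longrightarrow> W = {0} \<or> W = UNIV)"

end

locale irreducible_highest_weight_module =
  kac_moody_algebra scaleh N A \<alpha> coroot scaleg brk \<iota> e f + lie_module scaleg brk scalev act
  for scaleh :: "complex \<Rightarrow> 'h::ab_group_add \<Rightarrow> 'h"
    and N :: nat
    and A :: "nat \<Rightarrow> nat \<Rightarrow> int"
    and \<alpha> :: "nat \<Rightarrow> 'h \<Rightarrow> complex"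
    and coroot :: "nat \<Rightarrow> 'h"
    and scaleg :: "complex \<Rightarrow> 'g::ab_group_add \<Rightarrow> 'g"
    and brk :: "'g \<Rightarrow> 'g \<Rightarrow> 'g"
    and \<iota> :: "'h \<Rightarrow> 'g"
    and e f :: "nat \<Rightarrow> 'g"
    and scalev :: "complex \<Rightarrow> 'v::ab_group_add \<Rightarrow> 'v"
    and act :: "'g \<Rightarrow> 'v \<Rightarrow> 'v" +
  fixes \<Lambda> :: "'h \<Rightarrow> complex"
  assumes irreducible: irreducible_module
    and highest_weight_vector:
      "\<exists>v. v \<noteq> 0 \<and> (\<forall>i<N. act (e i) v = 0) \<and> (\<forall>h. act (\<iota> h) v = scalev (\<Lambda> h) v) \<and>
           (\<forall>W. submodule W \<longrightarrow> v \<in> W \<longrightarrow> W = UNIV)"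

definition weight_space ::
  "(complex \<Rightarrow> 'v \<Rightarrow> 'v) \<Rightarrow> ('g \<Rightarrow> 'v \<Rightarrow> 'v) \<Rightarrow> ('h \<Rightarrow> 'g) \<Rightarrow> ('h \<Rightarrow> complex) \<Rightarrow> 'v set" where
  "weight_space scalev act \<iota> \<mu> = {v. \<forall>h. act (\<iota> h) v = scalev (\<mu> h) v}"

text \<open>A possibly infinite formal sum \<open>\<Sum>\<^sub>\<mu> F(\<mu>) e\<^sup>\<mu>\<close> over \<open>\<mu> \<in> \<hh>\<^sup>*\<close> is represented by its
  coefficient function \<open>F\<close>; finite ones are elements of the group ring of \<open>\<hh>\<^sup>*\<close>, represented as
  polynomial mappings.\<close>

type_synonym 'w formal_sum = "'w \<Rightarrow> int"
type_synonym 'w group_ring = "'w \<Rightarrow>\<^sub>0 int"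

definition character ::
  "(complex \<Rightarrow> 'v::ab_group_add \<Rightarrow> 'v) \<Rightarrow> ('g \<Rightarrow> 'v \<Rightarrow> 'v) \<Rightarrow> ('h \<Rightarrow> 'g) \<Rightarrow> ('h \<Rightarrow> complex) formal_sum"
  where
  "character scalev act \<iota> = (\<lambda>\<mu>. int (vector_space.dim scalev (weight_space scalev act \<iota> \<mu>)))"

definition fexp :: "'w \<Rightarrow> 'w group_ring" where
  "fexp \<mu> = Poly_Mapping.single \<mu> 1"

text \<open>The product \<open>e\<^sup>\<nu> \<cdot> F\<close>.\<close>

definition fexp_times :: "'w::ab_group_add \<Rightarrow> 'w formal_sum \<Rightarrow> 'w formal_sum" where
  "fexp_times \<nu> F = (\<lambda>\<mu>. F (\<mu> - \<nu>))"

text \<open>Summation of a family of formal sums: for every \<open>\<mu>\<close> the coefficients of \<open>e\<^sup>\<mu>\<close> sum up to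
  \<open>F \<mu>\<close>. As \<^typ>\<open>int\<close> is discrete and the coefficients here are nonnegative, this includes that
  only finitely many members of the family contribute to each coefficient.\<close>

definition has_formal_sum :: "('a \<Rightarrow> 'w group_ring) \<Rightarrow> 'w formal_sum \<Rightarrow> 'a set \<Rightarrow> bool" where
  "has_formal_sum t F S \<longleftrightarrow> (\<forall>\<mu>. ((\<lambda>a. Poly_Mapping.lookup (t a) \<mu>) has_sum F \<mu>) S)"

text \<open>The ordered set \<open>1 < \<dots> < n < n\<^bold>\<bar> < \<dots> < 1\<^bold>\<bar>\<close> is encoded as \<open>{1..2n}\<close> with its usual order,
  the barred letter of \<open>k\<close> being \<open>2n + 1 - k\<close>. This gives the involution \<open>bar (bar k) = k\<close> and the
  convention \<open>bar (n + 1) = n\<close>. The pair \<open>(k, u)\<close> stands for \<open>k\<close> coloured by \<open>c\<^sub>u\<close> and the triple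
  \<open>(k, x, y)\<close> for \<open>k\<close> coloured by \<open>c\<^sub>x\<^sub>,\<^sub>y\<close>.\<close>

definition letters :: "nat \<Rightarrow> nat set" where
  "letters n = {1..2 * n}"

definition bar :: "nat \<Rightarrow> nat \<Rightarrow> nat" where
  "bar n u = 2 * n + 1 - u"

type_synonym primary = "int \<times> nat"
type_synonym secondary = "int \<times> nat \<times> nat"

definition succ :: "nat \<Rightarrow> primary \<Rightarrow> primary" where
  "succ n = (\<lambda>(k, u). if u = bar n 1 then (k + 1, 1) else (k, u + 1))"

definition pred :: "nat \<Rightarrow> primary \<Rightarrow> primary" where
  "pred n = (\<lambda>(k, u). if u = 1 then (k - 1, bar n 1) else (k, u - 1))"

definition secondary_ints :: "nat \<Rightarrow> secondary set" where
  "secondary_ints n = {(k, x, y). x \<in> letters n \<and> y \<in> letters n \<and> x \<le> y}"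

definition eta :: "secondary \<Rightarrow> primary" where
  "eta = (\<lambda>(k, x, y). if even k then (k div 2, y) else (k div 2 + 1, x))"

definition zeta :: "secondary \<Rightarrow> primary" where
  "zeta = (\<lambda>(k, x, y). if even k then (k div 2, x) else (k div 2, y))"

definition df_defined :: "nat \<Rightarrow> secondary \<Rightarrow> bool" where
  "df_defined n e \<longleftrightarrow> e \<in> secondary_ints n \<and> (\<exists>u \<le> 2 * n - 1. eta e = (succ n ^^ u) (zeta e))"

definition d_step :: "nat \<Rightarrow> secondary \<Rightarrow> secondary" where
  "d_step n e = (THE e'. e' \<in> secondary_ints n \<and> eta e' = eta e \<and> zeta e' = pred n (zeta e))"

definition f_step :: "nat \<Rightarrow> secondary \<Rightarrow> secondary" where
  "f_step n e = (THE e'. e' \<in> secondary_ints n \<and> eta e' = succ n (eta e) \<and> zeta e' = zeta e)"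

text \<open>A path \<open>(p 0, \<dots>, p m)\<close>, \<open>m = 2n\<close>, in the set \<open>X\<close>; values of \<open>p\<close> beyond \<open>m\<close> are irrelevant.\<close>

definition path_in :: "nat \<Rightarrow> secondary set \<Rightarrow> (nat \<Rightarrow> secondary) \<Rightarrow> bool" where
  "path_in n X p \<longleftrightarrow>
     (\<forall>j \<le> 2 * n. p j \<in> X \<inter> secondary_ints n) \<and>
     (\<forall>j < 2 * n. df_defined n (p j) \<and> p (Suc j) \<in> {d_step n (p j), f_step n (p j)})"

definition omega :: "nat \<Rightarrow> nat \<Rightarrow> secondary" where
  "omega n j = (if j = 0 then (- 1, bar n 1, bar n 1) else (0, j, bar n (j + 1)))"

definition Omega :: "nat \<Rightarrow> secondary set" where
  "Omega n = omega n ` {0..n} \<union> (\<lambda>u. (0, u, bar n u)) ` {1..n}"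

definition positive_secondary :: "nat \<Rightarrow> secondary set" where
  "positive_secondary n =
     {(k, x, y) \<in> secondary_ints n. (k = 0 \<and> bar n y < x) \<or> k > 0}"

definition ext_freq :: "nat \<Rightarrow> secondary \<Rightarrow> secondary multiset \<Rightarrow> secondary \<Rightarrow> nat" where
  "ext_freq n \<omega> \<pi> u = (if u \<in> Omega n then (if u = \<omega> then 1 else 0) else count \<pi> u)"

definition admissible_partitions :: "nat \<Rightarrow> secondary \<Rightarrow> secondary multiset set" where
  "admissible_partitions n \<omega> =
     {\<pi>. set_mset \<pi> \<subseteq> positive_secondary n \<and>
         (\<forall>p. path_in n (Omega n \<union> positive_secondary n) p \<longrightarrow>
              (\<Sum>j \<le> 2 * n. ext_freq n \<omega> \<pi> (p j)) \<le> 1)}"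

definition colour_weight :: "nat \<Rightarrow> (nat \<Rightarrow> 'h \<Rightarrow> complex) \<Rightarrow> nat \<Rightarrow> 'h \<Rightarrow> complex" where
  "colour_weight n \<alpha> j = (\<lambda>h. 1 / 2 * \<alpha> n h + (\<Sum>u=j..<n. \<alpha> u h))"

definition colour1 :: "nat \<Rightarrow> (nat \<Rightarrow> 'h \<Rightarrow> complex) \<Rightarrow> nat \<Rightarrow> ('h \<Rightarrow> complex) group_ring" where
  "colour1 n \<alpha> u =
     (if u \<le> n then fexp (colour_weight n \<alpha> u) else fexp (- colour_weight n \<alpha> (bar n u)))"

definition colour :: "nat \<Rightarrow> (nat \<Rightarrow> 'h \<Rightarrow> complex) \<Rightarrow> secondary \<Rightarrow> ('h \<Rightarrow> complex) group_ring" where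
  "colour n \<alpha> = (\<lambda>(k, x, y). colour1 n \<alpha> x * colour1 n \<alpha> y)"

definition part_size :: "secondary \<Rightarrow> nat" where
  "part_size = (\<lambda>(k, x, y). nat k)"

text \<open>\<open>C(\<pi>) q\<^bsup>|\<pi>|\<^esup>\<close> with the specialised colours.\<close>

definition partition_monomial ::
  "nat \<Rightarrow> (nat \<Rightarrow> 'h \<Rightarrow> complex) \<Rightarrow> ('h \<Rightarrow> complex) group_ring \<Rightarrow> secondary multiset
     \<Rightarrow> ('h \<Rightarrow> complex) group_ring" where
  "partition_monomial n \<alpha> q \<pi> =
     (\<Prod>u\<in>set_mset \<pi>. (colour n \<alpha> u * q ^ part_size u) ^ count \<pi> u)"

end

theory Submission
  imports Defs "HOL-Library.FSet"
begin

text \<open>Identify the primary-coloured integer \<open>k\<close> of colour \<open>c\<^sub>u\<close> with the integer \<open>2nk + u\<close>. A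
  secondary-coloured integer becomes an interval \<open>[b, a]\<close> with \<open>b \<le> a \<le> b + 2n\<close>, a path becomes a
  chain of intervals growing by one unit at a time, and two parts lie on a common path iff one interval
  contains the other. So admissible partitions are the sequences of intervals whose lower and upper
  ends both increase strictly, starting from the interval \<open>[i, 2n - i]\<close> of \<open>\<omega>\<^sub>i\<close>.

  The module is compared with the fermionic Fock space of charge \<open>i\<close>, on which the Chevalley
  generators act by \<open>f\<^sub>j = \<Sum> u\<^sub>q\<^sub>+\<^sub>1 d\<^sub>q\<close> over \<open>q \<equiv> \<plusminus>j\<close> modulo \<open>2n\<close>, with \<open>e\<^sub>j\<close> the transpose of \<open>f\<^sub>j\<close>. The words
  in the \<open>f\<^sub>j\<close> applied to the highest weight vector and to the vacuum satisfy the same linear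
  relations: in both cases these are given by the kernel of the Gram matrix, which depends only on the
  Cartan matrix, because the module is irreducible and the form on the Fock space is positive definite.

  On the Fock space every interval \<open>[b, a]\<close> gives a current \<open>X b a\<close> of the affine symplectic algebra.
  Spanning by admissible products: since fermions anticommute, \<open>ab \<cdot> cd + ac \<cdot> bd + ad \<cdot> bc\<close>, summed over
  all degrees, vanishes for any four colours; the nested pair is the unique term in which the two
  interval midpoints are closest, so it can be replaced by pairs lying further apart.
  Independence: the leading state of \<open>X b\<^sub>1 a\<^sub>1 \<cdots> X b\<^sub>s a\<^sub>s\<close> is the one with particles at the \<open>b\<^sub>j\<close> and
  holes at the \<open>2n + 1 - a\<^sub>j\<close>, and it determines the sequence of intervals.\<close>

section \<open>Fermionic Fock space\<close>

text \<open>All fundamental weights of type C_n^(1) have level one, which is why free fermions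
  suffice: folding the cyclic diagram with 2n nodes by q -> -q places the affine symplectic algebra
  inside the affine general linear algebra, which acts on the Fock space at level one. The module
  reappears as the span of the words applied to the vacuum, in general a proper part of the charge
  sector. Dimensions are compared through linear relations among words, so no isomorphism has to be
  built. Central terms are determined by Schur's lemma and by values on the vacuum. The delicate
  point is convergence in the quadratic relation: infinite sums of modes are finite only at one
  basis state at a time, degrees may be rearranged only after a cut-off, and the larger degree must
  stand on the left for the tails to vanish.\<close>

type_synonym fock = "int fset \<Rightarrow> complex"

definition fscale :: "complex \<Rightarrow> ('s \<Rightarrow> complex) \<Rightarrow> 's \<Rightarrow> complex" where
  "fscale c \<phi> = (\<lambda>S. c * \<phi> S)"

lemma fscale_apply [simp]: "fscale c \<phi> S = c * \<phi> S"
  by (simp add: fscale_def)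

interpretation fv: vector_space fscale
  by unfold_locales (auto simp: fun_eq_iff algebra_simps)

interpretation fvp: vector_space_pair fscale fscale
  by unfold_locales

abbreviation flinear :: "(fock \<Rightarrow> fock) \<Rightarrow> bool" where
  "flinear \<equiv> Vector_Spaces.linear fscale fscale"

lemma flinearI:
  assumes "\<And>\<phi> \<chi>. T (\<phi> + \<chi>) = T \<phi> + T \<chi>" "\<And>c \<phi>. T (fscale c \<phi>) = fscale c (T \<phi>)"
  shows "flinear T"
  using assms by unfold_locales auto

lemmas flinear_simps = fvp.linear_add fvp.linear_scale fvp.linear_0 fvp.linear_neg fvp.linear_diff fvp.linear_sum

lemma sum_fun_apply: "(\<Sum>x\<in>A. g x) y = (\<Sum>x\<in>A. g x y)"
  for g :: "'a \<Rightarrow> 'b \<Rightarrow> 'c::comm_monoid_add"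
  by (induction A rule: infinite_finite_induct) auto

text \<open>The Jordan-Wigner sign: counting the members below p makes operators of different modes
  anticommute.\<close>

definition fsign :: "int \<Rightarrow> int fset \<Rightarrow> complex" where
  "fsign p S = (-1) ^ card {q \<in> fset S. q < p}"

lemma fsign_sq [simp]: "fsign p S * fsign p S = 1"
  by (simp add: fsign_def flip: power_mult_distrib)

lemma fsign_sq' [simp]: "fsign p S * (fsign p S * z) = z"
  by (metis fsign_sq mult.assoc mult_1)

lemma fsign_nz [simp]: "fsign p S \<noteq> 0"
  by (simp add: fsign_def)

lemma fsign_empty [simp]: "fsign p {||} = 1"
  by (simp add: fsign_def)

lemma fsign_real: "cnj (fsign p S) = fsign p S"
  by (simp add: fsign_def)

lemma fsign_finsert:
  assumes "q |\<notin>| S"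
  shows "fsign p (finsert q S) = (if q < p then - fsign p S else fsign p S)"
proof -
  have eq: "{x \<in> fset (finsert q S). x < p} =
      (if q < p then insert q {x \<in> fset S. x < p} else {x \<in> fset S. x < p})"
    by auto
  have "card (insert q {x \<in> fset S. x < p}) = Suc (card {x \<in> fset S. x < p})"
    using assms by (intro card_insert_disjoint) auto
  then show ?thesis
    unfolding fsign_def eq by (simp del: fset_simps)
qed

lemma fsign_remove:
  assumes "q |\<in>| S"
  shows "fsign p (S |-| {|q|}) = (if q < p then - fsign p S else fsign p S)"
proof -
  have "finsert q (S |-| {|q|}) = S" using assms by auto
  then show ?thesis using fsign_finsert[of q "S |-| {|q|}" p] by auto
qed

definition cre :: "int \<Rightarrow> fock \<Rightarrow> fock" where
  "cre p \<phi> = (\<lambda>S. if p |\<in>| S then fsign p S * \<phi> (S |-| {|p|}) else 0)"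

definition ann :: "int \<Rightarrow> fock \<Rightarrow> fock" where
  "ann p \<phi> = (\<lambda>S. if p |\<in>| S then 0 else fsign p S * \<phi> (finsert p S))"

lemma flinear_cre: "flinear (cre p)"
  by (rule flinearI) (auto simp: cre_def fun_eq_iff algebra_simps)

lemma flinear_ann: "flinear (ann p)"
  by (rule flinearI) (auto simp: ann_def fun_eq_iff algebra_simps)

lemma cre_cre: "cre p (cre q \<phi>) = - cre q (cre p \<phi>)"
proof (rule ext)
  fix S
  have "S |-| {|p|} |-| {|q|} = S |-| {|q|} |-| {|p|}" by auto
  then show "cre p (cre q \<phi>) S = (- cre q (cre p \<phi>)) S"
    by (cases p q rule: linorder_cases) (auto simp: cre_def fsign_remove)
qed

lemma ann_ann: "ann p (ann q \<phi>) = - ann q (ann p \<phi>)"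
proof (rule ext)
  fix S
  have "finsert p (finsert q S) = finsert q (finsert p S)" by auto
  then show "ann p (ann q \<phi>) S = (- ann q (ann p \<phi>)) S"
    by (cases p q rule: linorder_cases) (auto simp: ann_def fsign_finsert)
qed

lemma ann_cre: "ann q (cre p \<phi>) = (if p = q then \<phi> else 0) - cre p (ann q \<phi>)"
proof (rule ext)
  fix S
  show "ann q (cre p \<phi>) S = ((if p = q then \<phi> else 0) - cre p (ann q \<phi>)) S"
  proof (cases "p = q")
    case True
    show ?thesis
    proof (cases "p |\<in>| S")
      case True
      then have "finsert p (S |-| {|p|}) = S" by auto
      with True \<open>p = q\<close> show ?thesis by (simp add: ann_def cre_def fsign_remove)
    next
      case False
      then have "finsert p S |-| {|p|} = S" by auto
      with False \<open>p = q\<close> show ?thesis by (simp add: ann_def cre_def fsign_finsert)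
    qed
  next
    case False
    then have "finsert q S |-| {|p|} = finsert q (S |-| {|p|})" by auto
    with False show ?thesis
      by (cases p q rule: linorder_cases) (auto simp: ann_def cre_def fsign_remove fsign_finsert)
  qed
qed

lemma cre_ann: "cre q (ann p \<phi>) = (if p = q then \<phi> else 0) - ann p (cre q \<phi>)"
  by (simp add: ann_cre)

definition ket :: "int fset \<Rightarrow> fock" where
  "ket S = (\<lambda>T. if T = S then 1 else 0)"

abbreviation vac :: fock where "vac \<equiv> ket {||}"

lemma ann_vac [simp]: "ann p vac = 0"
  by (auto simp: ann_def ket_def fun_eq_iff)

lemma cre_ket: "p |\<notin>| S \<Longrightarrow> cre p (ket S) = fscale (fsign p S) (ket (finsert p S))"
  by (auto simp: cre_def ket_def fun_eq_iff fsign_finsert)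

lemma ket_finsert: "p |\<notin>| S \<Longrightarrow> ket (finsert p S) = fscale (fsign p S) (cre p (ket S))"
  by (simp add: cre_ket fun_eq_iff)

text \<open>States are arbitrary functions so that every operator is total. This predicate cuts out
  the actual Fock space, on which identities with a scalar term are proved.\<close>

definition finsupp :: "fock \<Rightarrow> bool" where
  "finsupp \<phi> \<longleftrightarrow> finite {S. \<phi> S \<noteq> 0}"

lemma finsupp_ket [simp]: "finsupp (ket S)"
  by (simp add: finsupp_def ket_def)

lemma finsupp_add: "finsupp \<phi> \<Longrightarrow> finsupp \<chi> \<Longrightarrow> finsupp (\<phi> + \<chi>)"
  unfolding finsupp_def by (rule finite_subset[of _ "{S. \<phi> S \<noteq> 0} \<union> {S. \<chi> S \<noteq> 0}"]) auto

lemma finsupp_scale: "finsupp \<phi> \<Longrightarrow> finsupp (fscale c \<phi>)"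
  unfolding finsupp_def by (rule finite_subset[of _ "{S. \<phi> S \<noteq> 0}"]) auto

lemma finsupp_0 [simp]: "finsupp 0"
  by (simp add: finsupp_def)

lemma subspace_finsupp: "fv.subspace (Collect finsupp)"
  by (auto simp: fv.subspace_def finsupp_add finsupp_scale)

lemma finsupp_expand:
  assumes "finsupp \<phi>"
  shows "\<phi> = (\<Sum>S | \<phi> S \<noteq> 0. fscale (\<phi> S) (ket S))"
proof (rule ext)
  fix T
  have "(\<Sum>S | \<phi> S \<noteq> 0. fscale (\<phi> S) (ket S)) T = (\<Sum>S | \<phi> S \<noteq> 0. if S = T then \<phi> S else 0)"
    by (simp add: sum_fun_apply ket_def if_distrib cong: if_cong) (rule sum.cong, auto)
  also have "\<dots> = \<phi> T" using assms by (simp add: finsupp_def)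
  finally show "\<phi> T = (\<Sum>S | \<phi> S \<noteq> 0. fscale (\<phi> S) (ket S)) T" ..
qed

lemma finsupp_in_span_ket: "finsupp \<phi> \<longleftrightarrow> \<phi> \<in> fv.span (range ket)"
proof
  assume "finsupp \<phi>"
  then show "\<phi> \<in> fv.span (range ket)"
    by (subst finsupp_expand) (simp, intro fv.span_sum fv.span_scale fv.span_base, simp)
next
  assume "\<phi> \<in> fv.span (range ket)"
  then have "\<phi> \<in> Collect finsupp"
    by (rule fv.span_induct) (auto simp: subspace_finsupp)
  then show "finsupp \<phi>" by simp
qed

lemma flinear_eq_on_finsupp:
  assumes "flinear T" "flinear T'" "\<And>S. T (ket S) = T' (ket S)" "finsupp \<phi>"
  shows "T \<phi> = T' \<phi>"
  using assms fvp.linear_eq_on[of T T' \<phi> "range ket"] by (auto simp: finsupp_in_span_ket)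

lemma flinear_finsupp:
  assumes "flinear T" "\<And>S. finsupp (T (ket S))" "finsupp \<phi>"
  shows "finsupp (T \<phi>)"
proof -
  have "T \<phi> = (\<Sum>S | \<phi> S \<noteq> 0. fscale (\<phi> S) (T (ket S)))"
    by (subst finsupp_expand[OF assms(3)]) (simp add: flinear_simps[OF assms(1)])
  then show ?thesis
    using assms(2) subspace_finsupp by (auto intro!: fv.subspace_sum[OF subspace_finsupp, simplified] finsupp_scale)
qed

lemma finsupp_cre: "finsupp \<phi> \<Longrightarrow> finsupp (cre p \<phi>)"
proof (rule flinear_finsupp[OF flinear_cre])
  fix S show "finsupp (cre p (ket S))"
    unfolding finsupp_def
    by (rule finite_subset[of _ "{finsert p S}"]) (auto simp: cre_def ket_def split: if_splits)
qed

lemma finsupp_ann: "finsupp \<phi> \<Longrightarrow> finsupp (ann p \<phi>)"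
proof (rule flinear_finsupp[OF flinear_ann])
  fix S show "finsupp (ann p (ket S))"
    unfolding finsupp_def
    by (rule finite_subset[of _ "{S |-| {|p|}}"]) (auto simp: ann_def ket_def split: if_splits)
qed

section \<open>Fermion modes over a filled sea and sums of normal-ordered bilinears\<close>

locale fermions =
  fixes lev :: int
begin

text \<open>A state records the deviation from a sea filled up to \<open>lev\<close>: a member p >
  \<open>lev\<close> is a particle, a member p \<le> \<open>lev\<close> is a hole. Thus
  \<open>u p\<close> always adds a fermion at p and \<open>d p\<close> removes one, whichever set
  operation this takes.\<close>

definition u :: "int \<Rightarrow> fock \<Rightarrow> fock" where
  "u p = (if p > lev then cre p else ann p)"

definition d :: "int \<Rightarrow> fock \<Rightarrow> fock" where
  "d p = (if p > lev then ann p else cre p)"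

lemma flinear_u: "flinear (u p)" and flinear_d: "flinear (d p)"
  by (auto simp: u_def d_def flinear_cre flinear_ann)

lemmas u_simps = flinear_simps[OF flinear_u]
lemmas d_simps = flinear_simps[OF flinear_d]

lemma u_u: "u p (u q \<phi>) = - u q (u p \<phi>)"
proof -
  have "ann p (cre q \<phi>) = - cre q (ann p \<phi>)" if "p \<noteq> q" for p q
    using that by (subst ann_cre) auto
  then show ?thesis
    by (cases "p > lev"; cases "q > lev") (auto simp: u_def intro: cre_cre ann_ann)
qed

lemma d_d: "d p (d q \<phi>) = - d q (d p \<phi>)"
proof -
  have "ann p (cre q \<phi>) = - cre q (ann p \<phi>)" if "p \<noteq> q" for p q
    using that by (subst ann_cre) auto
  then show ?thesis
    by (cases "p > lev"; cases "q > lev") (auto simp: d_def intro: cre_cre ann_ann)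
qed

lemma d_u: "d q (u p \<phi>) = (if p = q then \<phi> else 0) - u p (d q \<phi>)"
proof -
  have "cre q (cre p \<phi>) = - cre p (cre q \<phi>)" "ann q (ann p \<phi>) = - ann p (ann q \<phi>)"
    by (rule cre_cre, rule ann_ann)
  moreover have "cre q (ann p \<phi>) = (if p = q then \<phi> else 0) - ann p (cre q \<phi>)" by (rule cre_ann)
  moreover have "ann q (cre p \<phi>) = (if p = q then \<phi> else 0) - cre p (ann q \<phi>)" by (rule ann_cre)
  ultimately show ?thesis
    by (cases "p > lev"; cases "q > lev") (simp_all only: u_def d_def if_True if_False, auto)
qed

lemma finsupp_u: "finsupp \<phi> \<Longrightarrow> finsupp (u p \<phi>)" and finsupp_d: "finsupp \<phi> \<Longrightarrow> finsupp (d p \<phi>)"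
  by (auto simp: u_def d_def finsupp_cre finsupp_ann)

text \<open>A radius around 0 that contains every member of S and also the level, because
  \<open>u\<close> and \<open>d\<close> switch at \<open>lev\<close> while \<open>nord\<close>
  switches at 0.\<close>

definition bnd :: "int fset \<Rightarrow> int" where
  "bnd S = (\<Sum>x\<in>fset S. \<bar>x\<bar>) + \<bar>lev\<bar>"

lemma bnd_mem: "x |\<in>| S \<Longrightarrow> \<bar>x\<bar> \<le> bnd S"
proof -
  assume "x |\<in>| S"
  then have "\<bar>x\<bar> \<le> (\<Sum>x\<in>fset S. \<bar>x\<bar>)" by (intro member_le_sum) auto
  then show ?thesis by (simp add: bnd_def)
qed

lemma bnd_lev: "\<bar>lev\<bar> \<le> bnd S"
  by (simp add: bnd_def sum_nonneg)

text \<open>Normal ordering is with respect to the level 0 vacuum, whatever \<open>lev\<close> is: for colour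
  functions of vanishing mean it agrees with the symmetric truncation of the unordered sum.\<close>

definition nord :: "int \<Rightarrow> int \<Rightarrow> fock \<Rightarrow> fock" where
  "nord p q \<phi> = u p (d q \<phi>) - (if p = q \<and> q \<le> 0 then \<phi> else 0)"

lemma flinear_nord: "flinear (nord p q)"
  by (rule flinearI) (auto simp: nord_def u_simps d_simps fun_eq_iff algebra_simps)

text \<open>Far above the sea, \<open>cre (q + h)\<close> would need q + h in S. Far below it,
  \<open>cre q\<close> would need q in S together with q + h, which leaves only h = 0, and there the
  subtracted term cancels.\<close>

lemma nord_far:
  assumes "\<bar>q\<bar> > bnd S + \<bar>h\<bar>"
  shows "nord (q + h) q \<phi> S = 0"
proof -
  note b = bnd_lev[of S]
  have mem: "q |\<notin>| S" "q + h |\<notin>| S"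
    using bnd_mem[of q S] bnd_mem[of "q + h" S] assms by linarith+
  show ?thesis
  proof (cases "q > 0")
    case True
    then have "q > lev" "q + h > lev" using assms b by linarith+
    then show ?thesis using mem True by (simp add: nord_def u_def d_def cre_def)
  next
    case False
    then have "q \<le> lev" "q + h \<le> lev" using assms b by linarith+
    moreover have "finsert q S |-| {|q|} = S" using mem by auto
    ultimately show ?thesis using mem False
      by (auto simp: nord_def u_def d_def cre_def ann_def fsign_finsert)
  qed
qed

text \<open>The infinite sum of \<open>c q\<close> times the normal-ordered product of modes q + h
  and q. By \<open>nord_far\<close> only the displayed window contributes at S, so the operator
  makes sense on all functions.\<close>

definition Z :: "int \<Rightarrow> (int \<Rightarrow> complex) \<Rightarrow> fock \<Rightarrow> fock" where
  "Z h c \<phi> = (\<lambda>S. \<Sum>q = - (bnd S + \<bar>h\<bar>)..bnd S + \<bar>h\<bar>. c q * nord (q + h) q \<phi> S)"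

lemma Z_eq:
  assumes "finite Q" "{- (bnd S + \<bar>h\<bar>)..bnd S + \<bar>h\<bar>} \<subseteq> Q"
  shows "Z h c \<phi> S = (\<Sum>q\<in>Q. c q * nord (q + h) q \<phi> S)"
  unfolding Z_def
proof (rule sum.mono_neutral_left[OF assms])
  show "\<forall>q\<in>Q - {- (bnd S + \<bar>h\<bar>)..bnd S + \<bar>h\<bar>}. c q * nord (q + h) q \<phi> S = 0"
    by (auto simp: nord_far)
qed

lemma flinear_Z: "flinear (Z h c)"
  by (rule flinearI)
    (auto simp: Z_def fun_eq_iff flinear_simps[OF flinear_nord] algebra_simps sum.distrib sum_distrib_left)

lemmas Z_simps = flinear_simps[OF flinear_Z]

lemma Z_coeff_cong: "(\<And>q. c q = c' q) \<Longrightarrow> Z h c \<phi> = Z h c' \<phi>"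
  by (simp add: Z_def)

lemma Z_coeff_add: "Z h (\<lambda>q. c q + c' q) \<phi> = Z h c \<phi> + Z h c' \<phi>"
  by (simp add: Z_def fun_eq_iff algebra_simps sum.distrib)

lemma Z_coeff_scale: "Z h (\<lambda>q. a * c q) \<phi> = fscale a (Z h c \<phi>)"
  by (simp add: Z_def fun_eq_iff algebra_simps sum_distrib_left)

lemma Z_coeff_0: "Z h (\<lambda>q. 0) \<phi> = 0"
  by (simp add: Z_def fun_eq_iff)

lemma Z_coeff_sum: "Z h (\<lambda>q. \<Sum>x\<in>A. c x q) \<phi> = (\<Sum>x\<in>A. Z h (c x) \<phi>)"
  by (induction A rule: infinite_finite_induct) (auto simp: Z_coeff_0 Z_coeff_add)

lemma nord_u: "nord p q (u r \<phi>) = u r (nord p q \<phi>) + (if q = r then u p \<phi> else 0)"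
  by (simp add: nord_def d_u u_simps u_u[of r p] fun_eq_iff)

lemma nord_d: "nord p q (d r \<phi>) = d r (nord p q \<phi>) - (if p = r then d q \<phi> else 0)"
  by (simp add: nord_def d_u d_simps u_simps d_d[of r q] fun_eq_iff)

text \<open>Each fermion operator reads a single value of its argument. Evaluating
  \<open>u r\<close> of a sum of modes at S therefore means evaluating that sum at another state T,
  which makes \<open>Z_u\<close> a comparison of two finite sums.\<close>

lemma u_point: "\<exists>s T. \<forall>\<chi>. u r \<chi> S = s * \<chi> T"
  by (cases "r > lev"; cases "r |\<in>| S") (auto simp: u_def cre_def ann_def intro: exI[of _ 0])

lemma d_point: "\<exists>s T. \<forall>\<chi>. d r \<chi> S = s * \<chi> T"
  by (cases "r > lev"; cases "r |\<in>| S") (auto simp: d_def cre_def ann_def intro: exI[of _ 0])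

lemma Z_u: "Z h c (u r \<phi>) = u r (Z h c \<phi>) + fscale (c r) (u (r + h) \<phi>)"
proof (rule ext)
  fix S
  obtain s T where T: "\<And>\<chi>. u r \<chi> S = s * \<chi> T" using u_point by blast
  \<comment> \<open>Wide enough for the windows of both S and T and for the mode r itself.\<close>
  define R where "R = bnd S + bnd T + \<bar>h\<bar> + \<bar>r\<bar>"
  have pos: "bnd S \<ge> 0" "bnd T \<ge> 0" by (auto simp: bnd_def sum_nonneg)
  have "Z h c (u r \<phi>) S = (\<Sum>q=-R..R. c q * nord (q + h) q (u r \<phi>) S)"
    by (rule Z_eq) (use pos in \<open>auto simp: R_def\<close>)
  also have "\<dots> = (\<Sum>q=-R..R. s * (c q * nord (q + h) q \<phi> T)) + (\<Sum>q=-R..R. if q = r then c r * u (r + h) \<phi> S else 0)"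
    by (subst sum.distrib[symmetric], rule sum.cong) (auto simp: nord_u T algebra_simps)
  also have "(\<Sum>q=-R..R. if q = r then c r * u (r + h) \<phi> S else 0) = c r * u (r + h) \<phi> S"
    using pos by (auto simp: R_def)
  also have "(\<Sum>q=-R..R. s * (c q * nord (q + h) q \<phi> T)) = s * Z h c \<phi> T"
    by (subst Z_eq[of "{-R..R}"]) (use pos in \<open>auto simp: R_def sum_distrib_left\<close>)
  finally show "Z h c (u r \<phi>) S = (u r (Z h c \<phi>) + fscale (c r) (u (r + h) \<phi>)) S"
    by (simp add: T)
qed

lemma Z_d: "Z h c (d r \<phi>) = d r (Z h c \<phi>) - fscale (c (r - h)) (d (r - h) \<phi>)"
proof (rule ext)
  fix S
  obtain s T where T: "\<And>\<chi>. d r \<chi> S = s * \<chi> T" using d_point by blast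
  define R where "R = bnd S + bnd T + \<bar>h\<bar> + \<bar>r\<bar>"
  have pos: "bnd S \<ge> 0" "bnd T \<ge> 0" by (auto simp: bnd_def sum_nonneg)
  have "Z h c (d r \<phi>) S = (\<Sum>q=-R..R. c q * nord (q + h) q (d r \<phi>) S)"
    by (rule Z_eq) (use pos in \<open>auto simp: R_def\<close>)
  also have "\<dots> = (\<Sum>q=-R..R. s * (c q * nord (q + h) q \<phi> T)) - (\<Sum>q=-R..R. if q = r - h then c (r - h) * d (r - h) \<phi> S else 0)"
    by (subst sum_subtractf[symmetric], rule sum.cong) (auto simp: nord_d T algebra_simps)
  also have "(\<Sum>q=-R..R. if q = r - h then c (r - h) * d (r - h) \<phi> S else 0) = c (r - h) * d (r - h) \<phi> S"
    using pos by (auto simp: R_def)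
  also have "(\<Sum>q=-R..R. s * (c q * nord (q + h) q \<phi> T)) = s * Z h c \<phi> T"
    by (subst Z_eq[of "{-R..R}"]) (use pos in \<open>auto simp: R_def sum_distrib_left\<close>)
  finally show "Z h c (d r \<phi>) S = (d r (Z h c \<phi>) - fscale (c (r - h)) (d (r - h) \<phi>)) S"
    by (simp add: T)
qed

end

declare fscale_apply [simp del]

lemmas fpt = fun_eq_iff fscale_apply

section \<open>Gradings, action on the vacuum, and commutators up to a scalar\<close>

context fermions
begin

definition state_weight :: "(int \<Rightarrow> 'w::ab_group_add) \<Rightarrow> int fset \<Rightarrow> 'w" where
  "state_weight w S = (\<Sum>p\<in>fset S. if p > lev then w p else - w p)"

definition graded :: "(int \<Rightarrow> 'w::ab_group_add) \<Rightarrow> 'w \<Rightarrow> fock \<Rightarrow> bool" where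
  "graded w \<mu> \<phi> \<longleftrightarrow> (\<forall>S. \<phi> S \<noteq> 0 \<longrightarrow> state_weight w S = \<mu>)"

lemma state_weight_finsert:
  "p |\<notin>| S \<Longrightarrow> state_weight w (finsert p S) = (if p > lev then w p else - w p) + state_weight w S"
  by (simp add: state_weight_def)

lemma state_weight_remove:
  assumes "p |\<in>| S"
  shows "state_weight w (S |-| {|p|}) = state_weight w S - (if p > lev then w p else - w p)"
proof -
  have "finsert p (S |-| {|p|}) = S" using assms by auto
  then show ?thesis using state_weight_finsert[of p "S |-| {|p|}" w] by auto
qed

lemma graded_u: "graded w \<mu> \<phi> \<Longrightarrow> graded w (\<mu> + w p) (u p \<phi>)"
  unfolding graded_def
proof (intro allI impI)
  fix S assume g: "\<forall>S. \<phi> S \<noteq> 0 \<longrightarrow> state_weight w S = \<mu>" and nz: "u p \<phi> S \<noteq> 0"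
  show "state_weight w S = \<mu> + w p"
  proof (cases "p > lev")
    case True
    with nz have "p |\<in>| S" "\<phi> (S |-| {|p|}) \<noteq> 0" by (auto simp: u_def cre_def split: if_splits)
    with g True show ?thesis by (auto simp: state_weight_remove algebra_simps)
  next
    case False
    with nz have "p |\<notin>| S" "\<phi> (finsert p S) \<noteq> 0" by (auto simp: u_def ann_def split: if_splits)
    with g False show ?thesis by (auto simp: state_weight_finsert algebra_simps)
  qed
qed

lemma graded_d: "graded w \<mu> \<phi> \<Longrightarrow> graded w (\<mu> - w p) (d p \<phi>)"
  unfolding graded_def
proof (intro allI impI)
  fix S assume g: "\<forall>S. \<phi> S \<noteq> 0 \<longrightarrow> state_weight w S = \<mu>" and nz: "d p \<phi> S \<noteq> 0"
  show "state_weight w S = \<mu> - w p"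
  proof (cases "p > lev")
    case False
    with nz have "p |\<in>| S" "\<phi> (S |-| {|p|}) \<noteq> 0" by (auto simp: d_def cre_def split: if_splits)
    with g False show ?thesis by (auto simp: state_weight_remove algebra_simps)
  next
    case True
    with nz have "p |\<notin>| S" "\<phi> (finsert p S) \<noteq> 0" by (auto simp: d_def ann_def split: if_splits)
    with g True show ?thesis by (auto simp: state_weight_finsert algebra_simps)
  qed
qed

lemma graded_Z:
  assumes "graded w \<mu> \<phi>" and "\<And>q. c q \<noteq> 0 \<Longrightarrow> w (q + h) - w q = \<nu>"
  shows "graded w (\<mu> + \<nu>) (Z h c \<phi>)"
  unfolding graded_def
proof (intro allI impI)
  fix S assume "Z h c \<phi> S \<noteq> 0"
  then obtain q where q: "c q \<noteq> 0" "nord (q + h) q \<phi> S \<noteq> 0"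
    unfolding Z_def by (metis (no_types, lifting) mult_eq_0_iff sum.neutral)
  then consider "u (q + h) (d q \<phi>) S \<noteq> 0" | "h = 0" "\<phi> S \<noteq> 0"
    by (cases "u (q + h) (d q \<phi>) S = 0") (auto simp: nord_def split: if_splits)
  then show "state_weight w S = \<mu> + \<nu>"
  proof cases
    case 1
    then have "state_weight w S = \<mu> - w q + w (q + h)"
      using graded_u[OF graded_d[OF assms(1)]] unfolding graded_def by blast
    then show ?thesis using assms(2)[OF q(1)] by (simp add: algebra_simps)
  next
    case 2
    then show ?thesis using assms(1) assms(2)[OF q(1)] by (auto simp: graded_def)
  qed
qed

lemma graded_vac: "graded w 0 vac"
  by (simp add: graded_def ket_def state_weight_def)

lemma cre_cre_same [simp]: "cre p (cre p \<phi>) = 0"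
  using cre_cre[of p p \<phi>] by (simp add: fpt)

lemma nord_vac:
  "nord (q + h) q vac =
     (if q \<le> lev \<and> lev < q + h then cre (q + h) (cre q vac)
      else if h = 0 then fscale (of_bool (q \<le> lev) - of_bool (q \<le> 0)) vac else 0)"
proof -
  have "ann (q + h) (cre q vac) = (if h = 0 then vac else 0)"
    by (simp add: ann_cre flinear_simps[OF flinear_cre])
  then show ?thesis
    by (auto simp: nord_def u_def d_def fpt flinear_simps[OF flinear_cre] flinear_simps[OF flinear_ann])
qed

text \<open>On the vacuum a bilinear can only create a particle-hole pair across the level. The
  scalar for h = 0 counts the modes between 0, where \<open>nord\<close> is ordered, and
  \<open>lev\<close>, where the sea ends.\<close>

lemma Z_vac:
  "Z h c vac = (\<Sum>q\<in>{lev-h<..lev}. fscale (c q) (cre (q + h) (cre q vac)))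
     + (if h = 0 then fscale (\<Sum>q=-\<bar>lev\<bar>..\<bar>lev\<bar>. c q * (of_bool (q \<le> lev) - of_bool (q \<le> 0))) vac else 0)"
proof (rule ext)
  fix S
  define R where "R = bnd S + \<bar>h\<bar>"
  note b = bnd_lev[of S]
  have sub: "{lev-h<..lev} \<subseteq> {-R..R}" using b by (auto simp: R_def)
  have sub2: "{-\<bar>lev\<bar>..\<bar>lev\<bar>} \<subseteq> {-R..R}" using b by (auto simp: R_def)
  have "Z h c vac S = (\<Sum>q=-R..R. c q * nord (q + h) q vac S)" by (simp add: Z_def R_def)
  also have "\<dots> = (\<Sum>q=-R..R. (if q \<in> {lev-h<..lev} then c q * cre (q + h) (cre q vac) S else 0)
      + (if h = 0 then (c q * (of_bool (q \<le> lev) - of_bool (q \<le> 0))) * vac S else 0))"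
    by (rule sum.cong[OF refl]) (auto simp: nord_vac)
  also have "\<dots> = (\<Sum>q\<in>{lev-h<..lev}. c q * cre (q + h) (cre q vac) S)
      + (if h = 0 then (\<Sum>q=-R..R. c q * (of_bool (q \<le> lev) - of_bool (q \<le> 0))) * vac S else 0)"
    using sub by (simp add: sum.distrib sum.If_cases Int_absorb1 sum_distrib_right del: of_bool_eq greaterThanAtMost_iff)
  also have "(\<Sum>q=-R..R. c q * (of_bool (q \<le> lev) - of_bool (q \<le> 0)))
      = (\<Sum>q=-\<bar>lev\<bar>..\<bar>lev\<bar>. c q * (of_bool (q \<le> lev) - of_bool (q \<le> 0)))"
    by (rule sum.mono_neutral_right) (use sub2 in auto)
  finally show "Z h c vac S = ((\<Sum>q\<in>{lev-h<..lev}. fscale (c q) (cre (q + h) (cre q vac)))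
     + (if h = 0 then fscale (\<Sum>q=-\<bar>lev\<bar>..\<bar>lev\<bar>. c q * (of_bool (q \<le> lev) - of_bool (q \<le> 0))) vac else 0)) S"
    by (simp add: sum_fun_apply fscale_apply)
qed

lemma Z_vac_nonpos: "h \<le> 0 \<Longrightarrow> \<exists>k. (h < 0 \<longrightarrow> k = 0) \<and> Z h c vac = fscale k vac"
  by (cases "h = 0") (auto simp: Z_vac intro: exI[of _ 0])

lemma ket_induct [case_names vac u d]:
  assumes "P vac"
    and "\<And>S p. p |\<notin>| S \<Longrightarrow> p > lev \<Longrightarrow> P (ket S) \<Longrightarrow> P (fscale (fsign p S) (u p (ket S)))"
    and "\<And>S p. p |\<notin>| S \<Longrightarrow> p \<le> lev \<Longrightarrow> P (ket S) \<Longrightarrow> P (fscale (fsign p S) (d p (ket S)))"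
  shows "P (ket S)"
proof (induction S rule: fset_induct_stronger)
  case empty
  show ?case by (rule assms(1))
next
  case (insert p S)
  then show ?case using assms(2,3)[of p S] by (cases "p > lev") (auto simp: ket_finsert u_def d_def)
qed

lemma finsupp_Z: "finsupp \<phi> \<Longrightarrow> finsupp (Z h c \<phi>)"
proof (rule flinear_finsupp[OF flinear_Z])
  fix S show "finsupp (Z h c (ket S))"
  proof (induction S rule: ket_induct)
    case vac
    show ?case unfolding Z_vac
      by (intro finsupp_add fv.subspace_sum[OF subspace_finsupp, simplified] finsupp_scale finsupp_cre)
        (auto intro: finsupp_scale)
  next
    case (u S p)
    then show ?case unfolding Z_simps Z_u by (intro finsupp_scale finsupp_add finsupp_u finsupp_ket)
  next
    case (d S p)
    have eq: "Z h c (d p (ket S)) = d p (Z h c (ket S)) + fscale (- c (p - h)) (d (p - h) (ket S))"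
      by (simp add: Z_d fpt)
    from d show ?case unfolding Z_simps eq
      by (intro finsupp_scale finsupp_add finsupp_d finsupp_ket)
  qed
qed

lemma ann_ket: "p |\<notin>| S \<Longrightarrow> ann p (ket S) = 0"
  by (auto simp: ann_def ket_def fpt)

text \<open>A strongly lowering operator moves each fermion to a mode absent from S on the side of
  the level where it annihilates. The bound does not depend on \<open>c\<close>, so one bound later
  serves all six colour pairs of the quadratic relation.\<close>

lemma Z_kills_ket: "\<exists>N. \<forall>h c. h < - N \<longrightarrow> Z h c (ket S) = 0"
proof (induction S rule: fset_induct_stronger)
  case empty
  have "\<forall>h c. h < - (0::int) \<longrightarrow> Z h c (ket {||}) = 0" by (auto simp: Z_vac)
  then show ?case by blast
next
  case (insert p S)
  then obtain N where N: "\<And>h c. h < - N \<Longrightarrow> Z h c (ket S) = 0" by blast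
  define N' where "N' = max N (bnd S + \<bar>p\<bar>)"
  have "Z h c (ket (finsert p S)) = 0" if h: "h < - N'" for h c
  proof (cases "p > lev")
    case True
    have "p + h \<le> lev" "p + h |\<notin>| S"
      using h bnd_lev[of S] bnd_mem[of "p + h" S] unfolding N'_def by linarith+
    then have "u (p + h) (ket S) = 0" by (simp add: u_def ann_ket)
    then have "Z h c (u p (ket S)) = 0" using h N[of h c] by (simp add: Z_u N'_def u_simps)
    then show ?thesis using True insert by (simp add: ket_finsert Z_simps u_def)
  next
    case False
    have "p - h > lev" "p - h |\<notin>| S"
      using h bnd_lev[of S] bnd_mem[of "p - h" S] unfolding N'_def by linarith+
    then have "d (p - h) (ket S) = 0" by (simp add: d_def ann_ket)
    then have "Z h c (d p (ket S)) = 0" using h N[of h c] by (simp add: Z_d N'_def d_simps)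
    then show ?thesis using False insert by (simp add: ket_finsert Z_simps d_def)
  qed
  then show ?case by blast
qed

lemma Z_kills:
  assumes "finsupp \<phi>"
  obtains N where "\<And>h c. h < - N \<Longrightarrow> Z h c \<phi> = 0"
proof -
  have "\<forall>S. \<exists>N. \<forall>h c. h < - N \<longrightarrow> Z h c (ket S) = 0" using Z_kills_ket by blast
  then obtain N where N: "\<And>S h c. h < - N S \<Longrightarrow> Z h c (ket S) = 0" by metis
  define M where "M = (\<Sum>S | \<phi> S \<noteq> 0. \<bar>N S\<bar>)"
  have "Z h c \<phi> = 0" if "h < - M" for h c
  proof -
    have "Z h c (ket S) = 0" if "\<phi> S \<noteq> 0" for S
    proof -
      have "\<bar>N S\<bar> \<le> M" unfolding M_def using assms that by (intro member_le_sum) (auto simp: finsupp_def)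
      then show ?thesis using N[of h S c] \<open>h < - M\<close> by linarith
    qed
    then show ?thesis
      by (subst finsupp_expand[OF assms]) (simp add: Z_simps)
  qed
  then show ?thesis using that by blast
qed

text \<open>Schur's lemma: a vector killed by all annihilation operators is a multiple of the vacuum, and the
  creation operators generate everything finitely supported from it.\<close>

lemma fermion_commutant:
  assumes lin: "flinear Y" and cu: "\<And>r \<phi>. Y (u r \<phi>) = u r (Y \<phi>)" and cd: "\<And>r \<phi>. Y (d r \<phi>) = d r (Y \<phi>)"
    and fin: "finsupp \<phi>"
  shows "Y \<phi> = fscale (Y vac {||}) \<phi>"
proof -
  define k where "k = Y vac {||}"
  have can: "Y (ann p \<chi>) = ann p (Y \<chi>)" for p \<chi>
    using cu[of p \<chi>] cd[of p \<chi>] by (cases "p > lev") (auto simp: u_def d_def)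
  have "Y vac S = 0" if ne: "S \<noteq> {||}" for S
  proof -
    obtain p where p: "p |\<in>| S" using ne by (meson ex_fin_conv)
    then have eq: "finsert p (S |-| {|p|}) = S" by auto
    have "ann p (Y vac) (S |-| {|p|}) = 0"
      using can[of p vac] by (simp add: flinear_simps[OF lin])
    then show ?thesis using eq by (simp add: ann_def)
  qed
  then have Yvac: "Y vac = fscale k vac" by (auto simp: fpt ket_def k_def)
  have Yket: "Y (ket S) = fscale k (ket S)" for S
  proof (induction S rule: ket_induct)
    case vac
    show ?case by (rule Yvac)
  next
    case (u S p)
    then show ?case by (simp add: flinear_simps[OF lin] cu u_simps mult.commute)
  next
    case (d S p)
    then show ?case by (simp add: flinear_simps[OF lin] cd d_simps mult.commute)
  qed
  have "flinear (fscale k)" by (rule flinearI) (auto simp: fpt algebra_simps)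
  from flinear_eq_on_finsupp[OF lin this Yket fin] show ?thesis by (simp add: k_def)
qed

text \<open>The defect of the commutation rule commutes with every \<open>u\<close> and
  \<open>d\<close>, so \<open>fermion_commutant\<close> makes it a scalar without any computation of
  the central term.\<close>

lemma Z_commutator:
  fixes c c' :: "int \<Rightarrow> complex" and h h' :: int
  defines "c'' \<equiv> \<lambda>q. c (q + h') * c' q - c' (q + h) * c q"
  obtains k where "\<And>\<phi>. finsupp \<phi> \<Longrightarrow>
      Z h c (Z h' c' \<phi>) = Z h' c' (Z h c \<phi>) + Z (h + h') c'' \<phi> + fscale k \<phi>"
    "h + h' \<noteq> 0 \<Longrightarrow> k = 0"
proof -
  define Y where "Y \<phi> = Z h c (Z h' c' \<phi>) - Z h' c' (Z h c \<phi>) - Z (h + h') c'' \<phi>" for \<phi>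
  have lin: "flinear Y"
    by (rule flinearI) (auto simp: Y_def Z_simps fpt algebra_simps)
  have cu: "Y (u r \<phi>) = u r (Y \<phi>)" for r \<phi>
    by (simp add: Y_def Z_u Z_simps u_simps fpt c''_def algebra_simps)
  have e1: "r - h' - h = r - h - h'" "r - (h + h') = r - h - h'" "r - h - h' + h' = r - h" "r - h - h' + h = r - h'" for r
    by auto
  have cd: "Y (d r \<phi>) = d r (Y \<phi>)" for r \<phi>
    unfolding Y_def Z_d Z_simps d_simps c''_def e1 by (simp add: fpt algebra_simps)
  have main: "Z h c (Z h' c' \<phi>) = Z h' c' (Z h c \<phi>) + Z (h + h') c'' \<phi> + fscale (Y vac {||}) \<phi>"
    if "finsupp \<phi>" for \<phi>
    using fermion_commutant[of Y, OF lin cu cd that] by (simp add: Y_def fpt algebra_simps)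
  have "Y vac {||} = 0" if "h + h' \<noteq> 0"
  proof -
    \<comment> \<open>With the position p as weight, an operator of height h raises the degree by
      exactly h, whereas the vacuum component has degree 0.\<close>
    have g: "graded (\<lambda>p. p) (m + h) (Z h c \<phi>)" if "graded (\<lambda>p. p) m \<phi>" for m h c \<phi>
      using that by (rule graded_Z) simp
    have "graded (\<lambda>p. p) (0 + h' + h) (Z h c (Z h' c' vac))" "graded (\<lambda>p. p) (0 + h + h') (Z h' c' (Z h c vac))"
      "graded (\<lambda>p. p) (0 + (h + h')) (Z (h + h') c'' vac)"
      by (intro g graded_vac)+
    moreover have "\<chi> {||} = 0" if "graded (\<lambda>p. p) m \<chi>" "m = h + h'" for m \<chi>
      using that \<open>h + h' \<noteq> 0\<close> by (force simp: graded_def state_weight_def)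
    ultimately have "Z h c (Z h' c' vac) {||} = 0" "Z h' c' (Z h c vac) {||} = 0" "Z (h + h') c'' vac {||} = 0"
      by (metis add.commute add_0)+
    then show ?thesis by (simp add: Y_def)
  qed
  then show ?thesis using that main by blast
qed

end

section \<open>The symplectic currents\<close>

context fermions
begin

text \<open>A nonzero value would force q, which then lies below \<open>- bnd S\<close>, to be a
  hole of S. The bound is independent of the argument, so tails of degree sums vanish at S whatever
  stands to the right.\<close>

lemma ud_high:
  assumes "p - q > 2 * bnd S"
  shows "u p (d q \<phi>) S = 0"
proof (cases "p > lev")
  case True
  have "u p (d q \<phi>) S = 0" if "p |\<in>| S"
  proof -
    have "p \<le> bnd S" using bnd_mem[OF that] by linarith
    then have "q < - bnd S" using assms by linarith
    then have "q \<le> lev" "q |\<notin>| S" using bnd_lev[of S] bnd_mem[of q S] by linarith+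
    then show ?thesis using True by (simp add: u_def d_def cre_def)
  qed
  then show ?thesis using True by (auto simp: u_def cre_def)
next
  case False
  have "q < p" using assms bnd_lev[of S] by linarith
  moreover have "q < - bnd S" using False assms bnd_lev[of S] by linarith
  then have "q |\<notin>| S" using bnd_mem[of q S] by linarith
  ultimately show ?thesis using False by (simp add: u_def d_def cre_def ann_def)
qed

lemma nord_point: "\<exists>s T r. \<forall>\<chi>. nord p q \<chi> S = s * \<chi> T + r * \<chi> S"
proof -
  obtain s T where 1: "\<And>\<chi>. u p \<chi> S = s * \<chi> T" using u_point by blast
  obtain s' T' where 2: "\<And>\<chi>. d q \<chi> T = s' * \<chi> T'" using d_point by blast
  have "nord p q \<chi> S = (s * s') * \<chi> T' + (if p = q \<and> q \<le> 0 then -1 else 0) * \<chi> S" for \<chi>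
    by (simp add: nord_def 1 2)
  then show ?thesis by blast
qed

text \<open>One coefficient of the image depends on finitely many coefficients of the argument; this
  allows a limit in the inner factor of a composition.\<close>

lemma Z_local:
  obtains P where "finite P" "\<And>\<chi> \<chi>'. (\<And>T. T \<in> P \<Longrightarrow> \<chi> T = \<chi>' T) \<Longrightarrow> Z h c \<chi> S = Z h c \<chi>' S"
proof -
  have "\<forall>q. \<exists>s T r. \<forall>\<chi>. nord (q + h) q \<chi> S = s * \<chi> T + r * \<chi> S" using nord_point by blast
  then obtain s T r where sT: "\<And>q \<chi>. nord (q + h) q \<chi> S = s q * \<chi> (T q) + r q * \<chi> S" by metis
  define P where "P = insert S (T ` {- (bnd S + \<bar>h\<bar>)..bnd S + \<bar>h\<bar>})"
  have "finite P" by (simp add: P_def)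
  moreover have "Z h c \<chi> S = Z h c \<chi>' S" if "\<And>T. T \<in> P \<Longrightarrow> \<chi> T = \<chi>' T" for \<chi> \<chi>'
    unfolding Z_def by (rule sum.cong) (auto simp: sT that P_def)
  ultimately show ?thesis using that by blast
qed

end

section \<open>The symplectic pairing of modes and the six-term identity\<close>

definition psgn :: "int \<Rightarrow> complex" where
  "psgn q = (if even q then 1 else -1)"

lemma psgn_nz [simp]: "psgn q \<noteq> 0"
  by (simp add: psgn_def)

lemma psgn_add: "psgn (p + q) = psgn p * psgn q"
  by (auto simp: psgn_def)

lemma psgn_diff: "psgn (p - q) = psgn p * psgn q"
  by (auto simp: psgn_def)

lemma psgn_sq [simp]: "psgn q * psgn q = 1" "psgn q * (psgn q * z) = z"
  by (auto simp: psgn_def)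

locale symplectic_fock =
  fixes n i :: nat
  assumes n_pos: "n \<ge> 1" and i_le: "i \<le> n"

sublocale symplectic_fock \<subseteq> fermions "int i" .

context symplectic_fock
begin

definition per :: int where "per = 2 * int n"

lemma per_pos: "per \<ge> 2" and per_even: "even per"
  using n_pos by (auto simp: per_def)

text \<open>Coefficients of the symmetric product of colours x and y. Removing a fermion whose
  letter is the bar of y amounts to adding colour y, and the sign comes from the symplectic
  form.\<close>

definition Jcol :: "int \<Rightarrow> int \<Rightarrow> int \<Rightarrow> complex" where
  "Jcol x y q = psgn q * (of_bool (per dvd q + y - 1) + of_bool (per dvd q + x - 1))"

definition hgt :: "int \<Rightarrow> int \<Rightarrow> int \<Rightarrow> int" where
  "hgt k x y = per * k + x + y - per - 1"

definition J :: "int \<Rightarrow> int \<Rightarrow> int \<Rightarrow> fock \<Rightarrow> fock" where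
  "J k x y = Z (hgt k x y) (Jcol x y)"

definition A :: "int \<Rightarrow> int \<Rightarrow> fock \<Rightarrow> fock" where
  "A x k = u (x + per * k)"

text \<open>Colour y once more, realised by removing the barred mode. The period is oriented so that
  \<open>A x k\<close> followed or preceded by \<open>B y l\<close> has degree k + l.\<close>

definition B :: "int \<Rightarrow> int \<Rightarrow> fock \<Rightarrow> fock" where
  "B y k \<phi> = fscale (psgn (1 - y)) (d (per + 1 - y - per * k) \<phi>)"

lemma flinear_A: "flinear (A x k)"
  by (simp add: A_def flinear_u)

lemma flinear_B: "flinear (B y k)"
  by (rule flinearI) (auto simp: B_def d_simps fpt algebra_simps)

lemmas A_simps = flinear_simps[OF flinear_A]
lemmas B_simps = flinear_simps[OF flinear_B]

lemma A_A: "A x k (A y l \<phi>) = - A y l (A x k \<phi>)"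
  unfolding A_def by (rule u_u)

lemma B_B: "B x k (B y l \<phi>) = - B y l (B x k \<phi>)"
  unfolding B_def d_simps by (subst d_d) (simp add: fpt)

definition \<omega> :: "int \<Rightarrow> int \<Rightarrow> int \<Rightarrow> int \<Rightarrow> complex" where
  "\<omega> y k z l = psgn (1 - y) * of_bool (y + z + per * (k + l) = per + 1)"

lemma B_A: "B y k (A z l \<phi>) = fscale (\<omega> y k z l) \<phi> - A z l (B y k \<phi>)"
proof -
  have "(z + per * l = per + 1 - y - per * k) = (y + z + per * (k + l) = per + 1)"
    by (auto simp: algebra_simps)
  then show ?thesis
    by (auto simp: A_def B_def \<omega>_def d_u u_simps fpt algebra_simps)
qed

text \<open>A nonzero value forces y + z to be odd, since the period is even; the two signs are then
  opposite.\<close>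

lemma \<omega>_anti: "\<omega> y k z l = - \<omega> z k y l"
proof -
  have "odd (y + z)" if "y + z + per * (k + l) = per + 1"
  proof -
    have "y + z = per * (1 - (k + l)) + 1" using that by (simp add: algebra_simps)
    then show ?thesis using per_even by simp
  qed
  then show ?thesis by (auto simp: \<omega>_def psgn_def algebra_simps)
qed

definition AB :: "int \<Rightarrow> int \<Rightarrow> int \<Rightarrow> int \<Rightarrow> fock \<Rightarrow> fock" where
  "AB x y k l \<phi> = A x k (B y l \<phi>) + A y k (B x l \<phi>)"

lemma flinear_AB: "flinear (AB x y k l)"
  by (rule flinearI) (auto simp: AB_def A_simps B_simps fpt algebra_simps)

text \<open>The six ordered ways to split four colours into two symmetric pairs. The degrees belong
  to the places in the product, not to the colours.\<close>

definition V :: "int \<Rightarrow> int \<Rightarrow> int \<Rightarrow> int \<Rightarrow> int \<Rightarrow> int \<Rightarrow> int \<Rightarrow> int \<Rightarrow> fock \<Rightarrow> fock" where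
  "V a b c e k1 k2 k3 k4 \<phi> = AB a b k1 k2 (AB c e k3 k4 \<phi>) + 
    AB a c k1 k2 (AB b e k3 k4 \<phi>) + 
    AB a e k1 k2 (AB b c k3 k4 \<phi>) + 
    AB c e k1 k2 (AB a b k3 k4 \<phi>) + 
    AB b e k1 k2 (AB a c k3 k4 \<phi>) + 
    AB b c k1 k2 (AB a e k3 k4 \<phi>)"

definition AABB :: "int \<Rightarrow> int \<Rightarrow> int \<Rightarrow> int \<Rightarrow> int \<Rightarrow> int \<Rightarrow> int \<Rightarrow> int \<Rightarrow> fock \<Rightarrow> fock" where
  "AABB x z y t k1 k2 k3 k4 \<phi> = A x k1 (A z k3 (B y k2 (B t k4 \<phi>)))"

lemma ABAB:
  "A x k1 (B y k2 (A z k3 (B t k4 \<phi>))) = fscale (\<omega> y k2 z k3) (A x k1 (B t k4 \<phi>)) - AABB x z y t k1 k2 k3 k4 \<phi>"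
  by (simp add: B_A A_simps AABB_def)

lemma ABAB':
  "A z k3 (B t k4 (A x k1 (B y k2 \<phi>))) = fscale (\<omega> t k4 x k1) (A z k3 (B y k2 \<phi>)) - AABB x z y t k1 k2 k3 k4 \<phi>"
proof -
  have "A z k3 (A x k1 (B t k4 (B y k2 \<phi>))) = AABB x z y t k1 k2 k3 k4 \<phi>"
    unfolding AABB_def by (subst A_A, subst B_B) (simp add: A_simps)
  then show ?thesis by (simp add: B_A A_simps)
qed

lemma AABB_swap: "AABB x z y t k1 k4 k3 k2 \<phi> = - AABB x z t y k1 k2 k3 k4 \<phi>"
  unfolding AABB_def by (subst B_B) (simp add: A_simps)

definition quartic :: "int \<Rightarrow> int \<Rightarrow> int \<Rightarrow> int \<Rightarrow> int \<Rightarrow> int \<Rightarrow> int \<Rightarrow> int \<Rightarrow> fock \<Rightarrow> fock" where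
  "quartic a b c e k1 k2 k3 k4 \<phi> =
    AABB a c b e k1 k2 k3 k4 \<phi> +
    AABB a e b c k1 k2 k3 k4 \<phi> +
    AABB b c a e k1 k2 k3 k4 \<phi> +
    AABB b e a c k1 k2 k3 k4 \<phi> +
    AABB a b c e k1 k2 k3 k4 \<phi> +
    AABB a e c b k1 k2 k3 k4 \<phi> +
    AABB c b a e k1 k2 k3 k4 \<phi> +
    AABB c e a b k1 k2 k3 k4 \<phi> +
    AABB a b e c k1 k2 k3 k4 \<phi> +
    AABB a c e b k1 k2 k3 k4 \<phi> +
    AABB e b a c k1 k2 k3 k4 \<phi> +
    AABB e c a b k1 k2 k3 k4 \<phi> +
    AABB c a e b k1 k2 k3 k4 \<phi> +
    AABB c b e a k1 k2 k3 k4 \<phi> +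
    AABB e a c b k1 k2 k3 k4 \<phi> +
    AABB e b c a k1 k2 k3 k4 \<phi> +
    AABB b a e c k1 k2 k3 k4 \<phi> +
    AABB b c e a k1 k2 k3 k4 \<phi> +
    AABB e a b c k1 k2 k3 k4 \<phi> +
    AABB e c b a k1 k2 k3 k4 \<phi> +
    AABB b a c e k1 k2 k3 k4 \<phi> +
    AABB b e c a k1 k2 k3 k4 \<phi> +
    AABB c a b e k1 k2 k3 k4 \<phi> +
    AABB c e b a k1 k2 k3 k4 \<phi>"

text \<open>The contractions cancel because the symplectic form \<open>\<omega>\<close> is antisymmetric while \<open>AB\<close> is
  symmetric in its colours.\<close>

lemma V_quartic: "V a b c e k1 k2 k3 k4 \<phi> = - quartic a b c e k1 k2 k3 k4 \<phi>"
  unfolding V_def AB_def B_simps A_simps ABAB quartic_def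
  by (simp add: fpt \<omega>_anti[of b k2 c] \<omega>_anti[of b k2 e] \<omega>_anti[of c k2 e] \<omega>_anti[of a k2 b] \<omega>_anti[of a k2 c] \<omega>_anti[of a k2 e])

text \<open>With the two factors of every product reversed the contractions cancel as well and the
  same quartic expression remains. Hence the factors, with their degrees, may be exchanged.\<close>

lemma V_quartic':
  "AB c e k3 k4 (AB a b k1 k2 \<phi>) + 
    AB b e k3 k4 (AB a c k1 k2 \<phi>) + 
    AB b c k3 k4 (AB a e k1 k2 \<phi>) + 
    AB a b k3 k4 (AB c e k1 k2 \<phi>) + 
    AB a c k3 k4 (AB b e k1 k2 \<phi>) + 
    AB a e k3 k4 (AB b c k1 k2 \<phi>)
   = - quartic a b c e k1 k2 k3 k4 \<phi>"
  unfolding AB_def B_simps A_simps ABAB' quartic_def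
  by (simp add: fpt \<omega>_anti[of b k4 c] \<omega>_anti[of b k4 e] \<omega>_anti[of c k4 e] \<omega>_anti[of a k4 b] \<omega>_anti[of a k4 c] \<omega>_anti[of a k4 e])

text \<open>\<open>quartic\<close> runs over all 24 distributions of the colours, so exchanging the
  degrees of the two \<open>B\<close> factors is undone by relabelling colours, at the cost of the
  sign in \<open>B_B\<close>.\<close>

lemma V_swap: "V a b c e k1 k4 k3 k2 \<phi> = - V a b c e k1 k2 k3 k4 \<phi>"
  unfolding V_quartic quartic_def by (simp add: AABB_swap[of _ _ _ _ k1 k4 k3 k2] fpt)

text \<open>The current \<open>J\<close> cut off to finitely many fermion modes, so that sums over all degrees may be
  rearranged.\<close>

definition JT :: "int \<Rightarrow> int \<Rightarrow> int \<Rightarrow> int \<Rightarrow> fock \<Rightarrow> fock" where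
  "JT \<kappa> m x y \<phi> = (\<Sum>k=-\<kappa>..\<kappa>. \<Sum>l=-\<kappa>..\<kappa>. if k + l = m then AB x y k l \<phi> else 0)"

lemma JT_simps_apply: "JT \<kappa> m x y \<phi> S = (\<Sum>k=-\<kappa>..\<kappa>. \<Sum>l=-\<kappa>..\<kappa>. if k + l = m then AB x y k l \<phi> S else 0)"
  by (simp add: JT_def sum_fun_apply if_distribR) (simp add: if_distrib[of "\<lambda>f. f S"] cong: if_cong)

lemma reindex_class:
  fixes g :: "int \<Rightarrow> complex"
  assumes g0: "\<And>q. \<bar>q\<bar> > R \<Longrightarrow> g q = 0" and "1 \<le> y" "y \<le> per" "\<kappa> \<ge> R + 3" "R \<ge> 0"
  shows "(\<Sum>q=-R..R. of_bool (per dvd q + y - 1) * g q) = (\<Sum>l=-\<kappa>..\<kappa>. g (per + 1 - y - per * l))"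
proof -
  have "(\<Sum>q=-R..R. of_bool (per dvd q + y - 1) * g q) = (\<Sum>q | q \<in> {-R..R} \<and> per dvd q + y - 1. g q)"
    by (rule sum.mono_neutral_cong_right) auto
  also have "\<dots> = (\<Sum>q\<in>(\<lambda>l. per + 1 - y - per * l) ` {-\<kappa>..\<kappa>}. g q)"
  proof (rule sum.mono_neutral_left)
    show "{q \<in> {-R..R}. per dvd q + y - 1} \<subseteq> (\<lambda>l. per + 1 - y - per * l) ` {-\<kappa>..\<kappa>}"
    proof
      fix q assume q: "q \<in> {q \<in> {-R..R}. per dvd q + y - 1}"
      then obtain t where t: "q + y - 1 = per * t" by (auto elim: dvdE)
      have "\<bar>per * t\<bar> \<le> R + per" using t q assms by auto
      then have "\<bar>t\<bar> \<le> R + 1"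
      proof -
        assume a: "\<bar>per * t\<bar> \<le> R + per"
        have "per * \<bar>t\<bar> \<le> R + per" using a per_pos by (simp add: abs_mult)
        also have "\<dots> \<le> per * (R + 1)"
          using per_pos \<open>R \<ge> 0\<close> mult_mono[of 1 per R R] by (simp add: algebra_simps)
        finally show ?thesis using per_pos by (simp add: mult_le_cancel_left)
      qed
      then have "1 - t \<in> {-\<kappa>..\<kappa>}" using assms by auto
      moreover have "q = per + 1 - y - per * (1 - t)" using t by (simp add: algebra_simps)
      ultimately show "q \<in> (\<lambda>l. per + 1 - y - per * l) ` {-\<kappa>..\<kappa>}" by blast
    qed
    show "\<forall>q\<in>(\<lambda>l. per + 1 - y - per * l) ` {-\<kappa>..\<kappa>} - {q \<in> {-R..R}. per dvd q + y - 1}. g q = 0"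
    proof
      fix q assume q: "q \<in> (\<lambda>l. per + 1 - y - per * l) ` {-\<kappa>..\<kappa>} - {q \<in> {-R..R}. per dvd q + y - 1}"
      then obtain l where "q = per + 1 - y - per * l" by auto
      then have "q + y - 1 = per * (1 - l)" by (simp add: algebra_simps)
      then have "per dvd q + y - 1" by simp
      with q show "g q = 0" by (auto intro: g0)
    qed
  qed auto
  also have "\<dots> = (\<Sum>l=-\<kappa>..\<kappa>. g (per + 1 - y - per * l))"
    by (subst sum.reindex) (use per_pos in \<open>auto simp: inj_on_def\<close>)
  finally show ?thesis .
qed

text \<open>A cut-off sum carries no normal ordering, so the corrections must cancel. For height 0
  the sum x + y is odd, hence the two terms have opposite signs, and both modes reach the
  nonpositive side at l = 1. The bound is uniform in the argument, as compositions require.\<close>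

lemma JT_eventually:
  assumes x: "1 \<le> x" "x \<le> per" and y: "1 \<le> y" "y \<le> per"
  shows "\<exists>\<kappa>0. \<forall>\<kappa>\<ge>\<kappa>0. \<forall>\<phi>. JT \<kappa> m x y \<phi> S = J m x y \<phi> S"
proof -
  define h where "h = hgt m x y"
  define R where "R = bnd S + \<bar>h\<bar>"
  have R0: "R \<ge> 0" using bnd_lev[of S] by (simp add: R_def)
  have "JT \<kappa> m x y \<phi> S = J m x y \<phi> S" if \<kappa>: "\<kappa> \<ge> R + \<bar>m\<bar> + 3" for \<kappa> \<phi>
  proof -
    define g where "g q = psgn q * nord (q + h) q \<phi> S" for q
    have g0: "g q = 0" if "\<bar>q\<bar> > R" for q
      using that nord_far[of S h q \<phi>] by (simp add: g_def R_def)
    have "J m x y \<phi> S = (\<Sum>q=-R..R. of_bool (per dvd q + y - 1) * g q + of_bool (per dvd q + x - 1) * g q)"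
      unfolding J_def Z_def h_def[symmetric] R_def[symmetric]
      by (rule sum.cong) (auto simp: Jcol_def g_def algebra_simps)
    also have "\<dots> = (\<Sum>l=-\<kappa>..\<kappa>. g (per + 1 - y - per * l)) + (\<Sum>l=-\<kappa>..\<kappa>. g (per + 1 - x - per * l))"
      unfolding sum.distrib using reindex_class[of R g y \<kappa>] reindex_class[of R g x \<kappa>] g0 x y \<kappa> R0 by simp
    also have "\<dots> = (\<Sum>l=-\<kappa>..\<kappa>. g (per + 1 - y - per * l) + g (per + 1 - x - per * l))"
      by (simp add: sum.distrib)
    also have "\<dots> = (\<Sum>l=-\<kappa>..\<kappa>. if m - l \<in> {-\<kappa>..\<kappa>} then AB x y (m - l) l \<phi> S else 0)"
    proof (rule sum.cong[OF refl])
      fix l assume l: "l \<in> {-\<kappa>..\<kappa>}"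
      show "g (per + 1 - y - per * l) + g (per + 1 - x - per * l) = (if m - l \<in> {-\<kappa>..\<kappa>} then AB x y (m - l) l \<phi> S else 0)"
      proof (cases "m - l \<in> {-\<kappa>..\<kappa>}")
        case False
        \<comment> \<open>If m - l leaves the cut-off range then l is so large that both modes lie
          outside the window of S, so the discarded terms are zero.\<close>
        then have far: "\<bar>l\<bar> \<ge> R + 3" using \<kappa> by auto
        have "\<bar>per + 1 - z - per * l\<bar> > R" if "1 \<le> z" "z \<le> per" for z
        proof -
          have "\<bar>per * l\<bar> \<ge> per * (R + 3)" using far per_pos by (simp add: abs_mult)
          moreover have "per * (R + 3) \<ge> per + per + per + R" using per_pos R0
            mult_mono[of 1 per R R] by (simp add: algebra_simps)
          ultimately show ?thesis using that per_pos by linarith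
        qed
        then show ?thesis using False x y g0 by auto
      next
        case True
        have sg: "psgn (per + 1 - z - per * l) = psgn (1 - z)" for z
          by (simp add: psgn_diff psgn_add psgn_def per_even)
        have hy: "per + 1 - y - per * l + h = x + per * (m - l)" "per + 1 - x - per * l + h = y + per * (m - l)"
          by (auto simp: h_def hgt_def algebra_simps)
        have AB: "AB x y (m - l) l \<phi> S = psgn (1 - y) * u (x + per * (m - l)) (d (per + 1 - y - per * l) \<phi>) S
            + psgn (1 - x) * u (y + per * (m - l)) (d (per + 1 - x - per * l) \<phi>) S"
          by (simp add: AB_def A_def B_def u_simps fscale_apply)
        have "psgn (1 - y) * of_bool (h = 0 \<and> per + 1 - y - per * l \<le> 0) + psgn (1 - x) * of_bool (h = 0 \<and> per + 1 - x - per * l \<le> 0) = 0"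
        proof (cases "h = 0")
          case True
          then have e: "x + y = per * (1 - m) + 1" by (simp add: h_def hgt_def algebra_simps)
          have "odd (x + y)" unfolding e using per_even by simp
          then have s: "psgn (1 - y) = - psgn (1 - x)" by (auto simp: psgn_def)
          have "per + 1 - z - per * l \<le> 0 \<longleftrightarrow> l \<ge> 1" if "1 \<le> z" "z \<le> per" for z
          proof
            assume "l \<ge> 1"
            then have "per * l \<ge> per * 1" using per_pos by (intro mult_left_mono) auto
            then show "per + 1 - z - per * l \<le> 0" using that by linarith
          next
            assume *: "per + 1 - z - per * l \<le> 0"
            show "l \<ge> 1"
            proof (rule ccontr)
              assume "\<not> l \<ge> 1"
              then have "per * l \<le> per * 0" using per_pos by (intro mult_left_mono) auto
              then show False using * that by linarith
            qed
          qed
          then show ?thesis using x y s by simp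
        qed auto
        then have "psgn (1 - y) * of_bool (h = 0 \<and> per + 1 - y - per * l \<le> 0) * \<phi> S + psgn (1 - x) * of_bool (h = 0 \<and> per + 1 - x - per * l \<le> 0) * \<phi> S = 0"
          by (metis distrib_right mult_zero_left)
        moreover have "x + per * (m - l) = per + 1 - y - per * l \<longleftrightarrow> h = 0" "y + per * (m - l) = per + 1 - x - per * l \<longleftrightarrow> h = 0"
          unfolding hy[symmetric] by auto
        ultimately show ?thesis
          using True unfolding g_def hy sg AB nord_def by (auto simp: right_diff_distrib minus_equation_iff add_eq_0_iff)
      qed
    qed
    also have "\<dots> = (\<Sum>l=-\<kappa>..\<kappa>. \<Sum>k=-\<kappa>..\<kappa>. if k + l = m then AB x y k l \<phi> S else 0)"
    proof (rule sum.cong[OF refl])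
      fix l
      have "(\<Sum>k=-\<kappa>..\<kappa>. if k + l = m then AB x y k l \<phi> S else 0) = (\<Sum>k=-\<kappa>..\<kappa>. if k = m - l then AB x y (m - l) l \<phi> S else 0)"
        by (rule sum.cong) auto
      then show "(if m - l \<in> {-\<kappa>..\<kappa>} then AB x y (m - l) l \<phi> S else 0) = (\<Sum>k=-\<kappa>..\<kappa>. if k + l = m then AB x y k l \<phi> S else 0)"
        by simp
    qed
    also have "\<dots> = JT \<kappa> m x y \<phi> S"
      unfolding JT_simps_apply by (rule sum.swap)
    finally show ?thesis ..
  qed
  then show ?thesis by blast
qed

end

section \<open>The quadratic relation, first with a cut-off and then for the full currents\<close>

context symplectic_fock
begin

definition splits :: "int \<Rightarrow> int \<Rightarrow> (int \<times> int) set" where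
  "splits \<kappa> m = {(k, l). k \<in> {-\<kappa>..\<kappa>} \<and> l \<in> {-\<kappa>..\<kappa>} \<and> k + l = m}"

lemma finite_splits: "finite (splits \<kappa> m)"
  by (rule finite_subset[of _ "{-\<kappa>..\<kappa>} \<times> {-\<kappa>..\<kappa>}"]) (auto simp: splits_def)

lemma JT_splits: "JT \<kappa> m x y \<phi> = (\<Sum>p\<in>splits \<kappa> m. AB x y (fst p) (snd p) \<phi>)"
proof -
  have "JT \<kappa> m x y \<phi> = (\<Sum>p\<in>{-\<kappa>..\<kappa>}\<times>{-\<kappa>..\<kappa>}. if fst p + snd p = m then AB x y (fst p) (snd p) \<phi> else 0)"
    unfolding JT_def by (simp add: sum.cartesian_product split_def)
  also have "\<dots> = (\<Sum>p\<in>splits \<kappa> m. AB x y (fst p) (snd p) \<phi>)"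
    by (rule sum.mono_neutral_cong_right) (auto simp: splits_def)
  finally show ?thesis .
qed

lemmas AB_simps = flinear_simps[OF flinear_AB]

lemma JT_JT: "JT \<kappa> m x y (JT \<kappa> l z t \<phi>) =
  (\<Sum>p\<in>splits \<kappa> m. \<Sum>r\<in>splits \<kappa> l. AB x y (fst p) (snd p) (AB z t (fst r) (snd r) \<phi>))"
  by (simp add: JT_splits AB_simps)

definition U6 :: "(int \<Rightarrow> int \<Rightarrow> int \<Rightarrow> fock \<Rightarrow> fock) \<Rightarrow> int \<Rightarrow> int \<Rightarrow> int \<Rightarrow> int \<Rightarrow> int \<Rightarrow> int \<Rightarrow> fock \<Rightarrow> fock" where
  "U6 F a b c e m l \<phi> = F m a b (F l c e \<phi>) + F m a c (F l b e \<phi>) + F m a e (F l b c \<phi>)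
     + F m c e (F l a b \<phi>) + F m b e (F l a c \<phi>) + F m b c (F l a e \<phi>)"

lemma U6_JT: "U6 (JT \<kappa>) a b c e m l \<phi> =
  (\<Sum>p\<in>splits \<kappa> m. \<Sum>r\<in>splits \<kappa> l. V a b c e (fst p) (snd p) (fst r) (snd r) \<phi>)"
  unfolding U6_def JT_JT V_def sum.distrib[symmetric] by (simp add: sum.distrib)

lemma V_flip: "V a b c e k3 k4 k1 k2 \<phi> = V a b c e k1 k2 k3 k4 \<phi>"
  unfolding V_quartic[of a b c e k1 k2 k3 k4 \<phi>] V_quartic'[symmetric] unfolding V_def by (simp add: add_ac)

lemma U6_JT_flip: "U6 (JT \<kappa>) a b c e m l \<phi> = U6 (JT \<kappa>) a b c e l m \<phi>"
  unfolding U6_JT by (subst sum.swap) (simp add: V_flip)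

text \<open>The sum runs over all quadruples of cut-off degrees with total K; the bound on M makes
  every value of k1 + k2 occur. Exchanging k2 and k4 permutes the quadruples and reverses all signs
  by \<open>V_swap\<close>.\<close>

lemma U6_JT_total:
  assumes "M \<ge> 2 * \<kappa>"
  shows "(\<Sum>m=-M..M. U6 (JT \<kappa>) a b c e m (K - m) \<phi>) = 0"
proof -
  define C where "C = {(k1, k2, k3, k4). k1 \<in> {-\<kappa>..\<kappa>} \<and> k2 \<in> {-\<kappa>..\<kappa>} \<and> k3 \<in> {-\<kappa>..\<kappa>} \<and> k4 \<in> {-\<kappa>..\<kappa>}
      \<and> k1 + k2 + k3 + k4 = K}"
  have "(\<Sum>m=-M..M. U6 (JT \<kappa>) a b c e m (K - m) \<phi>) =
      (\<Sum>(m, p, r)\<in>Sigma {-M..M} (\<lambda>m. splits \<kappa> m \<times> splits \<kappa> (K - m)). V a b c e (fst p) (snd p) (fst r) (snd r) \<phi>)"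
    unfolding U6_JT sum.cartesian_product
    by (subst sum.Sigma) (auto simp: finite_splits split_def)
  also have "\<dots> = (\<Sum>(k1, k2, k3, k4)\<in>C. V a b c e k1 k2 k3 k4 \<phi>)"
    by (rule sum.reindex_bij_witness[where j = "\<lambda>(m, p, r). (fst p, snd p, fst r, snd r)"
          and i = "\<lambda>(k1, k2, k3, k4). (k1 + k2, (k1, k2), (k3, k4))"])
      (use assms in \<open>auto simp: C_def splits_def\<close>)
  finally have eq: "(\<Sum>m=-M..M. U6 (JT \<kappa>) a b c e m (K - m) \<phi>) = (\<Sum>(k1, k2, k3, k4)\<in>C. V a b c e k1 k2 k3 k4 \<phi>)" .
  have "(\<Sum>(k1, k2, k3, k4)\<in>C. V a b c e k1 k2 k3 k4 \<phi>) = (\<Sum>(k1, k2, k3, k4)\<in>C. V a b c e k1 k4 k3 k2 \<phi>)"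
    by (rule sum.reindex_bij_witness[where j = "\<lambda>(k1, k2, k3, k4). (k1, k4, k3, k2)"
          and i = "\<lambda>(k1, k2, k3, k4). (k1, k4, k3, k2)"]) (auto simp: C_def)
  also have "\<dots> = - (\<Sum>(k1, k2, k3, k4)\<in>C. V a b c e k1 k2 k3 k4 \<phi>)"
    unfolding sum_negf[symmetric] by (rule sum.cong[OF refl]) (clarsimp, rule V_swap)
  finally show ?thesis unfolding eq by (simp add: fun_eq_iff)
qed

lemma flinear_J: "flinear (J m x y)"
  by (simp add: J_def flinear_Z)

lemmas J_lin = flinear_simps[OF flinear_J]

text \<open>The outer factor becomes exact at S first; then the inner factor has to be exact only at
  the finitely many states on which that coefficient depends.\<close>

lemma JT_JT_eventually:
  assumes "1 \<le> a" "a \<le> per" "1 \<le> b" "b \<le> per" "1 \<le> c" "c \<le> per" "1 \<le> e" "e \<le> per"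
  shows "\<exists>\<kappa>0. \<forall>\<kappa>\<ge>\<kappa>0. JT \<kappa> m a b (JT \<kappa> l c e \<phi>) S = J m a b (J l c e \<phi>) S"
proof -
  obtain P where P: "finite P" "\<And>\<chi> \<chi>'. (\<And>T. T \<in> P \<Longrightarrow> \<chi> T = \<chi>' T) \<Longrightarrow> J m a b \<chi> S = J m a b \<chi>' S"
    using Z_local[of "hgt m a b" "Jcol a b" S] unfolding J_def by metis
  have "\<forall>T. \<exists>\<kappa>0. \<forall>\<kappa>\<ge>\<kappa>0. \<forall>\<phi>. JT \<kappa> l c e \<phi> T = J l c e \<phi> T"
    using JT_eventually assms by blast
  then obtain k where k: "\<And>T \<kappa> \<phi>. \<kappa> \<ge> k T \<Longrightarrow> JT \<kappa> l c e \<phi> T = J l c e \<phi> T" by metis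
  obtain k' where k': "\<And>\<kappa> \<phi>. \<kappa> \<ge> k' \<Longrightarrow> JT \<kappa> m a b \<phi> S = J m a b \<phi> S"
    using JT_eventually assms by blast
  define \<kappa>0 where "\<kappa>0 = max k' (\<Sum>T\<in>P. \<bar>k T\<bar>)"
  have "JT \<kappa> m a b (JT \<kappa> l c e \<phi>) S = J m a b (J l c e \<phi>) S" if "\<kappa> \<ge> \<kappa>0" for \<kappa>
  proof -
    have *: "JT \<kappa> l c e \<phi> T = J l c e \<phi> T" if "T \<in> P" for T
    proof (rule k)
      have "\<bar>k T\<bar> \<le> (\<Sum>T\<in>P. \<bar>k T\<bar>)" using P(1) that by (intro member_le_sum) auto
      moreover have "(\<Sum>T\<in>P. \<bar>k T\<bar>) \<le> \<kappa>" using \<open>\<kappa> \<ge> \<kappa>0\<close> by (simp add: \<kappa>0_def)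
      ultimately show "\<kappa> \<ge> k T" by linarith
    qed
    have "JT \<kappa> m a b (JT \<kappa> l c e \<phi>) S = J m a b (JT \<kappa> l c e \<phi>) S"
      by (rule k') (use that in \<open>simp add: \<kappa>0_def\<close>)
    also have "\<dots> = J m a b (J l c e \<phi>) S" by (rule P(2)) (rule *)
    finally show ?thesis .
  qed
  then show ?thesis by blast
qed

lemma U6_eventually:
  assumes "1 \<le> a" "a \<le> per" "1 \<le> b" "b \<le> per" "1 \<le> c" "c \<le> per" "1 \<le> e" "e \<le> per"
  shows "\<exists>\<kappa>0. \<forall>\<kappa>\<ge>\<kappa>0. U6 (JT \<kappa>) a b c e m l \<phi> S = U6 J a b c e m l \<phi> S"
proof -
  note ev = JT_JT_eventually[where m = m and l = l and \<phi> = \<phi> and S = S]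
  obtain k1 where k1: "\<And>\<kappa>. \<kappa> \<ge> k1 \<Longrightarrow> JT \<kappa> m a b (JT \<kappa> l c e \<phi>) S = J m a b (J l c e \<phi>) S" using ev[of a b c e] assms by blast
  obtain k2 where k2: "\<And>\<kappa>. \<kappa> \<ge> k2 \<Longrightarrow> JT \<kappa> m a c (JT \<kappa> l b e \<phi>) S = J m a c (J l b e \<phi>) S" using ev[of a c b e] assms by blast
  obtain k3 where k3: "\<And>\<kappa>. \<kappa> \<ge> k3 \<Longrightarrow> JT \<kappa> m a e (JT \<kappa> l b c \<phi>) S = J m a e (J l b c \<phi>) S" using ev[of a e b c] assms by blast
  obtain k4 where k4: "\<And>\<kappa>. \<kappa> \<ge> k4 \<Longrightarrow> JT \<kappa> m c e (JT \<kappa> l a b \<phi>) S = J m c e (J l a b \<phi>) S" using ev[of c e a b] assms by blast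
  obtain k5 where k5: "\<And>\<kappa>. \<kappa> \<ge> k5 \<Longrightarrow> JT \<kappa> m b e (JT \<kappa> l a c \<phi>) S = J m b e (J l a c \<phi>) S" using ev[of b e a c] assms by blast
  obtain k6 where k6: "\<And>\<kappa>. \<kappa> \<ge> k6 \<Longrightarrow> JT \<kappa> m b c (JT \<kappa> l a e \<phi>) S = J m b c (J l a e \<phi>) S" using ev[of b c a e] assms by blast
  have "U6 (JT \<kappa>) a b c e m l \<phi> S = U6 J a b c e m l \<phi> S" if "\<kappa> \<ge> max k1 (max k2 (max k3 (max k4 (max k5 k6))))" for \<kappa>
    using that by (simp add: U6_def k1 k2 k3 k4 k5 k6)
  then show ?thesis by blast
qed

lemma JT_high:
  assumes "1 \<le> x" "1 \<le> y" "per * m > 2 * bnd S + per + 1"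
  shows "JT \<kappa> m x y \<chi> S = 0"
proof -
  have gap: "x + per * k - (per + 1 - y - per * l) > 2 * bnd S" if "k + l = m" "1 \<le> x" "1 \<le> y" for k l x y
  proof -
    have "per * k + per * l = per * m" using that(1) by (simp flip: distrib_left)
    then show ?thesis using assms that by linarith
  qed
  have "AB x y k l \<chi> S = 0" if "k + l = m" for k l
    using that assms ud_high[OF gap[of k l x y], of \<chi>] ud_high[OF gap[of k l y x], of \<chi>]
    by (simp add: AB_def A_def B_def u_simps fscale_apply)
  then show ?thesis by (auto simp: JT_simps_apply intro!: sum.neutral)
qed

text \<open>With the larger degree on the left, summands outside the range vanish at S already for
  the cut-off operators, by \<open>JT_high\<close>. The vanishing total can thus be restricted to a
  fixed range of m before the cut-off is removed.\<close>

lemma quadratic_relation_at: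
  assumes ab: "1 \<le> a" "a \<le> per" "1 \<le> b" "b \<le> per" "1 \<le> c" "c \<le> per" "1 \<le> e" "e \<le> per"
  shows "\<exists>N0. \<forall>N\<ge>N0. (\<Sum>m=-N..N. U6 J a b c e (max m (K - m)) (min m (K - m)) \<phi> S) = 0"
proof -
  define N0 where "N0 = 2 * bnd S + per + 2 + \<bar>K\<bar>"
  have b0: "bnd S \<ge> 0" using bnd_lev[of S] by linarith
  have "(\<Sum>m=-N..N. U6 J a b c e (max m (K - m)) (min m (K - m)) \<phi> S) = 0" if N: "N \<ge> N0" for N
  proof -
    have "\<forall>m. \<exists>\<kappa>0. \<forall>\<kappa>\<ge>\<kappa>0. U6 (JT \<kappa>) a b c e (max m (K - m)) (min m (K - m)) \<phi> S = U6 J a b c e (max m (K - m)) (min m (K - m)) \<phi> S"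
      using U6_eventually[OF ab] by blast
    then obtain k where k: "\<And>m \<kappa>. \<kappa> \<ge> k m \<Longrightarrow> U6 (JT \<kappa>) a b c e (max m (K - m)) (min m (K - m)) \<phi> S = U6 J a b c e (max m (K - m)) (min m (K - m)) \<phi> S"
      by metis
    \<comment> \<open>One cut-off that is exact for each of the finitely many m; only afterwards is
      M chosen so large that the cut-off total is zero.\<close>
    define \<kappa> where "\<kappa> = (\<Sum>m=-N..N. \<bar>k m\<bar>)"
    have \<kappa>: "\<kappa> \<ge> k m" if "m \<in> {-N..N}" for m
    proof -
      have "\<bar>k m\<bar> \<le> \<kappa>" unfolding \<kappa>_def using that by (intro member_le_sum) auto
      then show ?thesis by linarith
    qed
    define M where "M = max N (2 * \<kappa>)"
    have flip: "U6 (JT \<kappa>) a b c e (max m (K - m)) (min m (K - m)) \<phi> = U6 (JT \<kappa>) a b c e m (K - m) \<phi>" for m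
      using U6_JT_flip[of \<kappa> a b c e m "K - m" \<phi>] by (cases "m \<le> K - m") (auto simp: max_def min_def)
    have "(\<Sum>m=-N..N. U6 J a b c e (max m (K - m)) (min m (K - m)) \<phi> S) = (\<Sum>m=-N..N. U6 (JT \<kappa>) a b c e (max m (K - m)) (min m (K - m)) \<phi> S)"
      by (rule sum.cong) (auto simp: k[OF \<kappa>])
    also have "\<dots> = (\<Sum>m=-M..M. U6 (JT \<kappa>) a b c e (max m (K - m)) (min m (K - m)) \<phi> S)"
    proof (rule sum.mono_neutral_left)
      show "\<forall>m\<in>{-M..M} - {-N..N}. U6 (JT \<kappa>) a b c e (max m (K - m)) (min m (K - m)) \<phi> S = 0"
      proof
        fix m assume "m \<in> {-M..M} - {-N..N}"
        then have "max m (K - m) \<ge> 2 * bnd S + per + 2" using N unfolding N0_def by auto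
        then have "per * max m (K - m) \<ge> 1 * (2 * bnd S + per + 2)" using per_pos b0 by (intro mult_mono) auto
        then have "per * max m (K - m) > 2 * bnd S + per + 1" by (rule less_le_trans[rotated]) simp
        then have "JT \<kappa> (max m (K - m)) x y \<chi> S = 0" if "1 \<le> x" "1 \<le> y" for x y \<chi>
          using JT_high that by blast
        then show "U6 (JT \<kappa>) a b c e (max m (K - m)) (min m (K - m)) \<phi> S = 0"
          using ab by (simp add: U6_def)
      qed
    qed (auto simp: M_def)
    also have "\<dots> = (\<Sum>m=-M..M. U6 (JT \<kappa>) a b c e m (K - m) \<phi>) S"
      by (simp add: sum_fun_apply flip)
    also have "\<dots> = 0" by (subst U6_JT_total) (auto simp: M_def)
    finally show ?thesis .
  qed
  then show ?thesis by blast
qed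

text \<open>The smaller degree acts first and kills the vector once it is low enough, so the range
  of summation no longer depends on the coefficient inspected.\<close>

lemma quadratic_relation:
  assumes ab: "1 \<le> a" "a \<le> per" "1 \<le> b" "b \<le> per" "1 \<le> c" "c \<le> per" "1 \<le> e" "e \<le> per"
    and fin: "finsupp \<phi>"
  obtains N0 where "\<And>N. N \<ge> N0 \<Longrightarrow> (\<Sum>m=-N..N. U6 J a b c e (max m (K - m)) (min m (K - m)) \<phi>) = 0"
proof -
  obtain D where D: "\<And>h c. h < - D \<Longrightarrow> Z h c \<phi> = 0" using Z_kills[OF fin] by blast
  define N1 where "N1 = \<bar>K\<bar> + \<bar>D\<bar> + per + 1"
  have vanish: "U6 J a b c e (max m (K - m)) (min m (K - m)) \<phi> = 0" if m: "m \<notin> {-N1..N1}" for m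
  proof -
    have "min m (K - m) < - \<bar>D\<bar> - per" using m unfolding N1_def by auto
    then have "per * min m (K - m) \<le> 1 * min m (K - m)"
      using per_pos by (intro mult_right_mono_neg) auto
    then have "per * min m (K - m) < - \<bar>D\<bar> - per" using \<open>min m (K - m) < - \<bar>D\<bar> - per\<close> by (metis le_less_trans mult_1)
    then have "hgt (min m (K - m)) x y < - D" if "x \<le> per" "y \<le> per" for x y
      using that unfolding hgt_def by linarith
    then have "J (min m (K - m)) x y \<phi> = 0" if "x \<le> per" "y \<le> per" for x y
      using D that by (simp add: J_def)
    then show ?thesis using ab by (simp add: U6_def J_lin)
  qed
  have "(\<Sum>m=-N..N. U6 J a b c e (max m (K - m)) (min m (K - m)) \<phi>) = 0" if "N \<ge> N1" for N
  proof (rule ext)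
    fix S
    obtain N0 where N0: "\<And>N. N \<ge> N0 \<Longrightarrow> (\<Sum>m=-N..N. U6 J a b c e (max m (K - m)) (min m (K - m)) \<phi> S) = 0"
      using quadratic_relation_at[OF ab] by blast
    have "(\<Sum>m=-N..N. U6 J a b c e (max m (K - m)) (min m (K - m)) \<phi> S) = (\<Sum>m=-max N N0..max N N0. U6 J a b c e (max m (K - m)) (min m (K - m)) \<phi> S)"
      by (rule sum.mono_neutral_left) (use vanish \<open>N \<ge> N1\<close> in auto)
    then show "(\<Sum>m=-N..N. U6 J a b c e (max m (K - m)) (min m (K - m)) \<phi>) S = 0 S"
      using N0[of "max N N0"] by (simp add: sum_fun_apply)
  qed
  then show ?thesis using that by blast
qed

end

section \<open>Interval currents, their commutators, and reordering modulo shorter products\<close>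

context symplectic_fock
begin

text \<open>The degree is absorbed into the ends: exchanging the ends, or moving a multiple of the
  period from one to the other, leaves the operator unchanged. So any pair p, r stands for an
  interval of length at most one period.\<close>

definition X :: "int \<Rightarrow> int \<Rightarrow> fock \<Rightarrow> fock" where
  "X p r = Z (p + r - per - 1) (Jcol p r)"

lemma flinear_X: "flinear (X p r)"
  by (simp add: X_def flinear_Z)

lemmas X_simps = flinear_simps[OF flinear_X]

lemma finsupp_X: "finsupp \<phi> \<Longrightarrow> finsupp (X p r \<phi>)"
  by (simp add: X_def finsupp_Z)

lemma X_sym: "X p r = X r p"
  unfolding X_def Jcol_def by (simp add: algebra_simps)

lemma X_cong:
  assumes "p + r = p' + r'" "per dvd p - p'"
  shows "X p r = X p' r'"
proof -
  have r: "per dvd r - r'" using assms by (metis add_diff_cancel_left' diff_add_cancel diff_diff_eq2 dvd_diff_commute add.commute)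
  have "per dvd q + p - 1 \<longleftrightarrow> per dvd q + p' - 1" for q
    using dvd_add_right_iff[OF assms(2), of "q + p' - 1"] by (simp add: algebra_simps)
  moreover have "per dvd q + r - 1 \<longleftrightarrow> per dvd q + r' - 1" for q
    using dvd_add_right_iff[OF r, of "q + r' - 1"] by (simp add: algebra_simps)
  ultimately have "Jcol p r = Jcol p' r'" by (simp add: Jcol_def fun_eq_iff)
  then show ?thesis using assms(1) by (simp add: X_def)
qed

lemma J_X: "J m x y = X (x + per * m) y"
proof -
  have "per dvd q + (x + per * m) - 1 \<longleftrightarrow> per dvd q + x - 1" for q
  proof -
    have "q + (x + per * m) - 1 = per * m + (q + x - 1)" by simp
    then show ?thesis by (simp only: dvd_add_right_iff[OF dvd_triv_left])
  qed
  then have "Jcol x y = Jcol (x + per * m) y" by (simp add: Jcol_def fun_eq_iff)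
  then show ?thesis by (simp add: J_def X_def hgt_def algebra_simps)
qed

text \<open>The operators \<open>Z h c\<close> with \<open>c\<close> of period \<open>2n\<close> form the affine general linear algebra; the
  reflection condition cuts out the affine symplectic one.\<close>

definition col_type :: "int \<Rightarrow> (int \<Rightarrow> complex) \<Rightarrow> bool" where
  "col_type h c \<longleftrightarrow> (\<forall>q. c (q + per) = c q) \<and> (\<forall>q. c (1 - h - q) = - psgn h * c q)"

lemma periodic_mult:
  assumes "\<And>q. c (q + per) = (c q :: complex)"
  shows "c (q + per * t) = c q"
proof -
  have *: "c (q + per * int k) = c q" for k q
  proof (induction k)
    case (Suc k)
    have "q + per * int (Suc k) = q + per * int k + per" by (simp add: algebra_simps)
    then show ?case using Suc assms[of "q + per * int k"] by metis
  qed simp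
  show ?thesis
  proof (cases "t \<ge> 0")
    case True then show ?thesis using *[of q "nat t"] by simp
  next
    case False then show ?thesis using *[of "q + per * t" "nat (- t)"] by simp
  qed
qed

lemma sum_residue:
  fixes g :: "int \<Rightarrow> complex"
  assumes "\<And>q. g (q + per) = g q"
  shows "(\<Sum>x=1..per. g x * of_bool (per dvd q - x)) = g q"
proof -
  define r where "r = (q - 1) mod per + 1"
  have r: "r \<in> {1..per}" using per_pos pos_mod_bound[of per "q - 1"] pos_mod_sign[of per "q - 1"] unfolding r_def by (simp only: atLeastAtMost_iff) linarith
  have "q - r = per * ((q - 1) div per)"
    unfolding r_def using mult_div_mod_eq[of per "q - 1"] by linarith
  then have q: "q = r + per * ((q - 1) div per)" by linarith
  have "per dvd q - x \<longleftrightarrow> x = r" if "x \<in> {1..per}" for x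
  proof
    assume "per dvd q - x"
    moreover have "per dvd q - r" using \<open>q - r = _\<close> by simp
    ultimately have "per dvd x - r" using dvd_diff[of per "q - r" "q - x"] by simp
    moreover have "\<bar>x - r\<bar> < per" using that r by auto
    ultimately show "x = r" using dvd_imp_le_int[of "x - r" per] per_pos by auto
  qed (use q in \<open>metis add_diff_cancel_left' dvd_triv_left\<close>)
  then have "(\<Sum>x=1..per. g x * of_bool (per dvd q - x)) = (\<Sum>x=1..per. if x = r then g r else 0)"
    by (intro sum.cong) auto
  also have "\<dots> = g r" using r by simp
  also have "\<dots> = g q" using q periodic_mult[of g, OF assms, of r] by metis
  finally show ?thesis .
qed

lemma psgn_periodic: "psgn (q + per) = psgn q"
  by (simp add: psgn_def per_even)

text \<open>Summing over residues recovers the value at q and, from the second part of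
  \<open>Jcol\<close>, the equal contribution of the reflected mode 1 - h - q; hence the factor 1/2.
  This makes commutators of currents combinations of currents again.\<close>

lemma col_type_decomp:
  assumes "col_type h c"
  shows "c q = (\<Sum>x=1..per. (psgn x * c x / 2) * Jcol (h + per + x) (1 - x) q)"
proof -
  define g where "g x = psgn x * c x" for x
  have gp: "g (q + per) = g q" for q
    using assms by (simp add: g_def col_type_def psgn_periodic)
  have "per dvd q + (h + per + x) - 1 \<longleftrightarrow> per dvd (1 - h - q) - x" for x
  proof -
    have "q + (h + per + x) - 1 = per - ((1 - h - q) - x)" by simp
    then show ?thesis by (simp only: dvd_diff_right_iff[OF dvd_refl])
  qed
  then have "(\<Sum>x=1..per. (psgn x * c x / 2) * Jcol (h + per + x) (1 - x) q)
    = psgn q / 2 * ((\<Sum>x=1..per. g x * of_bool (per dvd q - x)) + (\<Sum>x=1..per. g x * of_bool (per dvd (1 - h - q) - x)))"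
    unfolding sum.distrib[symmetric] sum_distrib_left
    by (intro sum.cong) (auto simp: Jcol_def g_def algebra_simps)
  also have "\<dots> = psgn q / 2 * (g q + g (1 - h - q))" by (simp only: sum_residue[of g, OF gp])
  also have "g (1 - h - q) = psgn (1 - h - q) * (- psgn h * c q)" using assms by (simp add: g_def col_type_def)
  also have "\<dots> = g q" by (auto simp: g_def psgn_def)
  finally show ?thesis by (simp add: g_def)
qed

lemma Z_col_type:
  assumes "col_type h c"
  shows "Z h c \<phi> = (\<Sum>x=1..per. fscale (psgn x * c x / 2) (X (h + per + x) (1 - x) \<phi>))"
proof -
  have "Z h c \<phi> = Z h (\<lambda>q. \<Sum>x=1..per. (psgn x * c x / 2) * Jcol (h + per + x) (1 - x) q) \<phi>"
    by (rule Z_coeff_cong) (rule col_type_decomp[OF assms])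
  moreover have "h + per + x + (1 - x) - per - 1 = h" for x by simp
  ultimately show ?thesis by (simp only: Z_coeff_sum Z_coeff_scale X_def)
qed

lemma col_type_bracket:
  assumes "col_type h c" "col_type h' c'"
  shows "col_type (h + h') (\<lambda>q. c (q + h') * c' q - c' (q + h) * c q)"
proof -
  have 1: "c (q + per) = c q" "c' (q + per) = c' q" for q using assms by (auto simp: col_type_def)
  have 2: "c (q + per + h') = c (q + h')" "c' (q + per + h) = c' (q + h)" for q
    using 1(1)[of "q + h'"] 1(2)[of "q + h"] by (simp_all add: add_ac)
  have 3: "c (1 - h - q) = - psgn h * c q" "c' (1 - h' - q) = - psgn h' * c' q" for q
    using assms by (auto simp: col_type_def)
  have 4: "1 - (h + h') - q + h' = 1 - h - q" "1 - (h + h') - q = 1 - h' - (q + h)"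
    "1 - (h + h') - q + h = 1 - h' - q" for q by auto
  have 5: "c (1 - (h + h') - q) = - psgn h * c (q + h')" for q
    using 3(1)[of "q + h'"] by (simp add: algebra_simps)
  have 6: "c' (1 - (h + h') - q) = - psgn h' * c' (q + h)" for q
    using 3(2)[of "q + h"] by (simp add: algebra_simps)
  show ?thesis unfolding col_type_def
  proof (intro conjI allI)
    show "c (q + per + h') * c' (q + per) - c' (q + per + h) * c (q + per) = c (q + h') * c' q - c' (q + h) * c q" for q
      by (simp only: 1 2)
    show "c (1 - (h + h') - q + h') * c' (1 - (h + h') - q) - c' (1 - (h + h') - q + h) * c (1 - (h + h') - q) =
        - psgn (h + h') * (c (q + h') * c' q - c' (q + h) * c q)" for q
      unfolding 4(1,3) 5 6 unfolding 3 psgn_add by (simp add: algebra_simps)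
  qed
qed

lemma col_type_Jcol: "col_type (p + r - per - 1) (Jcol p r)"
proof -
  have a: "per dvd q + per + x - 1 \<longleftrightarrow> per dvd q + x - 1" for q x
  proof -
    have "q + per + x - 1 = per + (q + x - 1)" by simp
    then show ?thesis by (simp only: dvd_add_right_iff[OF dvd_refl])
  qed
  have b: "per dvd 1 - (p + r - per - 1) - q + r - 1 \<longleftrightarrow> per dvd q + p - 1"
    "per dvd 1 - (p + r - per - 1) - q + p - 1 \<longleftrightarrow> per dvd q + r - 1" for q
  proof -
    have "1 - (p + r - per - 1) - q + r - 1 = per - (q + p - 1)" "1 - (p + r - per - 1) - q + p - 1 = per - (q + r - 1)" by auto
    then show "per dvd 1 - (p + r - per - 1) - q + r - 1 \<longleftrightarrow> per dvd q + p - 1"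
    "per dvd 1 - (p + r - per - 1) - q + p - 1 \<longleftrightarrow> per dvd q + r - 1"
      by (simp_all only: dvd_diff_right_iff[OF dvd_refl])
  qed
  have c: "psgn (1 - (p + r - per - 1) - q) = - psgn (p + r - per - 1) * psgn q" for q
    by (auto simp: psgn_def)
  show ?thesis
    unfolding col_type_def Jcol_def by (simp only: a b c psgn_periodic) (simp add: mult.assoc add.commute)
qed

definition Xs :: "(int \<times> int) list \<Rightarrow> fock \<Rightarrow> fock" where
  "Xs l = foldr (\<lambda>(p, r). X p r) l"

lemma Xs_simps [simp]: "Xs [] \<phi> = \<phi>" "Xs (e # l) \<phi> = X (fst e) (snd e) (Xs l \<phi>)"
  by (auto simp: Xs_def split_def)

lemma Xs_append: "Xs (l @ l') \<phi> = Xs l (Xs l' \<phi>)"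
  by (induction l) auto

lemma flinear_Xs: "flinear (Xs l)"
  by (rule flinearI; induction l) (auto simp: X_simps)

lemma finsupp_Xs: "finsupp \<phi> \<Longrightarrow> finsupp (Xs l \<phi>)"
  by (induction l) (auto simp: finsupp_X)

definition ht :: "int \<times> int \<Rightarrow> int" where
  "ht e = fst e + snd e - per - 1"

abbreviation hts :: "(int \<times> int) list \<Rightarrow> int" where
  "hts l \<equiv> sum_list (map ht l)"

text \<open>The filtration by number of factors at fixed total height, as in the
  Poincare-Birkhoff-Witt theorem.\<close>

definition filt :: "nat \<Rightarrow> int \<Rightarrow> fock set" where
  "filt s H = fv.span {Xs l vac |l. length l \<le> s \<and> hts l = H}"

lemma filt_base: "length l \<le> s \<Longrightarrow> hts l = H \<Longrightarrow> Xs l vac \<in> filt s H"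
  unfolding filt_def by (rule fv.span_base) blast

lemma subspace_filt: "fv.subspace (filt s H)"
  by (simp add: filt_def)

lemma filt_X:
  assumes "\<phi> \<in> filt s H"
  shows "X p r \<phi> \<in> filt (Suc s) (H + ht (p, r))"
proof -
  have "X p r ` filt s H \<subseteq> filt (Suc s) (H + ht (p, r))"
    unfolding filt_def fvp.linear_span_image[OF flinear_X, symmetric]
  proof (rule fv.span_mono, clarify)
    fix l assume "length l \<le> s" "H = hts l"
    then show "\<exists>l'. X p r (Xs l vac) = Xs l' vac \<and> length l' \<le> Suc s \<and> hts l' = hts l + ht (p, r)"
      by (intro exI[of _ "(p, r) # l"]) auto
  qed
  then show ?thesis using assms by blast
qed

text \<open>A commutator is a combination of single currents plus a scalar. The scalar can be
  nonzero only when the two heights cancel, so the total height is kept in both cases.\<close>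

lemma X_commutator_filt:
  assumes "\<phi> = Xs l2 vac" "l = l1 @ e # e' # l2"
  shows "Xs l1 (X (fst e) (snd e) (X (fst e') (snd e') \<phi>)) - Xs l1 (X (fst e') (snd e') (X (fst e) (snd e) \<phi>))
    \<in> filt (length l - 1) (hts l)"
proof -
  let ?c = "Jcol (fst e) (snd e)" and ?c' = "Jcol (fst e') (snd e')"
  define c'' where "c'' = (\<lambda>q. ?c (q + ht e') * ?c' q - ?c' (q + ht e) * ?c q)"
  have ct: "col_type (ht e + ht e') c''"
    unfolding c''_def using col_type_Jcol by (intro col_type_bracket) (auto simp: ht_def)
  have fin: "finsupp \<phi>" by (simp add: assms finsupp_Xs)
  obtain k where k: "\<And>\<phi>. finsupp \<phi> \<Longrightarrow> Z (ht e) ?c (Z (ht e') ?c' \<phi>) = Z (ht e') ?c' (Z (ht e) ?c \<phi>) + Z (ht e + ht e') c'' \<phi> + fscale k \<phi>"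
    and k0: "ht e + ht e' \<noteq> 0 \<Longrightarrow> k = 0"
    using Z_commutator[of "ht e" ?c "ht e'" ?c'] unfolding c''_def by blast
  have eq: "X (fst e) (snd e) (X (fst e') (snd e') \<phi>) = X (fst e') (snd e') (X (fst e) (snd e) \<phi>) + Z (ht e + ht e') c'' \<phi> + fscale k \<phi>"
    using k[OF fin] by (simp add: X_def ht_def)
  have "Xs l1 (Z (ht e + ht e') c'' \<phi>) \<in> filt (length l - 1) (hts l)"
    unfolding Z_col_type[OF ct] flinear_simps[OF flinear_Xs]
  proof (intro fv.subspace_sum[OF subspace_filt] fv.subspace_scale[OF subspace_filt])
    fix x
    have "Xs l1 (X (ht e + ht e' + per + x) (1 - x) \<phi>) = Xs (l1 @ (ht e + ht e' + per + x, 1 - x) # l2) vac"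
      by (simp add: Xs_append assms)
    also have "\<dots> \<in> filt (length l - 1) (hts l)"
      by (rule filt_base) (auto simp: assms ht_def)
    finally show "Xs l1 (X (ht e + ht e' + per + x) (1 - x) \<phi>) \<in> filt (length l - 1) (hts l)" .
  qed
  moreover have "Xs l1 (fscale k \<phi>) \<in> filt (length l - 1) (hts l)"
  proof (cases "k = 0")
    case True
    then show ?thesis by (simp add: flinear_simps[OF flinear_Xs] fv.subspace_0[OF subspace_filt])
  next
    case False
    then have "ht e + ht e' = 0" using k0 by blast
    then have "Xs (l1 @ l2) vac \<in> filt (length l - 1) (hts l)"
      by (intro filt_base) (auto simp: assms)
    then show ?thesis
      by (simp add: flinear_simps[OF flinear_Xs] assms Xs_append fv.subspace_scale[OF subspace_filt])
  qed
  ultimately have "Xs l1 (Z (ht e + ht e') c'' \<phi>) + Xs l1 (fscale k \<phi>) \<in> filt (length l - 1) (hts l)"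
    by (rule fv.subspace_add[OF subspace_filt])
  then show ?thesis unfolding eq flinear_simps[OF flinear_Xs] by (simp add: add.assoc)
qed

definition eqv :: "(int \<times> int) list \<Rightarrow> (int \<times> int) list \<Rightarrow> bool" where
  "eqv l l' \<longleftrightarrow> Xs l vac - Xs l' vac \<in> filt (length l - 1) (hts l) \<and> length l = length l' \<and> hts l = hts l'"

lemma eqv_refl: "eqv l l"
  by (simp add: eqv_def fv.subspace_0[OF subspace_filt])

lemma eqv_trans: "eqv l l' \<Longrightarrow> eqv l' l'' \<Longrightarrow> eqv l l''"
  using fv.subspace_add[OF subspace_filt, of "Xs l vac - Xs l' vac" _ _ "Xs l' vac - Xs l'' vac"]
  by (auto simp: eqv_def)

lemma eqv_Cons:
  assumes "eqv l l'"
  shows "eqv (e # l) (e # l')"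
proof (cases l)
  \<comment> \<open>Subtraction is truncated: for the empty list \<open>Suc (length l - 1)\<close>
    differs from \<open>length l\<close>.\<close>
  case Nil
  then have "l' = []" using assms by (simp add: eqv_def)
  then show ?thesis using Nil by (simp add: eqv_refl)
next
  case (Cons a list)
  then have "Suc (length l - 1) = length l" by simp
  moreover have "Xs l vac - Xs l' vac \<in> filt (length l - 1) (hts l)" using assms unfolding eqv_def by blast
  from filt_X[OF this, of "fst e" "snd e"]
  have "X (fst e) (snd e) (Xs l vac - Xs l' vac) \<in> filt (Suc (length l - 1)) (hts l + ht e)" by simp
  ultimately show ?thesis using assms unfolding eqv_def by (simp only: X_simps Xs_simps) (simp add: add.commute)
qed

lemma eqv_swap: "eqv (e # e' # l) (e' # e # l)"
  using X_commutator_filt[of "Xs l vac" l "e # e' # l" "[]" e e'] by (simp add: eqv_def)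

lemma eqv_move: "eqv (e # l1 @ l2) (l1 @ e # l2)"
proof (induction l1)
  case Nil
  show ?case by (simp add: eqv_refl)
next
  case (Cons a l1)
  show ?case using eqv_trans[OF eqv_swap eqv_Cons[OF Cons]] by simp
qed

lemma eqv_perm: "mset l = mset l' \<Longrightarrow> eqv l l'"
proof (induction l arbitrary: l')
  case Nil
  then show ?case by (simp add: eqv_refl)
next
  case (Cons e l)
  then have "e \<in> set l'" by (metis list.set_intros(1) mset_eq_setD)
  then obtain l1 l2 where l': "l' = l1 @ e # l2" by (meson split_list)
  then have "mset l = mset (l1 @ l2)" using Cons.prems by simp
  then have "eqv (e # l) (e # l1 @ l2)" using Cons.IH eqv_Cons by blast
  then show ?case using eqv_move eqv_trans l' by blast
qed

lemma eqv_mem_filt: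
  assumes "eqv l l'" "Xs l' vac \<in> filt (length l - 1) (hts l)"
  shows "Xs l vac \<in> filt (length l - 1) (hts l)"
proof -
  have "Xs l vac - Xs l' vac \<in> filt (length l - 1) (hts l)" using assms(1) unfolding eqv_def by blast
  from fv.subspace_add[OF subspace_filt this assms(2)] show ?thesis by simp
qed

text \<open>Modulo shorter products the factor may be moved to the far right, where it meets the
  vacuum and leaves at most a scalar.\<close>

lemma kills_vac_filt:
  assumes "e \<in> set l" "ht e \<le> 0 \<or> X (fst e) (snd e) vac = 0"
  shows "Xs l vac \<in> filt (length l - 1) (hts l)"
proof -
  obtain l1 l2 where l: "l = l1 @ e # l2" using assms(1) by (meson split_list)
  have "mset l = mset ((l1 @ l2) @ [e])" by (simp add: l)
  then have ev: "eqv l ((l1 @ l2) @ [e])" by (rule eqv_perm)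
  have "\<exists>k. X (fst e) (snd e) vac = fscale k vac \<and> (k \<noteq> 0 \<longrightarrow> ht e = 0)"
  proof (cases "X (fst e) (snd e) vac = 0")
    case True
    then show ?thesis by (intro exI[of _ 0]) simp
  next
    case False
    then have "ht e \<le> 0" using assms(2) by blast
    then show ?thesis using Z_vac_nonpos[of "ht e" "Jcol (fst e) (snd e)"]
      by (metis X_def ht_def order_le_less)
  qed
  then obtain k where k: "X (fst e) (snd e) vac = fscale k vac" "k \<noteq> 0 \<Longrightarrow> ht e = 0" by blast
  have "Xs ((l1 @ l2) @ [e]) vac = fscale k (Xs (l1 @ l2) vac)"
    by (simp add: Xs_append k flinear_simps[OF flinear_Xs])
  moreover have "fscale k (Xs (l1 @ l2) vac) \<in> filt (length l - 1) (hts l)"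
  proof (cases "k = 0")
    case True
    then show ?thesis by (simp add: fv.subspace_0[OF subspace_filt])
  next
    case False
    then have "hts (l1 @ l2) = hts l" using k l by simp
    then show ?thesis by (intro fv.subspace_scale[OF subspace_filt] filt_base) (auto simp: l)
  qed
  ultimately show ?thesis using ev eqv_mem_filt by simp
qed

text \<open>\<open>Z_vac\<close> involves only modes q with i - h < q \<le> i. For these, q + a - 1
  and q + b - 1 lie strictly between consecutive multiples of the period, so every coefficient is
  zero.\<close>

lemma X_vac_boundary:
  assumes "b \<le> a" "a \<le> b + per" "ht (b, a) \<ge> 1" "b \<le> int i \<or> a \<le> per - int i"
  shows "X b a vac = 0"
proof -
  have ii: "2 * int i \<le> per" using i_le by (simp add: per_def)
  have lem: False if "per * t > per" "per * t < 2 * per" for t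
  proof -
    have "t > 1" using that(1) per_pos by (metis mult.right_neutral mult_less_cancel_left_pos zero_less_numeral less_le_trans)
    then have "per * t \<ge> per * 2" using per_pos by (intro mult_left_mono) auto
    then show False using that by linarith
  qed
  have lem0: False if "per * t > 0" "per * t < per" for t
  proof -
    have "t > 0" using that(1) per_pos by (simp add: zero_less_mult_iff)
    then have "per * t \<ge> per * 1" using per_pos by (intro mult_left_mono) auto
    then show False using that by linarith
  qed
  have "Jcol b a q = 0" if q: "q \<in> {int i - ht (b, a)<..int i}" for q
  proof (rule ccontr)
    assume "Jcol b a q \<noteq> 0"
    then consider "per dvd q + a - 1" | "per dvd q + b - 1"
      by (cases "per dvd q + a - 1 \<or> per dvd q + b - 1") (force simp: Jcol_def)+
    then show False
    proof cases
      case 1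
      then obtain t where t: "q + a - 1 = per * t" by (elim dvdE)
      show False
      proof (cases "b \<le> int i")
        case True
        have "per * t > per" "per * t < 2 * per" using q True assms ii unfolding t[symmetric] by (auto simp: ht_def)
        then show ?thesis by (rule lem)
      next
        case False
        then have "per * t > 0" "per * t < per" using q assms ii unfolding t[symmetric] by (auto simp: ht_def)
        then show ?thesis by (rule lem0)
      qed
    next
      case 2
      then obtain t where t: "q + b - 1 = per * t" by (elim dvdE)
      have "per * t > 0" "per * t < per" using q assms ii unfolding t[symmetric] by (auto simp: ht_def)
      then show False by (rule lem0)
    qed
  qed
  then show ?thesis
    unfolding X_def using assms(3) by (simp add: Z_vac ht_def)
qed

end

section \<open>Straightening\<close>

context symplectic_fock
begin

lemma X_eqI:
  assumes "p + r = p' + r'" "per dvd p - p' \<or> per dvd p - r'"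
  shows "X p r = X p' r'"
  using assms X_cong[of p r p' r'] X_cong[of p r r' p'] X_sym[of p' r'] by (auto simp: add.commute)

lemma per_mult_cases:
  obtains "s = 0" | "s = 1" | "s = -1" | "per * s \<ge> 2 * per" | "per * s \<le> - 2 * per"
proof -
  consider "s = 0" | "s = 1" | "s = -1" | "s \<ge> 2" | "s \<le> -2" by linarith
  then show ?thesis
  proof cases
    case 4
    then have "per * 2 \<le> per * s" using per_pos by (intro mult_left_mono) auto
    then show ?thesis using that by auto
  next
    case 5
    then have "per * s \<le> per * (-2)" using per_pos by (intro mult_left_mono) auto
    then show ?thesis using that by auto
  qed (use that in auto)
qed

text \<open>Nested intervals have the closest end sums among all ways of pairing their four ends, up
  to shifts by whole periods. A tie requires ends that agree modulo the period, and then
  \<open>X_eqI\<close> identifies the two currents with the nested ones.\<close>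

lemma nested_key:
  assumes nest: "b' \<le> b" "b \<le> a" "a \<le> a'" "a' \<le> b' + per"
    and perm: "(x, y, z, t) \<in> {(b, a, b', a'), (b, b', a, a'), (b, a', a, b')}"
  shows "\<bar>(x + y + per * s) - (z + t - per * s)\<bar> > \<bar>(b + a) - (b' + a')\<bar>
    \<or> X (x + per * s) y = X b a \<and> X (z - per * s) t = X b' a'
    \<or> X (x + per * s) y = X b' a' \<and> X (z - per * s) t = X b a" (is "?far \<or> ?same \<or> ?swap")
proof (cases ?far)
  case False
  note pp = per_pos
  have far: "\<not> \<bar>(x + y + per * s) - (z + t - per * s)\<bar> > \<bar>(b + a) - (b' + a')\<bar>" by (rule False)
  consider (1) "x = b" "y = a" "z = b'" "t = a'" | (2) "x = b" "y = b'" "z = a" "t = a'"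
    | (3) "x = b" "y = a'" "z = a" "t = b'" using perm by auto
  then show ?thesis
  proof cases
    case 1
    show ?thesis
    proof (rule per_mult_cases[of s])
      assume "s = 0"
      then show ?thesis using 1 by simp
    next
      assume s: "s = 1"
      then have "a = b" "b' = b" "a' = b + per" using 1 far nest pp by auto
      then have ?swap using 1 s by (auto intro!: X_eqI)
      then show ?thesis by blast
    next
      assume s: "s = -1"
      then have "a = b" "a' = b" "b' = b - per" using 1 far nest pp by auto
      then have ?swap using 1 s by (auto intro!: X_eqI)
      then show ?thesis by blast
    next
      assume "per * s \<ge> 2 * per" then show ?thesis using 1 far nest pp by linarith
    next
      assume "per * s \<le> - 2 * per" then show ?thesis using 1 far nest pp by linarith
    qed
  next
    case 2
    show ?thesis
    proof (rule per_mult_cases[of s])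
      assume s: "s = 0"
      then have "a = b \<and> a' = b \<or> a = b \<and> b' = b" using 2 far nest pp by auto
      then have "?same \<or> ?swap" using 2 s by (auto intro!: X_eqI)
      then show ?thesis by blast
    next
      assume s: "s = 1"
      then have "a = b' + per \<and> a' = a \<or> a' = b + per \<and> b' = b" using 2 far nest pp by auto
      then have "?same \<or> ?swap" using 2 s by (auto intro!: X_eqI)
      then show ?thesis by blast
    next
      assume "s = -1"
      then show ?thesis using 2 far nest pp by auto
    next
      assume "per * s \<ge> 2 * per" then show ?thesis using 2 far nest pp by linarith
    next
      assume "per * s \<le> - 2 * per" then show ?thesis using 2 far nest pp by linarith
    qed
  next
    case 3
    show ?thesis
    proof (rule per_mult_cases[of s])
      assume s: "s = 0"
      then have "a = a' \<or> b = b'" using 3 far nest pp by auto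
      then have "?same \<or> ?swap" using 3 s by (auto intro!: X_eqI)
      then show ?thesis by blast
    next
      assume "s = 1"
      then show ?thesis using 3 far nest pp by auto
    next
      assume s: "s = -1"
      then have "a = b \<and> a' = b \<and> b' = b - per \<or> a = b \<and> b' = b \<and> a' = b + per" using 3 far nest pp by auto
      then have "?same \<or> ?swap" using 3 s by (auto intro!: X_eqI)
      then show ?thesis by blast
    next
      assume "per * s \<ge> 2 * per" then show ?thesis using 3 far nest pp by linarith
    next
      assume "per * s \<le> - 2 * per" then show ?thesis using 3 far nest pp by linarith
    qed
  qed
qed blast

text \<open>Moving one period between the ends changes their difference by \<open>2 * per\<close>,
  which brings it into the range from \<open>- per\<close> to \<open>per\<close>; a negative
  difference is cured by exchanging the ends.\<close>

lemma interval_form: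
  obtains b a where "b \<le> a" "a \<le> b + per" "X p r = X b a" "b + a = p + r"
proof -
  define t where "t = (r - p + per) div (2 * per)"
  define b where "b = p + per * t"
  define a where "a = r - per * t"
  have "(r - p + per) mod (2 * per) = r - p + per - 2 * per * t"
    unfolding t_def using mult_div_mod_eq[of "2 * per" "r - p + per"] by linarith
  moreover have "0 \<le> (r - p + per) mod (2 * per)" "(r - p + per) mod (2 * per) < 2 * per"
    using per_pos by auto
  ultimately have ab: "a - b \<ge> - per" "a - b < per"
    unfolding a_def b_def by (auto simp: algebra_simps)
  have X: "X p r = X b a" "b + a = p + r"
    by (auto simp: a_def b_def intro!: X_eqI)
  show ?thesis
  proof (cases "b \<le> a")
    case True
    then show ?thesis using that[of b a] ab X by auto
  next
    case False
    then show ?thesis using that[of a b] ab X X_sym[of a b] by auto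
  qed
qed

definition letter :: "int \<Rightarrow> int" where "letter p = (p - 1) mod per + 1"
definition period :: "int \<Rightarrow> int" where "period p = (p - 1) div per"

lemma letter_period: "p = letter p + per * period p"
  unfolding letter_def period_def using mult_div_mod_eq[of per "p - 1"] by linarith

lemma letter_bounds: "1 \<le> letter p" "letter p \<le> per"
  using per_pos pos_mod_bound[of per "p - 1"] pos_mod_sign[of per "p - 1"] unfolding letter_def by linarith+

lemma J_letters: "J m (letter x) (letter y) = X (x + per * (m - period x - period y)) y"
  unfolding J_X
proof (rule X_eqI)
  show "letter x + per * m + letter y = x + per * (m - period x - period y) + y"
    using letter_period[of x] letter_period[of y] by (simp add: algebra_simps)
  have "letter x + per * m - (x + per * (m - period x - period y)) = per * period y"
    using letter_period[of x] by (simp add: algebra_simps)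
  then show "per dvd letter x + per * m - (x + per * (m - period x - period y)) \<or> per dvd letter x + per * m - y"
    by simp
qed

definition admissible_list :: "(int \<times> int) list \<Rightarrow> bool" where
  "admissible_list l \<longleftrightarrow> sorted_wrt (\<lambda>e e'. fst e < fst e' \<and> snd e < snd e') l \<and>
     (\<forall>e\<in>set l. fst e \<le> snd e \<and> snd e \<le> fst e + per \<and> fst e > int i \<and> snd e > per - int i)"

definition Adm :: "int \<Rightarrow> fock set" where
  "Adm H = fv.span {Xs l vac |l. admissible_list l \<and> hts l = H}"

lemma subspace_Adm: "fv.subspace (Adm H)"
  by (simp add: Adm_def)

text \<open>For a fixed sum this grows when two midpoints move apart, so it measures the progress of
  straightening.\<close>

definition energy :: "(int \<times> int) list \<Rightarrow> int" where
  "energy l = sum_list (map (\<lambda>e. (fst e + snd e)\<^sup>2) l)"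

definition nested :: "int \<times> int \<Rightarrow> int \<times> int \<Rightarrow> bool" where
  "nested e e' \<longleftrightarrow> fst e' \<le> fst e \<and> snd e \<le> snd e'"

text \<open>Pairs are taken from the multiset, so two equal entries count as nested; this is what
  makes both ends strictly increasing. The map \<open>g\<close> serves lists of intervals as well as
  lists of coloured integers.\<close>

lemma unnested_sorted:
  assumes "\<And>e e' r. mset l = {#e, e'#} + r \<Longrightarrow> \<not> nested (g e) (g e')" "sorted (map (\<lambda>e. fst (g e)) l)"
  shows "sorted_wrt (\<lambda>e e'. fst (g e) < fst (g e') \<and> snd (g e) < snd (g e')) l"
  using assms
proof (induction l)
  case (Cons e l)
  have "fst (g e) < fst (g e') \<and> snd (g e) < snd (g e')" if mem: "e' \<in> set l" for e'
  proof -
    obtain l1 l2 where l: "l = l1 @ e' # l2" using mem by (meson split_list)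
    have "\<not> nested (g e) (g e')" by (rule Cons.prems(1)[of _ _ "mset (l1 @ l2)"]) (simp add: l)
    moreover have "\<not> nested (g e') (g e)" by (rule Cons.prems(1)[of _ _ "mset (l1 @ l2)"]) (simp add: l)
    moreover have "fst (g e) \<le> fst (g e')" using Cons.prems(2) mem by auto
    ultimately show ?thesis by (auto simp: nested_def)
  qed
  moreover have "sorted_wrt (\<lambda>e e'. fst (g e) < fst (g e') \<and> snd (g e) < snd (g e')) l"
  proof (rule Cons.IH)
    fix x x' r assume "mset l = {#x, x'#} + r"
    then show "\<not> nested (g x) (g x')" by (intro Cons.prems(1)[of _ _ "add_mset e r"]) simp
  qed (use Cons.prems in auto)
  ultimately show ?case by simp
qed simp

lemma interval_list:
  obtains l' where "Xs l = Xs l'" "length l' = length l" "hts l' = hts l" "energy l' = energy l"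
    "\<And>e. e \<in> set l' \<Longrightarrow> fst e \<le> snd e \<and> snd e \<le> fst e + per"
proof -
  have "\<exists>l'. Xs l = Xs l' \<and> length l' = length l \<and> hts l' = hts l \<and> energy l' = energy l \<and>
    (\<forall>e\<in>set l'. fst e \<le> snd e \<and> snd e \<le> fst e + per)"
  proof (induction l)
    case Nil
    show ?case by (intro exI[of _ "[]"]) auto
  next
    case (Cons e l)
    then obtain l' where l': "Xs l = Xs l'" "length l' = length l" "hts l' = hts l" "energy l' = energy l"
      "\<forall>e\<in>set l'. fst e \<le> snd e \<and> snd e \<le> fst e + per" by blast
    obtain b a where ba: "b \<le> a" "a \<le> b + per" "X (fst e) (snd e) = X b a" "b + a = fst e + snd e"
      using interval_form by blast
    then have "Xs (e # l) = Xs ((b, a) # l')" using l'(1) by (intro ext) simp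
    moreover have "hts ((b, a) # l') = hts (e # l)" using l'(3) ba by (simp add: ht_def[of e] ht_def[of "(b, a)"])
    moreover have "energy ((b, a) # l') = energy (e # l)" using l'(4) ba by (simp add: energy_def)
    ultimately show ?case using l' ba by (intro exI[of _ "(b, a) # l'"]) auto
  qed
  then show ?thesis using that by blast
qed

text \<open>Applied to the vector produced by the remaining factors, the quadratic relation writes 0
  as a sum of terms that are natural multiples of the nested product modulo \<open>Adm H\<close>.
  Since one multiplicity is positive, a positive multiple of the nested product lies in
  \<open>Adm H\<close>.\<close>

lemma nested_step:
  assumes nest: "nested (b, a) (b', a')" and iv: "b \<le> a" "a' \<le> b' + per"
    and H: "H = hts ((b, a) # (b', a') # rest)"
    and filtA: "filt (Suc (length rest)) H \<subseteq> Adm H"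
    and IH: "\<And>l. length l = Suc (Suc (length rest)) \<Longrightarrow> hts l = H \<Longrightarrow>
       energy l > energy ((b, a) # (b', a') # rest) \<Longrightarrow> Xs l vac \<in> Adm H"
  shows "Xs ((b, a) # (b', a') # rest) vac \<in> Adm H"
proof -
  define w where "w = Xs rest vac"
  define Y where "Y = Xs ((b, a) # (b', a') # rest) vac"
  have fin: "finsupp w" by (simp add: w_def finsupp_Xs)
  have nest': "b' \<le> b" "b \<le> a" "a \<le> a'" "a' \<le> b' + per" using nest iv by (auto simp: nested_def)
  \<comment> \<open>T is congruent to c copies of Y. The multiplicity is a natural number so that
    contributions of degenerate ties can only add up, never cancel.\<close>
  define R where "R c T \<longleftrightarrow> T - fscale (of_nat c) Y \<in> Adm H" for c :: nat and T
  have R_add: "R (c1 + c2) (T1 + T2)" if "R c1 T1" "R c2 T2" for c1 c2 T1 T2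
  proof -
    have "T1 + T2 - fscale (of_nat (c1 + c2)) Y = (T1 - fscale (of_nat c1) Y) + (T2 - fscale (of_nat c2) Y)"
      by (simp add: fpt algebra_simps)
    then show ?thesis using that fv.subspace_add[OF subspace_Adm] unfolding R_def by metis
  qed
  have R1: "R 1 Y" by (simp add: R_def fv.subspace_0[OF subspace_Adm])
  have R1': "R 1 (X b' a' (X b a w))"
  proof -
    have "eqv ((b', a') # (b, a) # rest) ((b, a) # (b', a') # rest)" by (rule eqv_swap)
    then have "X b' a' (X b a w) - Y \<in> filt (Suc (length rest)) H"
      by (simp add: eqv_def H Y_def w_def add_ac)
    then show ?thesis using filtA by (auto simp: R_def)
  qed
  have key: "\<exists>c. R c (X (x + per * s) y (X (z - per * s) t w)) \<and> R c (X (z - per * s) t (X (x + per * s) y w))"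
    if "(x, y, z, t) \<in> {(b, a, b', a'), (b, b', a, a'), (b, a', a, b')}" for x y z t s
    using nested_key[OF nest' that, of s]
  proof (elim disjE conjE)
    assume far: "\<bar>(x + y + per * s) - (z + t - per * s)\<bar> > \<bar>(b + a) - (b' + a')\<bar>"
    have sum: "(x + y + per * s) + (z + t - per * s) = (b + a) + (b' + a')" using that by auto
    have "((x + y + per * s) - (z + t - per * s))\<^sup>2 > ((b + a) - (b' + a'))\<^sup>2"
      using far power_strict_mono[of "\<bar>(b + a) - (b' + a')\<bar>" "\<bar>(x + y + per * s) - (z + t - per * s)\<bar>" 2] by simp
    then have en: "(x + y + per * s)\<^sup>2 + (z + t - per * s)\<^sup>2 > (b + a)\<^sup>2 + (b' + a')\<^sup>2"
    proof -
      assume *: "((x + y + per * s) - (z + t - per * s))\<^sup>2 > ((b + a) - (b' + a'))\<^sup>2"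
      have "2 * (p\<^sup>2 + q\<^sup>2) = (p + q)\<^sup>2 + (p - q)\<^sup>2" for p q :: int by (simp add: power2_eq_square algebra_simps)
      from this[of "x + y + per * s" "z + t - per * s"] this[of "b + a" "b' + a'"] * sum show ?thesis by simp
    qed
    have "Xs ((x + per * s, y) # (z - per * s, t) # rest) vac \<in> Adm H"
      by (rule IH) (use en sum in \<open>auto simp: H ht_def energy_def algebra_simps\<close>)
    moreover have "Xs ((z - per * s, t) # (x + per * s, y) # rest) vac \<in> Adm H"
      by (rule IH) (use en sum in \<open>auto simp: H ht_def energy_def algebra_simps\<close>)
    ultimately show ?thesis by (intro exI[of _ 0]) (simp add: R_def w_def)
  next
    assume "X (x + per * s) y = X b a" "X (z - per * s) t = X b' a'"
    then show ?thesis using R1 R1' by (intro exI[of _ 1]) (simp add: Y_def w_def)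
  next
    assume "X (x + per * s) y = X b' a'" "X (z - per * s) t = X b a"
    then show ?thesis using R1 R1' by (intro exI[of _ 1]) (simp add: Y_def w_def)
  qed
  \<comment> \<open>The total degree at which the two intervals occur once the periods of their ends
    have been split off.\<close>
  define K where "K = period b + period a + period b' + period a'"
  have keyJ: "\<exists>c. R c (J m (letter x) (letter y) (J l (letter z) (letter t) w))"
    "\<exists>c. R c (J l (letter z) (letter t) (J m (letter x) (letter y) w))"
    if q: "(x, y, z, t) \<in> {(b, a, b', a'), (b, b', a, a'), (b, a', a, b')}" and ml: "m + l = K" for m l x y z t
  proof -
    define s where "s = m - period x - period y"
    have "l - period z - period t = - s" using q ml by (auto simp: K_def s_def)
    then have "J m (letter x) (letter y) = X (x + per * s) y" "J l (letter z) (letter t) = X (z - per * s) t"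
      unfolding J_letters by (simp_all add: s_def[symmetric])
    then show "\<exists>c. R c (J m (letter x) (letter y) (J l (letter z) (letter t) w))"
      "\<exists>c. R c (J l (letter z) (letter t) (J m (letter x) (letter y) w))"
      using key[OF q, of s] by auto
  qed
  let ?U = "\<lambda>m l. U6 J (letter b) (letter a) (letter b') (letter a') m l w"
  have U_c: "\<exists>c. R c (?U m l)" if ml: "m + l = K" for m l
  proof -
    have lm: "l + m = K" using ml by simp
    obtain c1 where c1: "R c1 (J m (letter b) (letter a) (J l (letter b') (letter a') w))"
      using keyJ(1)[of b a b' a' m l] ml by blast
    obtain c2 where c2: "R c2 (J m (letter b) (letter b') (J l (letter a) (letter a') w))"
      using keyJ(1)[of b b' a a' m l] ml by blast
    obtain c3 where c3: "R c3 (J m (letter b) (letter a') (J l (letter a) (letter b') w))"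
      using keyJ(1)[of b a' a b' m l] ml by blast
    obtain c4 where c4: "R c4 (J m (letter b') (letter a') (J l (letter b) (letter a) w))"
      using keyJ(2)[of b a b' a' l m] lm by blast
    obtain c5 where c5: "R c5 (J m (letter a) (letter a') (J l (letter b) (letter b') w))"
      using keyJ(2)[of b b' a a' l m] lm by blast
    obtain c6 where c6: "R c6 (J m (letter a) (letter b') (J l (letter b) (letter a') w))"
      using keyJ(2)[of b a' a b' l m] lm by blast
    show ?thesis unfolding U6_def using R_add[OF R_add[OF R_add[OF R_add[OF R_add[OF c1 c2] c3] c4] c5] c6] by blast
  qed
  \<comment> \<open>At this degree the currents with the letters of the ends are exactly those of
    the two given intervals.\<close>
  define m0 where "m0 = period b + period a"
  have eqn: "J m0 (letter b) (letter a) = X b a" "J (K - m0) (letter b') (letter a') = X b' a'"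
    by (simp_all add: J_letters m0_def K_def)
  \<comment> \<open>Both orders are treated because the relation puts the larger of m0 and K - m0 on
    the left.\<close>
  have U_pos: "\<exists>c. c \<ge> 1 \<and> R c (?U m0 (K - m0))" "\<exists>c. c \<ge> 1 \<and> R c (?U (K - m0) m0)"
  proof -
    have ml: "m0 + (K - m0) = K" and lm: "(K - m0) + m0 = K" by auto
    have c1: "R 1 (J m0 (letter b) (letter a) (J (K - m0) (letter b') (letter a') w))"
      using R1 by (simp add: eqn Y_def w_def)
    obtain c2 where c2: "R c2 (J m0 (letter b) (letter b') (J (K - m0) (letter a) (letter a') w))"
      using keyJ(1)[OF _ ml, of b b' a a'] by blast
    obtain c3 where c3: "R c3 (J m0 (letter b) (letter a') (J (K - m0) (letter a) (letter b') w))"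
      using keyJ(1)[OF _ ml, of b a' a b'] by blast
    obtain c4 where c4: "R c4 (J m0 (letter b') (letter a') (J (K - m0) (letter b) (letter a) w))"
      using keyJ(2)[OF _ lm, of b a b' a'] by blast
    obtain c5 where c5: "R c5 (J m0 (letter a) (letter a') (J (K - m0) (letter b) (letter b') w))"
      using keyJ(2)[OF _ lm, of b b' a a'] by blast
    obtain c6 where c6: "R c6 (J m0 (letter a) (letter b') (J (K - m0) (letter b) (letter a') w))"
      using keyJ(2)[OF _ lm, of b a' a b'] by blast
    show "\<exists>c. c \<ge> 1 \<and> R c (?U m0 (K - m0))"
      unfolding U6_def using R_add[OF R_add[OF R_add[OF R_add[OF R_add[OF c1 c2] c3] c4] c5] c6]
      by (intro exI conjI) auto
    obtain d1 where d1: "R d1 (J (K - m0) (letter b) (letter a) (J m0 (letter b') (letter a') w))"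
      using keyJ(1)[OF _ lm, of b a b' a'] by blast
    obtain d2 where d2: "R d2 (J (K - m0) (letter b) (letter b') (J m0 (letter a) (letter a') w))"
      using keyJ(1)[OF _ lm, of b b' a a'] by blast
    obtain d3 where d3: "R d3 (J (K - m0) (letter b) (letter a') (J m0 (letter a) (letter b') w))"
      using keyJ(1)[OF _ lm, of b a' a b'] by blast
    have d4: "R 1 (J (K - m0) (letter b') (letter a') (J m0 (letter b) (letter a) w))"
      using R1' by (simp add: eqn Y_def w_def)
    obtain d5 where d5: "R d5 (J (K - m0) (letter a) (letter a') (J m0 (letter b) (letter b') w))"
      using keyJ(2)[OF _ ml, of b b' a a'] by blast
    obtain d6 where d6: "R d6 (J (K - m0) (letter a) (letter b') (J m0 (letter b) (letter a') w))"
      using keyJ(2)[OF _ ml, of b a' a b'] by blast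
    show "\<exists>c. c \<ge> 1 \<and> R c (?U (K - m0) m0)"
      unfolding U6_def using R_add[OF R_add[OF R_add[OF R_add[OF R_add[OF d1 d2] d3] d4] d5] d6]
      by (intro exI conjI) auto
  qed
  have ordU: "max m (K - m) + min m (K - m) = K" for m by (simp add: max_def min_def)
  have "\<forall>m. \<exists>c. R c (?U (max m (K - m)) (min m (K - m))) \<and> (m = m0 \<longrightarrow> c \<ge> 1)"
  proof
    fix m
    show "\<exists>c. R c (?U (max m (K - m)) (min m (K - m))) \<and> (m = m0 \<longrightarrow> c \<ge> 1)"
    proof (cases "m = m0")
      case True
      then show ?thesis using U_pos by (cases "m0 \<le> K - m0") (auto simp: max_def min_def)
    next
      case False
      then show ?thesis using U_c[OF ordU] by blast
    qed
  qed
  then obtain c where c: "\<And>m. R (c m) (?U (max m (K - m)) (min m (K - m)))" "c m0 \<ge> 1" by metis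
  have sumR: "R (\<Sum>m\<in>M. c m) (\<Sum>m\<in>M. ?U (max m (K - m)) (min m (K - m)))" if "finite M" for M
    using that
  proof (induction M)
    case empty
    have "0 - fscale (of_nat 0) Y = 0" by (simp add: fpt)
    then show ?case unfolding R_def sum.empty using fv.subspace_0[OF subspace_Adm, of H] by metis
  next
    case (insert m M)
    show ?case unfolding sum.insert[OF insert.hyps] by (rule R_add[OF c(1) insert.IH])
  qed
  obtain N0 where N0: "\<And>N. N \<ge> N0 \<Longrightarrow> (\<Sum>m=-N..N. ?U (max m (K - m)) (min m (K - m))) = 0"
    using quadratic_relation[OF letter_bounds letter_bounds letter_bounds letter_bounds fin] by blast
  define N where "N = max N0 \<bar>m0\<bar>"
  define C where "C = (\<Sum>m=-N..N. c m)"
  have "c m0 \<le> C" unfolding C_def by (rule member_le_sum) (auto simp: N_def)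
  then have C: "C \<ge> 1" using c(2) by simp
  have "R C 0" using sumR[of "{-N..N}"] N0[of N] by (simp add: C_def N_def)
  then have "fscale (of_nat C) Y \<in> Adm H"
    using fv.subspace_neg[OF subspace_Adm] by (fastforce simp: R_def)
  then have "fscale (1 / of_nat C) (fscale (of_nat C) Y) \<in> Adm H" by (rule fv.subspace_scale[OF subspace_Adm])
  then show ?thesis using C by (simp add: Y_def)
qed

text \<open>The outer induction on the number of factors absorbs commutators and factors that reduce
  to scalars. The inner induction is on the energy, which rises at every nested step and is bounded
  once all heights are positive.\<close>

lemma straighten: "Xs l vac \<in> Adm (hts l)"
proof (induction "length l" arbitrary: l rule: less_induct)
  case less
  define s where "s = length l"
  define H where "H = hts l"
  have filtA: "filt (s - 1) H \<subseteq> Adm H" if "s \<noteq> 0"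
  proof -
    have "{Xs l vac |l. length l \<le> s - 1 \<and> hts l = H} \<subseteq> Adm H"
    proof clarify
      fix k assume "length k \<le> s - 1" "H = hts k"
      then show "Xs k vac \<in> Adm (hts k)" using less[of k] that unfolding s_def by (metis Suc_pred bot_nat_0.not_eq_extremum le_imp_less_Suc One_nat_def)
    qed
    then show ?thesis unfolding filt_def using fv.span_minimal[OF _ subspace_Adm] by blast
  qed
  \<comment> \<open>If all heights are at least 1 and add up to H, each end sum is at most |H| + per
    + 1; the final 1 makes the bound on the energy strict.\<close>
  define C where "C = int s * (\<bar>H\<bar> + per + 1)\<^sup>2 + 1"
  have "length l = s \<Longrightarrow> hts l = H \<Longrightarrow> Xs l vac \<in> Adm H" for l
  proof (induction "nat (C - energy l)" arbitrary: l rule: less_induct)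
    case inner: less
    show ?case
    proof (cases "\<exists>e\<in>set l. ht e \<le> 0")
      case True
      then have "Xs l vac \<in> filt (length l - 1) (hts l)" "l \<noteq> []" using kills_vac_filt by auto
      then show ?thesis using filtA inner.prems by auto
    next
      case False
      obtain l' where l': "Xs l = Xs l'" "length l' = length l" "hts l' = hts l" "energy l' = energy l"
        and iv: "\<And>e. e \<in> set l' \<Longrightarrow> fst e \<le> snd e \<and> snd e \<le> fst e + per"
        using interval_list by blast
      show ?thesis
      proof (cases "\<exists>e\<in>set l'. ht e \<le> 0 \<or> X (fst e) (snd e) vac = 0")
        case True
        then have "Xs l' vac \<in> filt (length l' - 1) (hts l')" "l' \<noteq> []" using kills_vac_filt by auto
        moreover have "length l' = s" "hts l' = H" using inner.prems l' by simp_all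
        ultimately have "Xs l' vac \<in> Adm H" using filtA by auto
        then show ?thesis unfolding l'(1) .
      next
        case pos: False
        then have htpos: "\<And>e. e \<in> set l' \<Longrightarrow> ht e \<ge> 1" by force
        have bd: "fst e > int i" "snd e > per - int i" if "e \<in> set l'" for e
          using X_vac_boundary[of "fst e" "snd e"] that pos iv[OF that] htpos[OF that] by force+
        have "energy l' < C"
        proof -
          have "(fst e + snd e)\<^sup>2 \<le> (\<bar>H\<bar> + per + 1)\<^sup>2" if "e \<in> set l'" for e
          proof -
            have "ht e \<le> hts l'"
              using htpos that by (intro member_le_sum_list) (fastforce)+
            then have "fst e + snd e \<le> \<bar>H\<bar> + per + 1" "fst e + snd e \<ge> 0"
              using htpos[OF that] l' inner.prems per_pos by (auto simp: ht_def)
            then show ?thesis by (intro power_mono)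
          qed
          then have "energy l' \<le> sum_list (map (\<lambda>e. (\<bar>H\<bar> + per + 1)\<^sup>2) l')"
            unfolding energy_def by (intro sum_list_mono) auto
          then show ?thesis using l' inner.prems by (simp add: C_def sum_list_triv)
        qed
        have IH: "Xs l'' vac \<in> Adm H" if "length l'' = s" "hts l'' = H" "energy l'' > energy l'" for l''
          using inner.hyps[of l''] that \<open>energy l' < C\<close> l' by auto
        show ?thesis
        proof (cases "\<exists>e e' r. mset l' = {#e, e'#} + r \<and> nested e e'")
          case True
          then obtain e e' r where er: "mset l' = {#e, e'#} + r" "nested e e'" by blast
          obtain rest where rest: "mset rest = r" using ex_mset by blast
          have ms: "mset l' = mset (e # e' # rest)" using er rest by simp
          then have "set l' = set (e # e' # rest)" by (rule mset_eq_setD)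
          then have mem: "e \<in> set l'" "e' \<in> set l'" by auto
          have len: "Suc (Suc (length rest)) = s" using mset_eq_length[OF ms] l'(2) inner.prems(1) by simp
          have hs: "sum_list (map g (e # e' # rest)) = sum_list (map g l')" for g :: "int \<times> int \<Rightarrow> int"
            unfolding sum_mset_sum_list[symmetric] mset_map ms ..
          have "hts (e # e' # rest) = H"
            using hs[of ht] l'(3) inner.prems(2) by simp
          moreover have "energy (e # e' # rest) = energy l'"
            unfolding energy_def by (rule hs)
          moreover have "filt (Suc (length rest)) H \<subseteq> Adm H" using filtA len by auto
          ultimately have "Xs (e # e' # rest) vac \<in> Adm H"
            using nested_step[of "fst e" "snd e" "fst e'" "snd e'" H rest] er(2) iv[OF mem(1)] iv[OF mem(2)] IH
            unfolding len prod.collapse by metis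
          moreover have "eqv l' (e # e' # rest)" using ms by (rule eqv_perm)
          then have "Xs l' vac - Xs (e # e' # rest) vac \<in> filt (length l' - 1) (hts l')" unfolding eqv_def by blast
          then have "Xs l' vac - Xs (e # e' # rest) vac \<in> Adm H"
            using filtA len unfolding l'(2,3) inner.prems by auto
          ultimately have "(Xs l' vac - Xs (e # e' # rest) vac) + Xs (e # e' # rest) vac \<in> Adm H"
            using fv.subspace_add[OF subspace_Adm] by blast
          then show ?thesis unfolding l'(1) by (simp only: diff_add_cancel)
        next
          case unn: False
          define l'' where "l'' = sort_key fst l'"
          have ms: "mset l'' = mset l'" by (simp add: l''_def)
          have "sorted_wrt (\<lambda>e e'. fst e < fst e' \<and> snd e < snd e') l''"
          proof (rule unnested_sorted[where g = "\<lambda>e. e"])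
            fix e e' r assume "mset l'' = {#e, e'#} + r"
            then show "\<not> nested e e'" using unn ms by metis
          qed (simp add: l''_def)
          then have "admissible_list l''"
            using iv bd by (auto simp: admissible_list_def l''_def)
          moreover have "hts l'' = hts l'" unfolding sum_mset_sum_list[symmetric] mset_map ms ..
          then have "hts l'' = H" using l'(3) inner.prems(2) by simp
          ultimately have 1: "Xs l'' vac \<in> Adm H" unfolding Adm_def by (intro fv.span_base) blast
          have ev: "eqv l' l''" using ms by (intro eqv_perm) simp
          show ?thesis
          proof (cases "s = 0")
            case True
            then have "l' = []" "l'' = []" using l'(2) inner.prems(1) ms by auto
            then show ?thesis using 1 unfolding l'(1) by simp
          next
            case False
            have "Xs l' vac - Xs l'' vac \<in> filt (length l' - 1) (hts l')" using ev unfolding eqv_def by blast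
            then have "Xs l' vac - Xs l'' vac \<in> Adm H"
              using filtA False unfolding l'(2,3) inner.prems by auto
            then have "(Xs l' vac - Xs l'' vac) + Xs l'' vac \<in> Adm H"
              using 1 fv.subspace_add[OF subspace_Adm] by blast
            then show ?thesis unfolding l'(1) by (simp only: diff_add_cancel)
          qed
        qed
      qed
    qed
  qed
  then show ?case by (simp add: s_def H_def)
qed

end

section \<open>Leading terms of admissible products\<close>

context symplectic_fock
begin

lemma fcard_remove: "p |\<in>| S \<Longrightarrow> fcard (S |-| {|p|}) = fcard S - 1"
  by (simp add: fcard.rep_eq)

lemma Z_card:
  assumes supp: "\<And>T. \<phi> T \<noteq> 0 \<Longrightarrow> fcard T \<le> k" and nz: "Z h c \<phi> S \<noteq> 0"
  shows "fcard S \<le> k + 2"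
proof -
  obtain q where q: "nord (q + h) q \<phi> S \<noteq> 0"
    using nz unfolding Z_def by (metis (no_types, lifting) mult_eq_0_iff sum.neutral)
  have u1: "\<exists>T. \<chi> T \<noteq> 0 \<and> fcard S \<le> fcard T + 1" if "u p \<chi> S \<noteq> 0" for p \<chi> S
  proof (cases "p |\<in>| S")
    case True
    then show ?thesis using that by (intro exI[of _ "S |-| {|p|}"]) (auto simp: u_def cre_def ann_def fcard_remove split: if_splits)
  next
    case False
    then show ?thesis using that by (intro exI[of _ "finsert p S"]) (auto simp: u_def cre_def ann_def fcard_finsert_disjoint split: if_splits)
  qed
  have d1: "\<exists>T. \<chi> T \<noteq> 0 \<and> fcard S \<le> fcard T + 1" if "d p \<chi> S \<noteq> 0" for p \<chi> S
  proof (cases "p |\<in>| S")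
    case True
    then show ?thesis using that by (intro exI[of _ "S |-| {|p|}"]) (auto simp: d_def cre_def ann_def fcard_remove split: if_splits)
  next
    case False
    then show ?thesis using that by (intro exI[of _ "finsert p S"]) (auto simp: d_def cre_def ann_def fcard_finsert_disjoint split: if_splits)
  qed
  consider "u (q + h) (d q \<phi>) S \<noteq> 0" | "\<phi> S \<noteq> 0"
    using q by (cases "u (q + h) (d q \<phi>) S = 0") (auto simp: nord_def split: if_splits)
  then show ?thesis
  proof cases
    case 1
    then obtain T where T: "d q \<phi> T \<noteq> 0" "fcard S \<le> fcard T + 1" using u1 by blast
    then obtain T' where "\<phi> T' \<noteq> 0" "fcard T \<le> fcard T' + 1" using d1 by blast
    then show ?thesis using T supp[of T'] by linarith
  next
    case 2
    then show ?thesis using supp[of S] by linarith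
  qed
qed

text \<open>Two additional members arise only by creating a particle and a hole together, that is
  for q \<le> i < q + h. Every other mode leaves the number of members unchanged or lowers
  it.\<close>

lemma Z_top:
  assumes supp: "\<And>T. \<phi> T \<noteq> 0 \<Longrightarrow> fcard T \<le> k" and S: "fcard S = k + 2" and h: "h \<ge> 1"
  shows "Z h c \<phi> S = (\<Sum>q\<in>{int i - h<..int i}. c q * cre (q + h) (cre q \<phi>) S)"
  unfolding Z_def
proof (rule sum.mono_neutral_cong_right)
  show "{int i - h<..int i} \<subseteq> {- (bnd S + \<bar>h\<bar>)..bnd S + \<bar>h\<bar>}"
    using bnd_lev[of S] h by auto
  show "c q * nord (q + h) q \<phi> S = c q * cre (q + h) (cre q \<phi>) S" if "q \<in> {int i - h<..int i}" for q
    using that h by (auto simp: nord_def u_def d_def)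
  show "\<forall>q\<in>{- (bnd S + \<bar>h\<bar>)..bnd S + \<bar>h\<bar>} - {int i - h<..int i}. c q * nord (q + h) q \<phi> S = 0"
  proof
    fix q assume q: "q \<in> {- (bnd S + \<bar>h\<bar>)..bnd S + \<bar>h\<bar>} - {int i - h<..int i}"
    have big: "\<phi> T = 0" if "fcard T = k + 2" for T using supp[of T] that by fastforce
    consider "q > int i" | "q + h \<le> int i" using q by force
    then have "u (q + h) (d q \<phi>) S = 0"
    proof cases
      case 1
      then have "u (q + h) (d q \<phi>) S = cre (q + h) (ann q \<phi>) S" using h by (simp add: u_def d_def)
      also have "\<dots> = 0"
      proof (cases "q + h |\<in>| S \<and> q |\<notin>| S |-| {|q + h|}")
        case True
        then have "fcard (finsert q (S |-| {|q + h|})) = k + 2"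
          using S by (simp add: fcard_finsert_disjoint fcard_remove)
        then show ?thesis using big by (simp add: cre_def ann_def)
      next
        case False
        then show ?thesis by (auto simp: cre_def ann_def)
      qed
      finally show ?thesis .
    next
      case 2
      then have "u (q + h) (d q \<phi>) S = ann (q + h) (cre q \<phi>) S" using h by (simp add: u_def d_def)
      also have "\<dots> = 0"
      proof (cases "q + h |\<notin>| S \<and> q |\<in>| finsert (q + h) S")
        case True
        then have "fcard (finsert (q + h) S |-| {|q|}) = k + 2"
          using S by (subst fcard_remove) (auto simp: fcard_finsert_disjoint)
        then show ?thesis using big by (simp add: cre_def ann_def)
      next
        case False
        then show ?thesis by (auto simp: cre_def ann_def)
      qed
      finally show ?thesis .
    qed
    then show "c q * nord (q + h) q \<phi> S = 0" using h by (simp add: nord_def)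
  qed
qed simp

text \<open>Among all pairs of a particle \<open>p\<close> and a hole \<open>2n + 1 - r\<close> created by the current of the interval
  \<open>[b, a]\<close>, the quadratic part of the cost is least for \<open>{p, r} = {b, a}\<close>, and the linear part
  separates \<open>(p, r) = (b, a)\<close> from \<open>(a, b)\<close>.\<close>

definition scost :: "int fset \<Rightarrow> int" where
  "scost S = (\<Sum>p\<in>fset S. if p > int i then 2 * p\<^sup>2 + p else 2 * (per + 1 - p)\<^sup>2)"

definition ecost :: "int \<times> int \<Rightarrow> int" where
  "ecost e = 2 * (fst e)\<^sup>2 + fst e + 2 * (snd e)\<^sup>2"

lemma scost_finsert:
  "p |\<notin>| S \<Longrightarrow> scost (finsert p S) = (if p > int i then 2 * p\<^sup>2 + p else 2 * (per + 1 - p)\<^sup>2) + scost S"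
  by (simp add: scost_def)

lemma pair_cost:
  assumes ba: "b \<le> a" "a \<le> b + per" and p: "p = b + per * s \<or> p = a + per * s" and r: "p + r = b + a"
  shows "ecost (p, r) \<ge> ecost (b, a)" "ecost (p, r) = ecost (b, a) \<Longrightarrow> p = b"
proof -
  define D where "D = r - p"
  define E where "E = a - b"
  have E: "0 \<le> E" "E \<le> per" using ba by (auto simp: E_def)
  \<comment> \<open>For a fixed sum of ends the excess of the cost factorises in their differences.
    The second factor is odd, so only D = E gives equality; the linear part of the cost thereby
    excludes D = - E, where the ends are exchanged.\<close>
  have id: "2 * ecost (p, r) - 2 * ecost (b, a) = (D - E) * (2 * (D + E) - 1)"
  proof -
    have rr: "r = b + a - p" using r by simp
    show ?thesis unfolding D_def E_def ecost_def rr by (simp add: power2_eq_square algebra_simps)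
  qed
  have cases: "D > E \<or> D = E \<or> D + E \<le> 0"
  proof -
    define P where "P = per * s"
    have "s \<ge> 1 \<or> s = 0 \<or> s \<le> -1" by auto
    then have "P \<ge> per \<or> P = 0 \<or> P \<le> - per"
      using per_pos mult_left_mono[of 1 s per] mult_left_mono[of s "-1" per] by (auto simp: P_def)
    moreover have "D = E - 2 * P \<or> D = - E - 2 * P"
      using p r unfolding D_def E_def P_def by auto
    ultimately show ?thesis using per_pos E by auto
  qed
  have strict: "(D - E) * (2 * (D + E) - 1) > 0" if "D \<noteq> E"
  proof (cases "D > E")
    case True
    then have "2 * (D + E) - 1 > 0" using E by presburger
    then show ?thesis using True by (intro mult_pos_pos) auto
  next
    case False
    then have "D + E \<le> 0" "D - E < 0" using cases that by auto
    then show ?thesis by (intro mult_neg_neg) auto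
  qed
  then have "(D - E) * (2 * (D + E) - 1) \<ge> 0" by (cases "D = E") auto
  then show "ecost (p, r) \<ge> ecost (b, a)" using id by linarith
  assume "ecost (p, r) = ecost (b, a)"
  then have "D = E" using id strict by fastforce
  then show "p = b" using r unfolding D_def E_def by linarith
qed

definition good :: "(int \<times> int) list \<Rightarrow> bool" where
  "good l \<longleftrightarrow> distinct (map fst l) \<and> distinct (map snd l) \<and>
     (\<forall>e\<in>set l. fst e \<le> snd e \<and> snd e \<le> fst e + per \<and> fst e > int i \<and> snd e > per - int i)"

fun state :: "(int \<times> int) list \<Rightarrow> int fset" where
  "state [] = {||}"
| "state (e # l) = finsert (fst e) (finsert (per + 1 - snd e) (state l))"

lemma fset_state: "fset (state l) = fst ` set l \<union> (\<lambda>e. per + 1 - snd e) ` set l"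
  by (induction l) auto

lemma state_fresh:
  assumes "good (e # l)"
  shows "fst e |\<notin>| finsert (per + 1 - snd e) (state l)" "per + 1 - snd e |\<notin>| state l"
  using assms by (auto simp: good_def fset_state image_iff)

lemma scost_state: "good l \<Longrightarrow> scost (state l) = sum_list (map ecost l)"
proof (induction l)
  case (Cons e l)
  then have "good l" by (auto simp: good_def)
  then show ?case using Cons state_fresh[OF Cons.prems]
    by (auto simp: scost_finsert ecost_def good_def)
qed (simp add: scost_def)

lemma fcard_state: "good l \<Longrightarrow> fcard (state l) = 2 * length l"
proof (induction l)
  case (Cons e l)
  then have "good l" by (auto simp: good_def)
  then show ?case using Cons state_fresh[OF Cons.prems] by (simp add: fcard_finsert_disjoint)
qed simp

lemma Xs_support_card:
  "Xs l vac S \<noteq> 0 \<Longrightarrow> fcard S \<le> 2 * length l"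
proof (induction l arbitrary: S)
  case Nil
  then show ?case by (auto simp: ket_def split: if_splits)
next
  case (Cons e l)
  then show ?case using Z_card[of "Xs l vac" "2 * length l"] by (auto simp: X_def)
qed

lemma cre_cre_nz:
  assumes "cre p (cre q \<phi>) S \<noteq> 0"
  shows "p |\<in>| S" "q |\<in>| S" "p \<noteq> q" "\<phi> (S |-| {|p|} |-| {|q|}) \<noteq> 0"
    "S = finsert p (finsert q (S |-| {|p|} |-| {|q|}))"
  using assms by (auto simp: cre_def split: if_splits)

text \<open>The cost of a state is that of the pair added last plus that of the remaining state.
  Both are bounded below, and equality forces both to be the leading ones. So a single term
  contributes at the leading state and nothing can cancel it.\<close>

lemma Xs_leading:
  assumes "good l"
  shows "\<And>S. Xs l vac S \<noteq> 0 \<Longrightarrow> fcard S = 2 * length l \<Longrightarrow>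
      scost S \<ge> sum_list (map ecost l) \<and> (scost S = sum_list (map ecost l) \<longrightarrow> S = state l)"
    and "Xs l vac (state l) \<noteq> 0"
proof -
  have "(\<forall>S. Xs l vac S \<noteq> 0 \<longrightarrow> fcard S = 2 * length l \<longrightarrow>
      scost S \<ge> sum_list (map ecost l) \<and> (scost S = sum_list (map ecost l) \<longrightarrow> S = state l)) \<and> Xs l vac (state l) \<noteq> 0"
    using assms
  proof (induction l)
    case Nil
    show ?case by (auto simp: ket_def scost_def)
  next
    case (Cons e l)
    obtain b a where e: "e = (b, a)" by force
    have gl: "good l" using Cons.prems by (auto simp: good_def)
    define \<phi> where "\<phi> = Xs l vac"
    note IH = Cons.IH[OF gl, folded \<phi>_def]
    define h where "h = ht e"
    define c where "c = Jcol b a"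
    have ba: "b \<le> a" "a \<le> b + per" "b > int i" "a > per - int i" using Cons.prems e by (auto simp: good_def)
    then have h1: "h \<ge> 1" by (simp add: h_def ht_def e)
    have XZ: "Xs (e # l) vac = Z h c \<phi>" by (simp add: X_def e h_def c_def ht_def \<phi>_def)
    have supp: "\<phi> T \<noteq> 0 \<Longrightarrow> fcard T \<le> 2 * length l" for T using Xs_support_card by (simp add: \<phi>_def)
    have top: "Z h c \<phi> S = (\<Sum>q\<in>{int i - h<..int i}. c q * cre (q + h) (cre q \<phi>) S)" if "fcard S = 2 * length (e # l)" for S
      by (rule Z_top[OF supp _ h1]) (use that in auto)
    have trm: "scost S \<ge> sum_list (map ecost (e # l)) \<and>
        (scost S = sum_list (map ecost (e # l)) \<longrightarrow> q = per + 1 - a \<and> S = state (e # l))"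
      if S: "fcard S = 2 * length (e # l)" and q: "q \<in> {int i - h<..int i}" and nz: "c q * cre (q + h) (cre q \<phi>) S \<noteq> 0" for S q
    proof -
      define p where "p = q + h"
      define S' where "S' = S |-| {|p|} |-| {|q|}"
      have nz': "c q \<noteq> 0" "cre p (cre q \<phi>) S \<noteq> 0" using nz by (auto simp: p_def)
      note cc = cre_cre_nz[OF nz'(2), folded S'_def]
      have pq: "p > int i" "q \<le> int i" using q by (auto simp: p_def)
      have nin: "q |\<notin>| S'" "p |\<notin>| finsert q S'" using cc(3) by (auto simp: S'_def)
      have "fcard S = fcard S' + 2" using fcard_finsert_disjoint[OF nin(1)] fcard_finsert_disjoint[OF nin(2)] by (subst cc(5)) simp
      then have S'c: "fcard S' = 2 * length l" using S by simp
      have S'cost: "scost S' \<ge> sum_list (map ecost l)" "scost S' = sum_list (map ecost l) \<Longrightarrow> S' = state l"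
        using IH cc(4) S'c by auto
      define r where "r = per + 1 - q"
      have pr: "p + r = b + a" by (simp add: p_def r_def h_def ht_def e)
      have "per dvd q + a - 1 \<or> per dvd q + b - 1"
        using nz'(1) by (auto simp: c_def Jcol_def split: if_splits)
      then obtain s where "p = b + per * s \<or> p = a + per * s"
      proof
        assume "per dvd q + a - 1"
        then obtain t where "q + a - 1 = per * t" by (elim dvdE)
        then have "p = b + per * (t - 1)" by (simp add: p_def h_def ht_def e algebra_simps)
        then show ?thesis using that by blast
      next
        assume "per dvd q + b - 1"
        then obtain t where "q + b - 1 = per * t" by (elim dvdE)
        then have "p = a + per * (t - 1)" by (simp add: p_def h_def ht_def e algebra_simps)
        then show ?thesis using that by blast
      qed
      note pc = pair_cost[OF ba(1,2) this pr]
      have "scost S = ecost (p, r) + scost S'"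
        using scost_finsert[OF nin(1)] scost_finsert[OF nin(2)] pq by (subst cc(5)) (simp add: ecost_def r_def)
      then show ?thesis using pc S'cost cc(5) pr unfolding e by (auto simp: r_def)
    qed
    show ?case
    proof (intro conjI allI impI)
      fix S assume nz: "Xs (e # l) vac S \<noteq> 0" and S: "fcard S = 2 * length (e # l)"
      then obtain q where "q \<in> {int i - h<..int i}" "c q * cre (q + h) (cre q \<phi>) S \<noteq> 0"
        unfolding XZ top[OF S] by (meson sum.not_neutral_contains_not_neutral)
      then show "scost S \<ge> sum_list (map ecost (e # l))" "scost S = sum_list (map ecost (e # l)) \<Longrightarrow> S = state (e # l)"
        using trm[OF S] by blast+
    next
      let ?S = "state (e # l)" and ?q = "per + 1 - a"
      have S: "fcard ?S = 2 * length (e # l)" by (rule fcard_state[OF Cons.prems])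
      have cost: "scost ?S = sum_list (map ecost (e # l))" by (rule scost_state[OF Cons.prems])
      have qin: "?q \<in> {int i - h<..int i}" using ba by (auto simp: h_def ht_def e)
      have qh: "?q + h = b" by (simp add: h_def ht_def e)
      have "Xs (e # l) vac ?S = (\<Sum>q\<in>{?q}. c q * cre (q + h) (cre q \<phi>) ?S)"
        unfolding XZ top[OF S]
      proof (rule sum.mono_neutral_right)
        show "\<forall>q\<in>{int i - h<..int i} - {?q}. c q * cre (q + h) (cre q \<phi>) ?S = 0"
        proof (rule ballI, rule ccontr)
          fix q assume "q \<in> {int i - h<..int i} - {?q}" "c q * cre (q + h) (cre q \<phi>) ?S \<noteq> 0"
          with trm[OF S, of q] cost show False by (metis DiffE singletonI)
        qed
      qed (use qin in simp_all)
      also have "\<dots> = c ?q * cre b (cre ?q \<phi>) ?S" by (simp add: qh)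
      also have "\<dots> \<noteq> 0"
      proof -
        have f: "b |\<notin>| finsert ?q (state l)" "?q |\<notin>| state l" using state_fresh[OF Cons.prems] by (auto simp: e)
        then have "?S |-| {|b|} = finsert ?q (state l)" "finsert ?q (state l) |-| {|?q|} = state l" by (auto simp: e)
        then have "cre b (cre ?q \<phi>) ?S = fsign b ?S * (fsign ?q (finsert ?q (state l)) * \<phi> (state l))"
          by (simp add: cre_def e)
        moreover have "\<phi> (state l) \<noteq> 0" using IH by blast
        \<comment> \<open>Up to sign this coefficient is 1 or 2, the latter when a and b agree
          modulo the period.\<close>
        moreover have "c ?q \<noteq> 0"
        proof -
          have "(1::complex) + of_bool P \<noteq> 0" for P by (cases P) auto
          moreover have "per dvd ?q + a - 1" by simp
          ultimately show ?thesis by (simp add: c_def Jcol_def)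
        qed
        ultimately show ?thesis by simp
      qed
      finally show "Xs (e # l) vac ?S \<noteq> 0" .
    qed
  qed
  then show "\<And>S. Xs l vac S \<noteq> 0 \<Longrightarrow> fcard S = 2 * length l \<Longrightarrow>
      scost S \<ge> sum_list (map ecost l) \<and> (scost S = sum_list (map ecost l) \<longrightarrow> S = state l)"
    and "Xs l vac (state l) \<noteq> 0" by blast+
qed

lemma admissible_good: "admissible_list l \<Longrightarrow> good l"
proof -
  assume adm: "admissible_list l"
  then have "sorted_wrt (<) (map fst l)" "sorted_wrt (<) (map snd l)"
    by (auto simp: admissible_list_def sorted_wrt_map elim!: sorted_wrt_mono_rel[rotated])
  then have "distinct (map fst l)" "distinct (map snd l)" by (auto simp: strict_sorted_iff)
  then show ?thesis using adm by (auto simp: good_def admissible_list_def)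
qed

text \<open>Members above i are the lower ends and reflected members up to i are the upper ends.
  Both ends increase along the list, so sorting restores which of them belong together.\<close>

lemma state_inj:
  assumes l: "admissible_list l" and l': "admissible_list l'" and eq: "state l = state l'"
  shows "l = l'"
proof -
  have srt: "sorted_wrt (<) (map fst k)" "sorted_wrt (<) (map snd k)" if "admissible_list k" for k
    using that by (auto simp: admissible_list_def sorted_wrt_map elim!: sorted_wrt_mono_rel[rotated])
  have F: "set (map fst k) = {p \<in> fset (state k). p > int i}" if "admissible_list k" for k
    using that by (auto simp: fset_state admissible_list_def)
  have G: "set (map snd k) = (\<lambda>p. per + 1 - p) ` {p \<in> fset (state k). p \<le> int i}" if "admissible_list k" for k
  proof -
    have "{p \<in> fset (state k). p \<le> int i} = (\<lambda>e. per + 1 - snd e) ` set k"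
      using that by (force simp: fset_state admissible_list_def)
    then show ?thesis by (simp add: image_image)
  qed
  have "map fst l = map fst l'"
    using srt[OF l] srt[OF l'] F[OF l] F[OF l'] eq by (intro strict_sorted_equal) auto
  moreover have "map snd l = map snd l'"
    using srt[OF l] srt[OF l'] G[OF l] G[OF l'] eq by (intro strict_sorted_equal) auto
  ultimately show ?thesis by (metis zip_map_fst_snd)
qed

text \<open>Among the lists with nonzero coefficient a longest one is taken, and of those one of
  least cost. At its leading state shorter products vanish by the number of members, the others by
  cost and \<open>state_inj\<close>.\<close>

lemma admissible_family_independent:
  assumes fin: "finite L" and adm: "\<And>l. l \<in> L \<Longrightarrow> admissible_list l"
    and rel: "(\<Sum>l\<in>L. fscale (c l) (Xs l vac)) = 0" and "l \<in> L"
  shows "c l = 0"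
proof (rule ccontr)
  assume "c l \<noteq> 0"
  define L0 where "L0 = {l \<in> L. c l \<noteq> 0}"
  have L0: "finite L0" "l \<in> L0" using fin \<open>l \<in> L\<close> \<open>c l \<noteq> 0\<close> by (auto simp: L0_def)
  define m where "m = Max (length ` L0)"
  have m: "\<And>l. l \<in> L0 \<Longrightarrow> length l \<le> m" using L0 by (auto simp: m_def)
  define L1 where "L1 = {l \<in> L0. length l = m}"
  have "m \<in> length ` L0" unfolding m_def using L0 by (intro Max_in) auto
  then have L1: "L1 \<noteq> {}" "finite L1" using L0 by (auto simp: L1_def)
  define l0 where "l0 = arg_min_on (\<lambda>l. sum_list (map ecost l)) L1"
  have l0: "l0 \<in> L1" "\<And>l. l \<in> L1 \<Longrightarrow> sum_list (map ecost l0) \<le> sum_list (map ecost l)"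
    unfolding l0_def by (rule arg_min_if_finite(1)[OF L1(2,1)], rule arg_min_least[OF L1(2,1)])
  have adm0: "admissible_list l0" and mem0: "l0 \<in> L" "c l0 \<noteq> 0" "length l0 = m"
    using l0(1) adm by (auto simp: L1_def L0_def)
  have zero: "c l * Xs l vac (state l0) = 0" if l: "l \<in> L" "l \<noteq> l0" for l
  proof (rule ccontr)
    assume "c l * Xs l vac (state l0) \<noteq> 0"
    then have nz: "l \<in> L0" "Xs l vac (state l0) \<noteq> 0" using l by (auto simp: L0_def)
    have card: "fcard (state l0) = 2 * m" using fcard_state[OF admissible_good[OF adm0]] mem0 by simp
    then have "length l = m" using Xs_support_card[OF nz(2)] m[OF nz(1)] by simp
    then have "l \<in> L1" using nz by (simp add: L1_def)
    have "scost (state l0) = sum_list (map ecost l0)" by (rule scost_state[OF admissible_good[OF adm0]])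
    moreover have "scost (state l0) \<ge> sum_list (map ecost l)"
      "scost (state l0) = sum_list (map ecost l) \<Longrightarrow> state l0 = state l"
      using Xs_leading(1)[OF admissible_good[OF adm[OF l(1)]] nz(2)] card \<open>length l = m\<close> by auto
    ultimately have "state l0 = state l" using l0(2)[OF \<open>l \<in> L1\<close>] by linarith
    then show False using state_inj[OF adm0 adm[OF l(1)]] l(2) by blast
  qed
  have "0 = (\<Sum>l\<in>L. fscale (c l) (Xs l vac)) (state l0)" by (simp add: rel)
  also have "\<dots> = (\<Sum>l\<in>L. c l * Xs l vac (state l0))" by (simp add: sum_fun_apply fscale_apply)
  also have "\<dots> = (\<Sum>l\<in>{l0}. c l * Xs l vac (state l0))"
    by (rule sum.mono_neutral_right) (use fin mem0 zero in auto)
  also have "\<dots> \<noteq> 0" using mem0 Xs_leading(2)[OF admissible_good[OF adm0]] by simp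
  finally show False by simp
qed

lemma inj_admissible: "inj_on (\<lambda>l. Xs l vac) {l. admissible_list l}"
proof (rule inj_onI, rule ccontr)
  fix l l' assume l: "l \<in> {l. admissible_list l}" "l' \<in> {l. admissible_list l}" and eq: "Xs l vac = Xs l' vac" and ne: "l \<noteq> l'"
  define c where "c k = (if k = l then 1 else (-1 :: complex))" for k
  have "(\<Sum>k\<in>{l, l'}. fscale (c k) (Xs k vac)) = 0" using ne eq by (simp add: c_def fpt)
  then have "c l = 0" by (rule admissible_family_independent[rotated 2]) (use l in auto)
  then show False by (simp add: c_def)
qed

lemma independent_admissible: "fv.independent ((\<lambda>l. Xs l vac) ` {l. admissible_list l})"
  unfolding fv.dependent_explicit
proof clarify
  fix T g v assume T: "finite T" "T \<subseteq> (\<lambda>l. Xs l vac) ` {l. admissible_list l}" "(\<Sum>v\<in>T. fscale (g v) v) = 0"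
    and v: "v \<in> T" "g v \<noteq> 0"
  obtain L where L: "L \<subseteq> {l. admissible_list l}" "T = (\<lambda>l. Xs l vac) ` L" "finite L"
    using T(1,2) by (meson finite_subset_image)
  have inj: "inj_on (\<lambda>l. Xs l vac) L" using inj_admissible L(1) by (rule inj_on_subset)
  have "(\<Sum>l\<in>L. fscale (g (Xs l vac)) (Xs l vac)) = 0"
    using T(3) unfolding L(2) sum.reindex[OF inj] by simp
  then have "g (Xs l vac) = 0" if "l \<in> L" for l
    using admissible_family_independent[of L "\<lambda>l. g (Xs l vac)"] L that by blast
  then show False using v L(2) by auto
qed

end

section \<open>Chevalley generators on the Fock space\<close>

lemma finite_sum_ip: "finite F \<Longrightarrow> {S. (\<phi> :: fock) S \<noteq> 0} \<subseteq> F \<Longrightarrow> (\<Sum>S | \<phi> S \<noteq> 0. \<phi> S * \<chi> S) = (\<Sum>S\<in>F. \<phi> S * \<chi> S)"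
  by (rule sum.mono_neutral_left) auto

context symplectic_fock
begin

text \<open>The cyclic diagram with 2n nodes folded by q -> -q: the classes are the nodes 0, ..., n,
  and the two self-opposite classes 0 and n become the ends.\<close>

definition res :: "int \<Rightarrow> nat" where
  "res q = nat (min (q mod per) (per - q mod per))"

lemma mod_per: "0 \<le> q mod per" "q mod per < per"
  using per_pos pos_mod_sign[of per q] pos_mod_bound[of per q] by linarith+

lemma res_le: "res q \<le> n"
  using mod_per[of q] by (auto simp: res_def per_def min_def)

lemma res_cong: "per dvd q - q' \<Longrightarrow> res q = res q'"
  by (simp add: res_def mod_eq_dvd_iff[symmetric])

lemma res_period: "res (q + per) = res q"
  by (rule res_cong) simp

lemma res_uminus: "res (- q) = res q"
  using mod_per[of q] by (auto simp: res_def zmod_zminus1_eq_if min_def)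

lemma res_int: "k \<le> n \<Longrightarrow> res (int k) = k"
  using n_pos by (simp add: res_def per_def min_def)

lemma res_cases: "per dvd q - int (res q) \<or> per dvd q + int (res q)"
proof (cases "q mod per \<le> per - q mod per")
  case True
  then have "int (res q) = q mod per" using mod_per[of q] by (simp add: res_def min_def)
  then show ?thesis by (metis dvd_minus_mod)
next
  case False
  then have "int (res q) = per - q mod per" using mod_per[of q] by (simp add: res_def min_def)
  then have "q + int (res q) = (q - q mod per) + per" by simp
  then show ?thesis by (metis dvd_add dvd_minus_mod dvd_refl)
qed

lemma res_eq_iff: "res q = res q' \<longleftrightarrow> per dvd q - q' \<or> per dvd q + q'"
proof
  assume eq: "res q = res q'"
  define k where "k = int (res q)"
  have 1: "per dvd q - k \<or> per dvd q + k" "per dvd q' - k \<or> per dvd q' + k"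
    using res_cases[of q] res_cases[of q'] eq by (auto simp: k_def)
  have "q - q' = (q - k) - (q' - k)" "q - q' = (q + k) - (q' + k)" "q + q' = (q - k) + (q' + k)" "q + q' = (q + k) + (q' - k)"
    by auto
  then show "per dvd q - q' \<or> per dvd q + q'" using 1 by (metis dvd_add dvd_diff)
next
  assume "per dvd q - q' \<or> per dvd q + q'"
  then show "res q = res q'" using res_cong[of q q'] res_cong[of q "- q'"] res_uminus[of q'] by auto
qed

lemma res_succ: "k \<le> n \<Longrightarrow> res (int k + 1) = (if k < n then k + 1 else n - 1)"
proof -
  assume k: "k \<le> n"
  show ?thesis
  proof (cases "k < n")
    case True
    then have "res (int (k + 1)) = k + 1" by (intro res_int) simp
    then show ?thesis using True by (simp add: add.commute)
  next
    case False
    then have "k = n" using k by simp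
    moreover have "res (int n + 1) = res (int (n - 1))"
      unfolding res_eq_iff using n_pos by (simp add: per_def)
    ultimately show ?thesis using res_int[of "n - 1"] by simp
  qed
qed

lemma res_pred: "k \<le> n \<Longrightarrow> res (int k - 1) = (if k = 0 then 1 else k - 1)"
proof -
  assume k: "k \<le> n"
  show ?thesis
  proof (cases "k = 0")
    case True
    then show ?thesis using res_uminus[of 1] res_int[of 1] n_pos by simp
  next
    case False
    then have "int k - 1 = int (k - 1)" by simp
    then show ?thesis using False k res_int[of "k - 1"] by simp
  qed
qed

definition fcol :: "nat \<Rightarrow> int \<Rightarrow> complex" where
  "fcol j q = of_bool (res q = j)"

text \<open>A second difference of the indicator of class j, evaluated at class k. The entries -2
  arise because both neighbours of class 0, and both neighbours of class n, fall into one folded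
  class.\<close>

lemma cartan_fcol:
  assumes "j \<le> n" "res q = k"
  shows "fcol j (q + 1) - fcol j q - (fcol j q - fcol j (q - 1)) = - of_int (cartan_C1 n j k)"
proof -
  have k: "k \<le> n" using assms(2) res_le by blast
  consider "per dvd q - int k" | "per dvd q + int k" using res_cases[of q] assms(2) by auto
  then have "fcol j (q + 1) + fcol j (q - 1) = fcol j (int k + 1) + fcol j (int k - 1)"
  proof cases
    case 1
    then have "res (q + 1) = res (int k + 1)" "res (q - 1) = res (int k - 1)" by (auto intro!: res_cong)
    then show ?thesis by (simp add: fcol_def)
  next
    case 2
    then have "res (q + 1) = res (- int k + 1)" "res (q - 1) = res (- int k - 1)" by (auto intro!: res_cong)
    moreover have "res (- int k + 1) = res (int k - 1)" "res (- int k - 1) = res (int k + 1)"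
      using res_uminus[of "int k - 1"] res_uminus[of "int k + 1"] by simp_all
    ultimately show ?thesis by (simp add: fcol_def)
  qed
  moreover have "fcol j (int k + 1) + fcol j (int k - 1) - 2 * of_bool (j = k) = - of_int (cartan_C1 n j k)"
    unfolding fcol_def res_succ[OF k] res_pred[OF k] cartan_C1_def using assms(1) k n_pos by auto
  moreover have "fcol j q = of_bool (j = k)" using assms(2) by (auto simp: fcol_def)
  ultimately show ?thesis by simp
qed

lemma col_type_fcol: "col_type 1 (fcol j)"
  using res_uminus by (auto simp: col_type_def fcol_def res_period psgn_def)

definition fop :: "nat \<Rightarrow> fock \<Rightarrow> fock" where "fop j = Z 1 (fcol j)"
text \<open>The shift in the coefficient makes this the transpose of \<open>fop j\<close>: both
  operators join q - 1 and q, weighted by the class of q - 1.\<close>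

definition eop :: "nat \<Rightarrow> fock \<Rightarrow> fock" where "eop j = Z (-1) (\<lambda>q. fcol j (q - 1))"

lemma flinear_fop: "flinear (fop j)" and flinear_eop: "flinear (eop j)"
  by (simp_all add: fop_def eop_def flinear_Z)

lemma finsupp_fop: "finsupp \<phi> \<Longrightarrow> finsupp (fop j \<phi>)" and finsupp_eop: "finsupp \<phi> \<Longrightarrow> finsupp (eop j \<phi>)"
  by (simp_all add: fop_def eop_def finsupp_Z)

lemma eop_vac: "eop j vac = 0"
  by (simp add: eop_def Z_vac)

lemma fop_vac: "fop k vac = fscale (of_bool (k = i)) (cre (int i + 1) (cre (int i) vac))"
proof -
  have "{int i - 1<..int i} = {int i}" by auto
  then show ?thesis by (simp add: fop_def Z_vac fcol_def res_int[OF i_le] fpt)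
qed

lemma eop_fop_vac: "eop j (fop k vac) = fscale (of_bool (j = i \<and> k = i)) vac"
proof -
  have "cre (int i + 1) (cre (int i) vac) = u (int i + 1) (d (int i) vac)" by (simp add: u_def d_def)
  then have "eop j (cre (int i + 1) (cre (int i) vac)) =
      u (int i + 1) (d (int i) (Z (-1) (\<lambda>q. fcol j (q - 1)) vac) - fscale (fcol j (int i)) (d (int i + 1) vac))
      + fscale (fcol j (int i)) (u (int i) (d (int i) vac))"
    by (simp add: eop_def Z_u Z_d)
  also have "\<dots> = fscale (fcol j (int i)) vac"
  proof -
    have "d (int i + 1) vac = 0" by (simp add: d_def)
    moreover have "u (int i) (d (int i) vac) = vac" by (simp add: u_def d_def ann_cre flinear_simps[OF flinear_cre])
    ultimately show ?thesis using eop_vac[of j] by (simp add: eop_def u_simps d_simps)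
  qed
  finally show ?thesis
    by (simp add: fop_vac flinear_simps[OF flinear_eop] fcol_def res_int[OF i_le]) (auto simp: fpt)
qed

text \<open>The unknown scalar of the commutator is made part of \<open>hop\<close>. The highest
  weight is then read off by applying the commutator to the vacuum, so normal-ordering constants
  never have to be evaluated.\<close>

lemma cartan_relations:
  assumes "j \<le> n"
  obtains hop where "flinear hop" "\<And>\<phi>. finsupp \<phi> \<Longrightarrow> eop j (fop j \<phi>) = fop j (eop j \<phi>) + hop \<phi>"
    "hop vac = fscale (of_bool (j = i)) vac"
    "\<And>k \<phi>. k \<le> n \<Longrightarrow> finsupp \<phi> \<Longrightarrow> hop (fop k \<phi>) = fop k (hop \<phi>) - fscale (of_int (cartan_C1 n j k)) (fop k \<phi>)"
proof -
  define c where "c q = fcol j q - fcol j (q - 1)" for q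
  have cc: "(\<lambda>q. fcol j (q + 1 - 1) * fcol j q - fcol j (q + -1) * fcol j (q - 1)) = c"
    by (auto simp: c_def fcol_def fun_eq_iff)
  obtain \<kappa> where \<kappa>: "\<And>\<phi>. finsupp \<phi> \<Longrightarrow> eop j (fop j \<phi>) = fop j (eop j \<phi>) + Z 0 c \<phi> + fscale \<kappa> \<phi>"
    using Z_commutator[of "-1" "\<lambda>q. fcol j (q - 1)" 1 "fcol j"] unfolding cc eop_def fop_def by auto
  define hop where "hop \<phi> = Z 0 c \<phi> + fscale \<kappa> \<phi>" for \<phi>
  have 1: "flinear hop" by (rule flinearI) (auto simp: hop_def Z_simps fpt algebra_simps)
  have 2: "eop j (fop j \<phi>) = fop j (eop j \<phi>) + hop \<phi>" if "finsupp \<phi>" for \<phi>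
    using \<kappa>[OF that] by (simp add: hop_def add.assoc)
  have 3: "hop vac = fscale (of_bool (j = i)) vac"
    using 2[of vac] eop_fop_vac[of j j] by (simp add: eop_vac flinear_simps[OF flinear_fop])
  have 4: "hop (fop k \<phi>) = fop k (hop \<phi>) - fscale (of_int (cartan_C1 n j k)) (fop k \<phi>)" if k: "k \<le> n" "finsupp \<phi>" for k \<phi>
  proof -
    have cc: "(\<lambda>q. c (q + 1) * fcol k q - fcol k (q + 0) * c q) = (\<lambda>q. - of_int (cartan_C1 n j k) * fcol k q)"
    proof
      fix q
      show "c (q + 1) * fcol k q - fcol k (q + 0) * c q = - of_int (cartan_C1 n j k) * fcol k q"
      proof (cases "res q = k")
        case True
        then show ?thesis using cartan_fcol[OF assms True] by (simp add: c_def fcol_def)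
      qed (simp add: fcol_def)
    qed
    obtain \<kappa>' where "\<And>\<phi>. finsupp \<phi> \<Longrightarrow> Z 0 c (Z 1 (fcol k) \<phi>) = Z 1 (fcol k) (Z 0 c \<phi>) + Z (0 + 1) (\<lambda>q. - of_int (cartan_C1 n j k) * fcol k q) \<phi> + fscale \<kappa>' \<phi>"
      "0 + (1::int) \<noteq> 0 \<Longrightarrow> \<kappa>' = 0"
      by (rule Z_commutator[of 0 c 1 "fcol k", unfolded cc]) blast
    moreover have "Z (0 + 1) (\<lambda>q. - of_int (cartan_C1 n j k) * fcol k q) \<phi> = fscale (- of_int (cartan_C1 n j k)) (fop k \<phi>)"
      unfolding fop_def by (simp only: Z_coeff_scale) simp
    ultimately have "Z 0 c (fop k \<phi>) = fop k (Z 0 c \<phi>) - fscale (of_int (cartan_C1 n j k)) (fop k \<phi>)"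
      using k(2) by (simp add: fop_def)
    then show ?thesis by (simp add: hop_def flinear_simps[OF flinear_fop] fpt)
  qed
  show ?thesis using that[OF 1 2 3 4] by blast
qed

text \<open>Only a scalar survives in the commutator, and comparing both sides on the vacuum shows
  that it is zero.\<close>

lemma eop_fop_commute:
  assumes "j \<noteq> k" "finsupp \<phi>"
  shows "eop j (fop k \<phi>) = fop k (eop j \<phi>)"
proof -
  have cc: "(\<lambda>q. fcol j (q + 1 - 1) * fcol k q - fcol k (q + -1) * fcol j (q - 1)) = (\<lambda>q. 0)"
    using assms(1) by (auto simp: fcol_def fun_eq_iff)
  obtain \<kappa> where \<kappa>: "\<And>\<phi>. finsupp \<phi> \<Longrightarrow> eop j (fop k \<phi>) = fop k (eop j \<phi>) + fscale \<kappa> \<phi>"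
    using Z_commutator[of "-1" "\<lambda>q. fcol j (q - 1)" 1 "fcol k"] unfolding cc eop_def fop_def by (auto simp: Z_coeff_0)
  have "fscale \<kappa> vac = 0"
    using \<kappa>[of vac] eop_fop_vac[of j k] assms(1) by (auto simp: eop_vac flinear_simps[OF flinear_fop])
  then have "\<kappa> = 0" by (auto simp: fpt ket_def split: if_splits)
  then show ?thesis using \<kappa>[OF assms(2)] by simp
qed

section \<open>Words in the lowering operators and products of currents span the same space\<close>

definition fw :: "nat list \<Rightarrow> fock \<Rightarrow> fock" where "fw I = foldr fop I"

lemma fw_simps [simp]: "fw [] \<phi> = \<phi>" "fw (j # I) \<phi> = fop j (fw I \<phi>)"
  by (simp_all add: fw_def)

lemma finsupp_fw: "finsupp \<phi> \<Longrightarrow> finsupp (fw I \<phi>)"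
  by (induction I) (auto simp: finsupp_fop)

text \<open>A lowering operator has symplectic type and height one, so it is a combination of
  currents; a word then expands into products that can be straightened.\<close>

lemma fw_Adm: "fw I vac \<in> Adm (int (length I))"
proof -
  have "fw I vac \<in> filt (length I) (int (length I))"
  proof (induction I)
    case Nil
    show ?case using filt_base[of "[]" 0 0] by simp
  next
    case (Cons j I)
    have "X (1 + per + x) (1 - x) (fw I vac) \<in> filt (length (j # I)) (int (length (j # I)))" for x
      using filt_X[OF Cons.IH, of "1 + per + x" "1 - x"] by (simp add: ht_def add.commute)
    then show ?case
      by (simp add: fop_def Z_col_type[OF col_type_fcol] fv.subspace_sum[OF subspace_filt] fv.subspace_scale[OF subspace_filt])
  qed
  moreover have "filt s H \<subseteq> Adm H" for s H
    unfolding filt_def using straighten by (intro fv.span_minimal subspace_Adm) auto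
  ultimately show ?thesis by blast
qed

definition Mf :: "fock set" where "Mf = fv.span {fw I vac |I. set I \<subseteq> {..n}}"

lemma subspace_Mf: "fv.subspace Mf" by (simp add: Mf_def)

lemma finsupp_Mf: "\<phi> \<in> Mf \<Longrightarrow> finsupp \<phi>"
proof -
  have "Mf \<subseteq> Collect finsupp"
    unfolding Mf_def by (rule fv.span_minimal[OF _ subspace_finsupp]) (auto simp: finsupp_fw)
  then show "\<phi> \<in> Mf \<Longrightarrow> finsupp \<phi>" by blast
qed

lemma fop_Mf: "\<phi> \<in> Mf \<Longrightarrow> j \<le> n \<Longrightarrow> fop j \<phi> \<in> Mf"
proof -
  assume \<phi>: "\<phi> \<in> Mf" and j: "j \<le> n"
  have "fop j ` Mf \<subseteq> Mf"
    unfolding Mf_def fvp.linear_span_image[OF flinear_fop, symmetric]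
  proof (rule fv.span_mono, clarify)
    fix I :: "nat list" assume "set I \<subseteq> {..n}"
    then show "\<exists>I'. fop j (fw I vac) = fw I' vac \<and> set I' \<subseteq> {..n}"
      using j by (intro exI[of _ "j # I"]) auto
  qed
  then show ?thesis using \<phi> by blast
qed

text \<open>Bracketing with \<open>fop j\<close> raises by one each end of class j. The positive
  height excludes a scalar term.\<close>

lemma fop_X:
  assumes "ht (p, r) \<ge> 1" "finsupp \<phi>"
  shows "fop j (X p r \<phi>) = X p r (fop j \<phi>) + fscale (of_bool (res p = j)) (X (p + 1) r \<phi>) + fscale (of_bool (res r = j)) (X p (r + 1) \<phi>)"
proof -
  define h where "h = p + r - per - 1"
  have h: "1 + h \<noteq> 0" using assms(1) by (simp add: h_def ht_def)
  have cc: "(\<lambda>q. fcol j (q + h) * Jcol p r q - Jcol p r (q + 1) * fcol j q) =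
    (\<lambda>q. of_bool (res p = j) * Jcol (p + 1) r q + of_bool (res r = j) * Jcol p (r + 1) q)"
  proof
    fix q
    have a1: "fcol j (q + h) * of_bool (per dvd q + r - 1) = of_bool (res p = j) * of_bool (per dvd q + r - 1)"
    proof (cases "per dvd q + r - 1")
      case True
      have "q + h - p = (q + r - 1) - per" by (simp add: h_def)
      then have "res (q + h) = res p" using True by (intro res_cong) (metis dvd_diff dvd_refl)
      then show ?thesis by (simp add: fcol_def)
    qed simp
    have a2: "fcol j (q + h) * of_bool (per dvd q + p - 1) = of_bool (res r = j) * of_bool (per dvd q + p - 1)"
    proof (cases "per dvd q + p - 1")
      case True
      have "q + h - r = (q + p - 1) - per" by (simp add: h_def)
      then have "res (q + h) = res r" using True by (intro res_cong) (metis dvd_diff dvd_refl)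
      then show ?thesis by (simp add: fcol_def)
    qed simp
    have a3: "fcol j q * of_bool (per dvd q + x) = of_bool (res x = j) * of_bool (per dvd q + x)" for x
      using res_eq_iff[of q x] by (auto simp: fcol_def)
    have e: "q + 1 + x - 1 = q + x" "q + (x + 1) - 1 = q + x" for x by auto
    have "fcol j (q + h) * Jcol p r q - Jcol p r (q + 1) * fcol j q =
      psgn q * (fcol j (q + h) * of_bool (per dvd q + r - 1) + fcol j (q + h) * of_bool (per dvd q + p - 1)
        + fcol j q * of_bool (per dvd q + r) + fcol j q * of_bool (per dvd q + p))"
      unfolding Jcol_def e psgn_add by (simp add: psgn_def algebra_simps)
    also have "\<dots> = of_bool (res p = j) * Jcol (p + 1) r q + of_bool (res r = j) * Jcol p (r + 1) q"
      unfolding a1 a2 a3 Jcol_def e by (simp only: distrib_left distrib_right add_ac mult_ac)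
    finally show "fcol j (q + h) * Jcol p r q - Jcol p r (q + 1) * fcol j q =
       of_bool (res p = j) * Jcol (p + 1) r q + of_bool (res r = j) * Jcol p (r + 1) q" .
  qed
  obtain \<kappa> where k: "\<And>\<phi>. finsupp \<phi> \<Longrightarrow> Z 1 (fcol j) (Z h (Jcol p r) \<phi>) = Z h (Jcol p r) (Z 1 (fcol j) \<phi>)
      + Z (1 + h) (\<lambda>q. of_bool (res p = j) * Jcol (p + 1) r q + of_bool (res r = j) * Jcol p (r + 1) q) \<phi> + fscale \<kappa> \<phi>"
    "1 + h \<noteq> 0 \<Longrightarrow> \<kappa> = 0"
    by (rule Z_commutator[of 1 "fcol j" h "Jcol p r", unfolded cc]) blast
  have hh: "p + 1 + r - per - 1 = 1 + h" "p + (r + 1) - per - 1 = 1 + h" by (auto simp: h_def)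
  show ?thesis
    using k(1)[OF assms(2)] k(2)[OF h] unfolding X_def fop_def hh h_def[symmetric] Z_coeff_add Z_coeff_scale
    by (simp add: add.assoc)
qed

text \<open>At height one the coefficient function is even and periodic, hence a function of the
  class alone, and the current is a combination of the \<open>fop j\<close>.\<close>

lemma X_Mf_base:
  assumes "p + r = per + 2" "\<phi> \<in> Mf"
  shows "X p r \<phi> \<in> Mf"
proof -
  define c where "c = Jcol p r"
  have c1: "col_type 1 c" using col_type_Jcol[of p r] assms(1) by (simp add: c_def)
  have per: "c (q + per) = c q" for q using c1 by (simp add: col_type_def)
  have neg: "c (- q) = c q" for q using c1 by (simp add: col_type_def psgn_def)
  have cong: "c q = c q'" if "per dvd q - q'" for q q'
  proof -
    obtain t where "q - q' = per * t" using \<open>per dvd q - q'\<close> by (elim dvdE)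
    then have "q = q' + per * t" by simp
    then show ?thesis using periodic_mult[of c, OF per] by simp
  qed
  have "c q = c (int (res q))" for q
    using res_cases[of q] cong[of q "int (res q)"] cong[of q "- int (res q)"] neg[of "int (res q)"] by auto
  then have cq: "c q = (\<Sum>j\<le>n. c (int j) * fcol j q)" for q
    using res_le[of q] by (simp add: fcol_def if_distrib)
  have "X p r \<phi> = Z 1 c \<phi>" using assms(1) by (simp add: X_def c_def)
  also have "\<dots> = Z 1 (\<lambda>q. \<Sum>j\<le>n. c (int j) * fcol j q) \<phi>"
    by (rule Z_coeff_cong) (rule cq)
  also have "\<dots> = (\<Sum>j\<le>n. fscale (c (int j)) (fop j \<phi>))" by (simp add: Z_coeff_sum Z_coeff_scale fop_def)
  also have "\<dots> \<in> Mf"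
    using assms(2) by (intro fv.subspace_sum[OF subspace_Mf] fv.subspace_scale[OF subspace_Mf] fop_Mf) auto
  finally show ?thesis .
qed

lemma res_neighbour: "res p \<noteq> res (p - 1)"
proof
  assume "res p = res (p - 1)"
  then have "per dvd 1 \<or> per dvd 2 * p - 1" unfolding res_eq_iff by (simp add: algebra_simps)
  then have "even (1::int) \<or> even (2 * p - 1)" using per_even dvd_trans by blast
  then show False by simp
qed

text \<open>Induction on the height, and within it on the width. Raising y - 1 to y by a bracket
  yields the wanted current and possibly one with x raised as well, which is narrower. At width 0
  the classes of x - 1 and x differ, so no second term appears; at width 1 both terms coincide and
  one divides by 2.\<close>

lemma X_Mf: "p + r \<ge> per + 2 \<Longrightarrow> \<phi> \<in> Mf \<Longrightarrow> X p r \<phi> \<in> Mf"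
proof (induction "nat (p + r - per - 2)" arbitrary: p r \<phi>)
  case 0
  then show ?case by (intro X_Mf_base) auto
next
  case (Suc N)
  have IH: "X p' r' \<phi> \<in> Mf" if "p' + r' = p + r - 1" "\<phi> \<in> Mf" for p' r' \<phi>
    using Suc.hyps(1)[of p' r' \<phi>] that Suc.hyps(2) by auto
  have comm: "fscale (of_bool (res p' = j)) (X (p' + 1) r' \<phi>) + fscale (of_bool (res r' = j)) (X p' (r' + 1) \<phi>) \<in> Mf"
    if "p' + r' = p + r - 1" "\<phi> \<in> Mf" "j \<le> n" for p' r' j \<phi>
  proof -
    have h: "ht (p', r') \<ge> 1" using that(1) Suc.hyps(2) by (simp add: ht_def)
    have "fscale (of_bool (res p' = j)) (X (p' + 1) r' \<phi>) + fscale (of_bool (res r' = j)) (X p' (r' + 1) \<phi>)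
      = fop j (X p' r' \<phi>) - X p' r' (fop j \<phi>)"
      unfolding fop_X[OF h finsupp_Mf[OF that(2)]] by simp
    also have "\<dots> \<in> Mf" using that by (intro fv.subspace_diff[OF subspace_Mf] fop_Mf IH)
    finally show ?thesis .
  qed
  have "X x y \<phi> \<in> Mf" if "x \<le> y" "x + y = p + r" "\<phi> \<in> Mf" for x y \<phi>
    using that
  proof (induction "nat (y - x)" arbitrary: x y \<phi> rule: less_induct)
    case inner: less
    consider "y = x" | "y = x + 1" | "y \<ge> x + 2" using inner.prems by linarith
    then show ?case
    proof cases
      case 1
      then show ?thesis using comm[of "x - 1" x \<phi> "res (x - 1)"] inner.prems res_neighbour[of x] res_le by simp
    next
      case 2
      then have "X (x + 1) x \<phi> + X x (x + 1) \<phi> \<in> Mf"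
        using comm[of x x \<phi> "res x"] inner.prems res_le by simp
      then have "fscale 2 (X x y \<phi>) \<in> Mf" using X_sym[of "x + 1" x] 2 by (simp add: fv.scale_left_distrib[of 1 1, simplified])
      then have "fscale (1/2) (fscale 2 (X x y \<phi>)) \<in> Mf" by (rule fv.subspace_scale[OF subspace_Mf])
      then show ?thesis by simp
    next
      case 3
      let ?A = "fscale (of_bool (res x = res (y - 1))) (X (x + 1) (y - 1) \<phi>)"
      have "?A + X x y \<phi> \<in> Mf"
        using comm[of x "y - 1" \<phi> "res (y - 1)"] inner.prems res_le by simp
      moreover have "?A \<in> Mf"
        using 3 inner by (intro fv.subspace_scale[OF subspace_Mf]) auto
      ultimately have "(?A + X x y \<phi>) - ?A \<in> Mf" by (rule fv.subspace_diff[OF subspace_Mf])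
      then show ?thesis by simp
    qed
  qed
  from this[of p r] this[of r p] show ?case using Suc.prems X_sym[of p r] by (cases "p \<le> r") auto
qed

lemma Xs_Mf: "(\<And>e. e \<in> set l \<Longrightarrow> ht e \<ge> 1) \<Longrightarrow> Xs l vac \<in> Mf"
proof (induction l)
  case Nil
  have "vac = fw [] vac" by simp
  then show ?case unfolding Mf_def by (metis (mono_tags, lifting) Xs_simps(1) empty_set empty_subsetI fv.span_base mem_Collect_eq)
next
  case (Cons e l)
  have "ht e \<ge> 1" using Cons.prems by simp
  then show ?case using Cons X_Mf[of "fst e" "snd e"] by (simp add: ht_def)
qed

lemma admissible_ht: "admissible_list l \<Longrightarrow> e \<in> set l \<Longrightarrow> ht e \<ge> 1"
  by (force simp: admissible_list_def ht_def)

section \<open>Transposition and the positive form\<close>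

lemma u_transpose: "u p (ket T) S = d p (ket S) T"
  by (auto simp: u_def d_def cre_def ann_def ket_def fsign_finsert fsign_remove)

lemma ud_ket: "\<exists>s T'. d q (ket T) = fscale s (ket T')"
proof -
  have "\<exists>s T'. cre q (ket T) = fscale s (ket T')"
  proof (cases "q |\<in>| T")
    case True
    then have "cre q (ket T) = fscale 0 (ket T)" by (auto simp: cre_def ket_def fpt)
    then show ?thesis by blast
  next
    case False
    then show ?thesis using cre_ket by blast
  qed
  moreover have "\<exists>s T'. ann q (ket T) = fscale s (ket T')"
  proof (cases "q |\<in>| T")
    case True
    then have "ann q (ket T) = fscale (fsign q (T |-| {|q|})) (ket (T |-| {|q|}))"
      by (auto simp: ann_def ket_def fpt)
    then show ?thesis by blast
  next
    case False
    then have "ann q (ket T) = fscale 0 (ket T)" by (simp add: ann_ket)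
    then show ?thesis by blast
  qed
  ultimately show ?thesis by (simp add: d_def)
qed

lemma nord_transpose: "nord p q (ket T) S = nord q p (ket S) T"
proof -
  obtain s T' where 1: "d q (ket T) = fscale s (ket T')" using ud_ket by blast
  obtain s' S' where 2: "d p (ket S) = fscale s' (ket S')" using ud_ket by blast
  have "u p (d q (ket T)) S = s * d p (ket S) T'" by (simp add: 1 u_simps fscale_apply u_transpose)
  also have "\<dots> = s' * (s * ket S' T')" by (simp add: 2 fscale_apply)
  also have "ket S' T' = ket T' S'" by (auto simp: ket_def)
  also have "s' * (s * ket T' S') = s' * d q (ket T) S'" by (simp add: 1 fscale_apply)
  also have "\<dots> = u q (d p (ket S)) T" by (simp add: 2 u_simps fscale_apply u_transpose)
  finally show ?thesis by (auto simp: nord_def ket_def)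
qed

lemma eop_transpose: "eop j (ket T) S = fop j (ket S) T"
proof -
  define R where "R = bnd S + bnd T + 2"
  have b: "bnd S \<ge> 0" "bnd T \<ge> 0" using bnd_lev[of S] bnd_lev[of T] by linarith+
  have "eop j (ket T) S = (\<Sum>q\<in>{-R..R + 1}. fcol j (q - 1) * nord (q + -1) q (ket T) S)"
    unfolding eop_def by (rule Z_eq) (use b in \<open>auto simp: R_def\<close>)
  also have "\<dots> = (\<Sum>q\<in>{-R - 1..R}. fcol j q * nord q (q + 1) (ket T) S)"
    by (rule sum.reindex_bij_witness[where i = "\<lambda>q. q + 1" and j = "\<lambda>q. q - 1"]) auto
  also have "\<dots> = (\<Sum>q\<in>{-R - 1..R}. fcol j q * nord (q + 1) q (ket S) T)"
    by (simp add: nord_transpose[of _ _ T S])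
  also have "\<dots> = fop j (ket S) T"
    unfolding fop_def by (rule Z_eq[symmetric]) (use b in \<open>auto simp: R_def\<close>)
  finally show ?thesis .
qed

text \<open>Bilinear, without conjugation. Summing over the support of the first argument keeps it
  finite; conjugation enters only in the final positivity argument.\<close>

definition ip :: "fock \<Rightarrow> fock \<Rightarrow> complex" where
  "ip \<phi> \<chi> = (\<Sum>S | \<phi> S \<noteq> 0. \<phi> S * \<chi> S)"

lemma flinear_expand_at:
  assumes "flinear T" "finsupp \<phi>"
  shows "T \<phi> R = (\<Sum>S | \<phi> S \<noteq> 0. \<phi> S * T (ket S) R)"
proof -
  have "T \<phi> = (\<Sum>S | \<phi> S \<noteq> 0. fscale (\<phi> S) (T (ket S)))"
    by (subst finsupp_expand[OF assms(2)]) (simp add: flinear_simps[OF assms(1)])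
  then show ?thesis by (simp add: sum_fun_apply fscale_apply)
qed

lemma ip_eop:
  assumes "finsupp \<phi>" "finsupp \<chi>"
  shows "ip (eop j \<phi>) \<chi> = ip \<phi> (fop j \<chi>)"
proof -
  let ?F = "{S. \<phi> S \<noteq> 0}" and ?G = "{S. \<chi> S \<noteq> 0}"
  have f: "finite ?F" "finite ?G" using assms by (auto simp: finsupp_def)
  have fe: "finite {S. eop j \<phi> S \<noteq> 0}" using finsupp_eop[OF assms(1)] by (simp add: finsupp_def)
  have "ip (eop j \<phi>) \<chi> = (\<Sum>T\<in>{S. eop j \<phi> S \<noteq> 0} \<union> ?G. eop j \<phi> T * \<chi> T)"
    unfolding ip_def by (rule finite_sum_ip) (use f fe in auto)
  also have "\<dots> = (\<Sum>T\<in>?G. eop j \<phi> T * \<chi> T)" by (rule sum.mono_neutral_right) (use f fe in auto)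
  also have "\<dots> = (\<Sum>T\<in>?G. \<Sum>S\<in>?F. \<phi> S * \<chi> T * fop j (ket T) S)"
    by (simp add: flinear_expand_at[OF flinear_eop assms(1)] eop_transpose sum_distrib_right sum_distrib_left mult_ac)
  also have "\<dots> = (\<Sum>S\<in>?F. \<Sum>T\<in>?G. \<phi> S * \<chi> T * fop j (ket T) S)" by (rule sum.swap)
  also have "\<dots> = ip \<phi> (fop j \<chi>)"
    unfolding ip_def by (simp add: flinear_expand_at[OF flinear_fop assms(2)] sum_distrib_left mult_ac)
  finally show ?thesis .
qed

text \<open>The head of the list acts first, so that \<open>ew K\<close> is the transpose of
  \<open>fw K\<close>.\<close>

primrec ew :: "nat list \<Rightarrow> fock \<Rightarrow> fock" where
  "ew [] \<phi> = \<phi>"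
| "ew (j # K) \<phi> = ew K (eop j \<phi>)"

lemma finsupp_ew: "finsupp \<phi> \<Longrightarrow> finsupp (ew K \<phi>)"
  by (induction K arbitrary: \<phi>) (auto simp: finsupp_eop)

lemma ip_ew: "finsupp \<phi> \<Longrightarrow> ip (ew K \<phi>) vac = ip \<phi> (fw K vac)"
  by (induction K arbitrary: \<phi>) (auto simp: finsupp_eop ip_eop finsupp_fw)

lemma ip_vac: "finsupp \<phi> \<Longrightarrow> ip \<phi> vac = \<phi> {||}"
  unfolding ip_def by (subst finite_sum_ip[of "insert {||} {S. \<phi> S \<noteq> 0}"]) (auto simp: finsupp_def ket_def if_distrib sum.If_cases cong: if_cong)

lemma fw_real: "cnj (fw I vac S) = fw I vac S"
proof (induction I arbitrary: S)
  case Nil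
  show ?case by (simp add: ket_def)
next
  case (Cons j I)
  have cr: "\<And>S. cnj (cre p \<phi> S) = cre p \<phi> S" "\<And>S. cnj (ann p \<phi> S) = ann p \<phi> S" if "\<And>S. cnj (\<phi> S) = \<phi> S" for p \<phi>
    using that by (auto simp: cre_def ann_def fsign_real)
  have ud: "\<And>S. cnj (u p \<phi> S) = u p \<phi> S" "\<And>S. cnj (d p \<phi> S) = d p \<phi> S" if "\<And>S. cnj (\<phi> S) = \<phi> S" for p \<phi>
    using cr[OF that] by (auto simp: u_def d_def)
  have "cnj (nord p q (fw I vac) S) = nord p q (fw I vac) S" for p q S
    using ud(1)[OF ud(2)[OF Cons.IH]] Cons.IH by (auto simp: nord_def)
  then show ?case by (simp add: fop_def Z_def fcol_def)
qed

text \<open>Words have real coefficients, so the complex conjugate of the combination is again a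
  combination of the same words. The combination is orthogonal to all of these, hence has norm
  zero.\<close>

lemma fock_gram_nondegenerate:
  assumes fin: "finite W" and len: "\<And>I. I \<in> W \<Longrightarrow> P I"
    and ann: "\<And>K. P K \<Longrightarrow> ew K (\<Sum>I\<in>W. fscale (c I) (fw I vac)) {||} = 0"
  shows "(\<Sum>I\<in>W. fscale (c I) (fw I vac)) = 0"
proof -
  define w where "w = (\<Sum>I\<in>W. fscale (c I) (fw I vac))"
  have fs: "finsupp w"
    unfolding w_def by (intro fv.subspace_sum[OF subspace_finsupp, simplified] finsupp_scale finsupp_fw finsupp_ket)
  have 0: "ip w (fw K vac) = 0" if "K \<in> W" for K
    using ann[OF len[OF that]] ip_ew[OF fs, of K] ip_vac[OF finsupp_ew[OF fs], of K] by (simp add: w_def)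
  have conj: "cnj (w S) = (\<Sum>K\<in>W. cnj (c K) * fw K vac S)" for S
    by (simp add: w_def sum_fun_apply fscale_apply fw_real)
  have "(\<Sum>S | w S \<noteq> 0. w S * cnj (w S)) = (\<Sum>K\<in>W. cnj (c K) * ip w (fw K vac))"
    unfolding conj ip_def sum_distrib_left by (subst sum.swap) (simp add: mult_ac)
  also have "\<dots> = 0" using 0 by simp
  finally have z: "(\<Sum>S | w S \<noteq> 0. w S * cnj (w S)) = 0" .
  have "complex_of_real (\<Sum>S | w S \<noteq> 0. (cmod (w S))\<^sup>2) = (\<Sum>S | w S \<noteq> 0. w S * cnj (w S))"
    unfolding of_real_sum by (rule sum.cong[OF refl]) (rule complex_norm_square)
  then have "(\<Sum>S | w S \<noteq> 0. (cmod (w S))\<^sup>2) = 0" using z by (metis of_real_eq_0_iff)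
  then have "\<forall>S\<in>{S. w S \<noteq> 0}. (cmod (w S))\<^sup>2 = 0"
    using fs by (subst (asm) sum_nonneg_eq_0_iff) (auto simp: finsupp_def)
  then have "w = 0" by (auto simp: fun_eq_iff)
  then show ?thesis by (simp add: w_def)
qed

end

section \<open>Gram matrices of words in the lowering operators\<close>

text \<open>Expansion of e_j applied to a word: e_j moves to the right, and each time it meets f_j
  it leaves the value of the j-th coroot on the weight of the remaining suffix.\<close>

fun lowering :: "(nat \<Rightarrow> nat \<Rightarrow> int) \<Rightarrow> (nat \<Rightarrow> complex) \<Rightarrow> nat \<Rightarrow> nat list \<Rightarrow> (complex \<times> nat list) list" where
  "lowering A lam j [] = []"
| "lowering A lam j (k # I) = map (\<lambda>(c, I'). (c, k # I')) (lowering A lam j I)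
     @ (if j = k then [(lam j - (\<Sum>l\<leftarrow>I. of_int (A j l)), I)] else [])"

text \<open>The scalar by which a word of raising operators sends a word of the same length to the
  highest weight vector. It involves only the Cartan matrix and the highest weight, so module and
  Fock space share it.\<close>

fun gram :: "(nat \<Rightarrow> nat \<Rightarrow> int) \<Rightarrow> (nat \<Rightarrow> complex) \<Rightarrow> nat list \<Rightarrow> nat list \<Rightarrow> complex" where
  "gram A lam [] I = 1"
| "gram A lam (j # J) I = (\<Sum>(c, I')\<leftarrow>lowering A lam j I. c * gram A lam J I')"

lemma lowering_length: "(c, I') \<in> set (lowering A lam j I) \<Longrightarrow> length I = Suc (length I') \<and> set I' \<subseteq> set I"
  by (induction I arbitrary: I') (fastforce split: if_splits)+

text \<open>The common ground of the module and the Fock space. The relations are stated on words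
  applied to v because the Fock space provides them on finitely supported vectors.\<close>

locale hw_words = vector_space scale
  for scale :: "complex \<Rightarrow> 'v::ab_group_add \<Rightarrow> 'v" +
  fixes N :: nat and A :: "nat \<Rightarrow> nat \<Rightarrow> int" and lam :: "nat \<Rightarrow> complex"
    and E F H :: "nat \<Rightarrow> 'v \<Rightarrow> 'v" and v :: 'v
  assumes linE: "j < N \<Longrightarrow> Vector_Spaces.linear scale scale (E j)"
    and linF: "j < N \<Longrightarrow> Vector_Spaces.linear scale scale (F j)"
    and Ev: "j < N \<Longrightarrow> E j v = 0" and Hv: "j < N \<Longrightarrow> H j v = scale (lam j) v"
    and EF: "\<And>I j k. set I \<subseteq> {..<N} \<Longrightarrow> j < N \<Longrightarrow> k < N \<Longrightarrow>
       E j (F k (foldr F I v)) = F k (E j (foldr F I v)) + (if j = k then H j (foldr F I v) else 0)"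
    and linH: "j < N \<Longrightarrow> Vector_Spaces.linear scale scale (H j)"
    and HF: "\<And>I j k. set I \<subseteq> {..<N} \<Longrightarrow> j < N \<Longrightarrow> k < N \<Longrightarrow>
       H j (F k (foldr F I v)) = F k (H j (foldr F I v)) - scale (of_int (A j k)) (F k (foldr F I v))"
begin

sublocale pair: vector_space_pair scale scale ..

lemma linear_sum_list:
  assumes "Vector_Spaces.linear scale scale T"
  shows "T (sum_list xs) = sum_list (map T xs)"
  by (induction xs) (use assms in \<open>auto simp: pair.linear_add pair.linear_0\<close>)

lemma H_word: "set I \<subseteq> {..<N} \<Longrightarrow> j < N \<Longrightarrow> H j (foldr F I v) = scale (lam j - (\<Sum>l\<leftarrow>I. of_int (A j l))) (foldr F I v)"
proof (induction I)
  case Nil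
  then show ?case by (simp add: Hv)
next
  case (Cons k I)
  then have "H j (F k (foldr F I v)) = F k (scale (lam j - (\<Sum>l\<leftarrow>I. of_int (A j l))) (foldr F I v)) - scale (of_int (A j k)) (F k (foldr F I v))"
    using HF[of I j k] by simp
  also have "\<dots> = scale (lam j - (\<Sum>l\<leftarrow>k # I. of_int (A j l))) (F k (foldr F I v))"
    using Cons.prems by (simp add: pair.linear_scale[OF linF] pair.linear_diff[OF linF] algebra_simps)
  finally show ?case by simp
qed

lemma E_word: "set I \<subseteq> {..<N} \<Longrightarrow> j < N \<Longrightarrow>
  E j (foldr F I v) = (\<Sum>(c, I')\<leftarrow>lowering A lam j I. scale c (foldr F I' v))"
proof (induction I)
  case Nil
  then show ?case by (simp add: Ev)
next
  case (Cons k I)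
  have k: "k < N" "set I \<subseteq> {..<N}" using Cons.prems by auto
  have "E j (foldr F (k # I) v) = F k (\<Sum>(c, I')\<leftarrow>lowering A lam j I. scale c (foldr F I' v)) + (if j = k then H j (foldr F I v) else 0)"
    using EF[OF k(2) Cons.prems(2) k(1)] Cons.IH[OF k(2) Cons.prems(2)] by simp
  also have "F k (\<Sum>(c, I')\<leftarrow>lowering A lam j I. scale c (foldr F I' v)) = (\<Sum>(c, I')\<leftarrow>lowering A lam j I. scale c (F k (foldr F I' v)))"
    by (simp add: linear_sum_list[OF linF[OF k(1)]] o_def split_def pair.linear_scale[OF linF[OF k(1)]])
  finally show ?case
    using H_word[OF k(2) Cons.prems(2)] by (auto simp: o_def split_def)
qed

definition EW :: "nat list \<Rightarrow> 'v \<Rightarrow> 'v" where "EW J x = fold E J x"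

lemma linear_EW: "set J \<subseteq> {..<N} \<Longrightarrow> Vector_Spaces.linear scale scale (EW J)"
proof (induction J)
  case Nil
  show ?case by unfold_locales (auto simp: EW_def)
next
  case (Cons j J)
  have "EW (j # J) = EW J \<circ> E j" by (auto simp: EW_def)
  moreover have "Vector_Spaces.linear scale scale (EW J \<circ> E j)"
    using Cons by (intro Vector_Spaces.linear_compose[of scale scale _ scale] linE) auto
  ultimately show ?case by (simp only:)
qed

lemma EW_word: "set I \<subseteq> {..<N} \<Longrightarrow> set J \<subseteq> {..<N} \<Longrightarrow> length J = length I \<Longrightarrow>
  EW J (foldr F I v) = scale (gram A lam J I) v"
proof (induction J arbitrary: I)
  case Nil
  then show ?case by (simp add: EW_def)
next
  case (Cons j J)
  have j: "j < N" "set J \<subseteq> {..<N}" using Cons.prems by auto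
  have IH: "EW J (foldr F I' v) = scale (gram A lam J I') v" if "(c, I') \<in> set (lowering A lam j I)" for c I'
    using lowering_length[OF that] Cons.prems by (intro Cons.IH) auto
  have "EW (j # J) (foldr F I v) = EW J (\<Sum>(c, I')\<leftarrow>lowering A lam j I. scale c (foldr F I' v))"
    using E_word[OF Cons.prems(1) j(1)] by (simp add: EW_def)
  also have "\<dots> = (\<Sum>(c, I')\<leftarrow>lowering A lam j I. scale c (EW J (foldr F I' v)))"
    by (simp add: linear_sum_list[OF linear_EW[OF j(2)]] o_def split_def pair.linear_scale[OF linear_EW[OF j(2)]])
  also have "\<dots> = (\<Sum>(c, I')\<leftarrow>lowering A lam j I. scale (c * gram A lam J I') v)"
    by (rule arg_cong[of _ _ sum_list], rule map_cong[OF refl]) (auto simp: IH)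
  also have "\<dots> = scale (\<Sum>(c, I')\<leftarrow>lowering A lam j I. c * gram A lam J I') v"
  proof -
    have "(\<Sum>(c, I')\<leftarrow>xs. scale (c * gram A lam J I') v) = scale (\<Sum>(c, I')\<leftarrow>xs. c * gram A lam J I') v" for xs
      by (induction xs) (auto simp: scale_left_distrib)
    then show ?thesis .
  qed
  finally show ?case by simp
qed

lemma EW_span: "set I \<subseteq> {..<N} \<Longrightarrow> set J \<subseteq> {..<N} \<Longrightarrow> length J \<le> length I \<Longrightarrow>
  EW J (foldr F I v) \<in> span {foldr F I' v |I'. length I' = length I - length J \<and> set I' \<subseteq> {..<N}}"
proof (induction J arbitrary: I)
  case Nil
  then show ?case by (auto simp: EW_def intro!: span_base)
next
  case (Cons j J)
  have j: "j < N" "set J \<subseteq> {..<N}" using Cons.prems by auto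
  have IH: "EW J (foldr F I' v) \<in> span {foldr F I' v |I'. length I' = length I - length (j # J) \<and> set I' \<subseteq> {..<N}}"
    if "(c, I') \<in> set (lowering A lam j I)" for c I'
    using lowering_length[OF that] Cons.prems Cons.IH[of I'] by auto
  have "EW (j # J) (foldr F I v) = EW J (\<Sum>(c, I')\<leftarrow>lowering A lam j I. scale c (foldr F I' v))"
    using E_word[OF Cons.prems(1) j(1)] by (simp add: EW_def)
  also have "\<dots> = (\<Sum>(c, I')\<leftarrow>lowering A lam j I. scale c (EW J (foldr F I' v)))"
    by (simp add: linear_sum_list[OF linear_EW[OF j(2)]] o_def split_def pair.linear_scale[OF linear_EW[OF j(2)]])
  also have "\<dots> \<in> span {foldr F I' v |I'. length I' = length I - length (j # J) \<and> set I' \<subseteq> {..<N}}"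
  proof -
    have sl: "sum_list xs \<in> span B" if "\<And>x. x \<in> set xs \<Longrightarrow> x \<in> span B" for xs B
      using that by (induction xs) (auto intro: span_add span_zero)
    show ?thesis
    proof (rule sl)
      fix x assume "x \<in> set (map (\<lambda>(c, I'). scale c (EW J (foldr F I' v))) (lowering A lam j I))"
      then obtain c I' where "(c, I') \<in> set (lowering A lam j I)" "x = scale c (EW J (foldr F I' v))" by auto
      then show "x \<in> span {foldr F I' v |I'. length I' = length I - length (j # J) \<and> set I' \<subseteq> {..<N}}"
        using span_scale[OF IH] by simp
    qed
  qed
  finally show ?case .
qed

text \<open>The two sides differ only in the origin of \<open>nondeg\<close>: irreducibility
  supplies it for the module, positivity of the form for the Fock space.\<close>

lemma relation_iff_gram:
  assumes W: "finite W" "\<And>I. I \<in> W \<Longrightarrow> set I \<subseteq> {..<N} \<and> length I = m" and "v \<noteq> 0"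
    and nondeg: "\<And>c. (\<And>J. set J \<subseteq> {..<N} \<Longrightarrow> length J = m \<Longrightarrow> EW J (\<Sum>I\<in>W. scale (c I) (foldr F I v)) = 0)
       \<Longrightarrow> (\<Sum>I\<in>W. scale (c I) (foldr F I v)) = 0"
  shows "(\<Sum>I\<in>W. scale (c I) (foldr F I v)) = 0 \<longleftrightarrow>
    (\<forall>J. set J \<subseteq> {..<N} \<longrightarrow> length J = m \<longrightarrow> (\<Sum>I\<in>W. c I * gram A lam J I) = 0)"
proof -
  have EWJ: "EW J (\<Sum>I\<in>W. scale (c I) (foldr F I v)) = scale (\<Sum>I\<in>W. c I * gram A lam J I) v"
    if "set J \<subseteq> {..<N}" "length J = m" for J
  proof -
    have "EW J (\<Sum>I\<in>W. scale (c I) (foldr F I v)) = (\<Sum>I\<in>W. scale (c I) (EW J (foldr F I v)))"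
      by (simp add: pair.linear_sum[OF linear_EW[OF that(1)]] pair.linear_scale[OF linear_EW[OF that(1)]])
    also have "\<dots> = (\<Sum>I\<in>W. scale (c I * gram A lam J I) v)"
      by (rule sum.cong[OF refl]) (use W that in \<open>auto simp: EW_word\<close>)
    finally show ?thesis by (simp add: scale_sum_left)
  qed
  show ?thesis
  proof
    assume "(\<Sum>I\<in>W. scale (c I) (foldr F I v)) = 0"
    then show "\<forall>J. set J \<subseteq> {..<N} \<longrightarrow> length J = m \<longrightarrow> (\<Sum>I\<in>W. c I * gram A lam J I) = 0"
      using EWJ \<open>v \<noteq> 0\<close> pair.linear_0[OF linear_EW] by auto
  next
    assume "\<forall>J. set J \<subseteq> {..<N} \<longrightarrow> length J = m \<longrightarrow> (\<Sum>I\<in>W. c I * gram A lam J I) = 0"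
    then show "(\<Sum>I\<in>W. scale (c I) (foldr F I v)) = 0"
      using nondeg[of c] EWJ by simp
  qed
qed

end

text \<open>Indices are chosen on which x is injective with a basis of the span as image. Since y
  obeys the same relations, it is injective, independent and spanning on the same indices.\<close>

lemma (in vector_space_pair) dim_eq_of_same_relations:
  assumes fin: "finite W"
    and rel: "\<And>c. (\<Sum>I\<in>W. s1 (c I) (x I)) = 0 \<longleftrightarrow> (\<Sum>I\<in>W. s2 (c I) (y I)) = 0"
  shows "vs1.dim (vs1.span (x ` W)) = vs2.dim (vs2.span (y ` W))"
proof -
  have relU: "(\<Sum>I\<in>U. s1 (c I) (x I)) = 0 \<longleftrightarrow> (\<Sum>I\<in>U. s2 (c I) (y I)) = 0" if "U \<subseteq> W" for U c
  proof -
    have "(\<Sum>I\<in>W. s1 (if I \<in> U then c I else 0) (x I)) = (\<Sum>I\<in>U. s1 (c I) (x I))"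
      "(\<Sum>I\<in>W. s2 (if I \<in> U then c I else 0) (y I)) = (\<Sum>I\<in>U. s2 (c I) (y I))"
      by (rule sum.mono_neutral_cong_right; use fin that in auto)+
    then show ?thesis using rel[of "\<lambda>I. if I \<in> U then c I else 0"] by simp
  qed
  obtain B where B: "B \<subseteq> x ` W" "vs1.independent B" "x ` W \<subseteq> vs1.span B"
    using vs1.maximal_independent_subset[of "x ` W"] by blast
  obtain S where S: "S \<subseteq> W" "inj_on x S" "B = x ` S"
    using B(1) unfolding subset_image_inj by blast
  have finS: "finite S" using S(1) fin finite_subset by blast
  have ind: "c I = 0" if "(\<Sum>I\<in>S. s1 (c I) (x I)) = 0" "I \<in> S" for c I
  proof -
    have "(\<Sum>b\<in>x ` S. s1 (c (the_inv_into S x b)) b) = (\<Sum>I\<in>S. s1 (c I) (x I))"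
      by (subst sum.reindex[OF S(2)]) (auto simp: the_inv_into_f_f[OF S(2)])
    then have "c (the_inv_into S x (x I)) = 0"
      using B(2) that finS S(3) vs1.independentD[of B "x ` S" "\<lambda>b. c (the_inv_into S x b)" "x I"] by auto
    then show ?thesis using that(2) by (simp add: the_inv_into_f_f[OF S(2)])
  qed
  have ind2: "c I = 0" if "(\<Sum>I\<in>S. s2 (c I) (y I)) = 0" "I \<in> S" for c I
    using ind[of c I] relU[OF S(1), of c] that by blast
  have injy: "inj_on y S"
  proof (rule inj_onI, rule ccontr)
    fix I I' assume I: "I \<in> S" "I' \<in> S" "y I = y I'" "I \<noteq> I'"
    define c where "c k = (if k = I then 1 else if k = I' then -1 else 0 :: 'a)" for k
    have "(\<Sum>k\<in>S. s2 (c k) (y k)) = (\<Sum>k\<in>{I, I'}. s2 (c k) (y k))"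
      by (rule sum.mono_neutral_right) (use finS I in \<open>auto simp: c_def\<close>)
    also have "\<dots> = 0" using I by (simp add: c_def)
    finally have "c I = 0" using ind2 I by blast
    then show False by (simp add: c_def)
  qed
  have indy: "vs2.independent (y ` S)"
    unfolding vs2.independent_explicit_module
  proof (intro allI impI)
    fix T g b assume T: "finite T" "T \<subseteq> y ` S" "(\<Sum>b\<in>T. s2 (g b) b) = 0" "b \<in> T"
    have "(\<Sum>I\<in>S. s2 (if y I \<in> T then g (y I) else 0) (y I)) = (\<Sum>b\<in>y ` S. s2 (if b \<in> T then g b else 0) b)"
      by (subst sum.reindex[OF injy]) auto
    also have "\<dots> = (\<Sum>b\<in>T. s2 (g b) b)"
      by (rule sum.mono_neutral_cong_right) (use T finS in auto)
    finally have "(\<Sum>I\<in>S. s2 (if y I \<in> T then g (y I) else 0) (y I)) = 0" using T by simp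
    then show "g b = 0" using ind2[of "\<lambda>I. if y I \<in> T then g (y I) else 0"] T by (metis (no_types, lifting) imageE subsetD)
  qed
  have spany: "y I \<in> vs2.span (y ` S)" if I: "I \<in> W" for I
  proof (cases "I \<in> S")
    case True
    then show ?thesis by (simp add: vs2.span_base)
  next
    case False
    have "x I \<in> vs1.span (x ` S)" using B(3) S(3) I by auto
    then obtain g where g: "x I = (\<Sum>b\<in>x ` S. s1 (g b) b)"
      unfolding vs1.span_finite[OF finite_imageI[OF finS]] by auto
    then have g': "x I = (\<Sum>k\<in>S. s1 (g (x k)) (x k))" by (simp add: sum.reindex[OF S(2)])
    define c where "c k = (if k = I then - 1 else g (x k))" for k
    have "(\<Sum>k\<in>insert I S. s1 (c k) (x k)) = - x I + (\<Sum>k\<in>S. s1 (g (x k)) (x k))"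
      using False finS by (simp add: c_def) (rule sum.cong, auto)
    then have "(\<Sum>k\<in>insert I S. s1 (c k) (x k)) = 0" using g' by simp
    then have "(\<Sum>k\<in>insert I S. s2 (c k) (y k)) = 0" using relU[of "insert I S" c] S(1) I by auto
    moreover have "(\<Sum>k\<in>insert I S. s2 (c k) (y k)) = - y I + (\<Sum>k\<in>S. s2 (g (x k)) (y k))"
      using False finS by (simp add: c_def) (rule sum.cong, auto)
    ultimately have "y I = (\<Sum>k\<in>S. s2 (g (x k)) (y k))" by simp
    moreover have "(\<Sum>k\<in>S. s2 (g (x k)) (y k)) \<in> vs2.span (y ` S)"
      by (intro vs2.span_sum vs2.span_scale vs2.span_base) simp
    ultimately show ?thesis by simp
  qed
  have "vs2.span (y ` W) = vs2.span (y ` S)"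
    using spany S(1) by (intro antisym vs2.span_minimal vs2.span_mono) auto
  then have "vs2.dim (vs2.span (y ` W)) = card S"
    using vs2.dim_span_eq_card_independent[OF indy] card_image[OF injy] by simp
  moreover have "vs1.span (x ` W) = vs1.span (x ` S)"
    using B(3) S by (intro antisym vs1.span_minimal vs1.span_mono) auto
  then have "vs1.dim (vs1.span (x ` W)) = card S"
    using vs1.dim_span_eq_card_independent[of "x ` S"] B(2) S card_image[OF S(2)] by simp
  ultimately show ?thesis by simp
qed

section \<open>Irreducible highest weight modules\<close>

text \<open>Fixes one of the highest weight vectors that the module is only asserted to
  possess.\<close>

locale hw_module = irreducible_highest_weight_module scaleh N A \<alpha> coroot scaleg brk \<iota> e f scalev act \<Lambda>
  for scaleh :: "complex \<Rightarrow> 'h::ab_group_add \<Rightarrow> 'h"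
    and N :: nat
    and A :: "nat \<Rightarrow> nat \<Rightarrow> int"
    and \<alpha> :: "nat \<Rightarrow> 'h \<Rightarrow> complex"
    and coroot :: "nat \<Rightarrow> 'h"
    and scaleg :: "complex \<Rightarrow> 'g::ab_group_add \<Rightarrow> 'g"
    and brk :: "'g \<Rightarrow> 'g \<Rightarrow> 'g"
    and \<iota> :: "'h \<Rightarrow> 'g"
    and e f :: "nat \<Rightarrow> 'g"
    and scalev :: "complex \<Rightarrow> 'v::ab_group_add \<Rightarrow> 'v"
    and act :: "'g \<Rightarrow> 'v \<Rightarrow> 'v"
    and \<Lambda> :: "'h \<Rightarrow> complex" +
  fixes v0 :: 'v
  assumes v0_nz: "v0 \<noteq> 0" and v0_e: "j < N \<Longrightarrow> act (e j) v0 = 0"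
    and v0_wt: "act (\<iota> h) v0 = scalev (\<Lambda> h) v0"
    and v0_gen: "submodule W \<Longrightarrow> v0 \<in> W \<Longrightarrow> W = UNIV"
begin

abbreviation wsp :: "('h \<Rightarrow> complex) \<Rightarrow> 'v set" where
  "wsp \<mu> \<equiv> weight_space scalev act \<iota> \<mu>"

lemma linear_act: "Vector_Spaces.linear scalev scalev (act x)"
  by unfold_locales (auto simp: act_add_right act_scale_right)

sublocale vpair: vector_space_pair scalev scalev ..

lemma act_zero_right: "act x 0 = 0" by (rule vpair.linear_0[OF linear_act])

lemma act_minus_left: "act (- x) w = - act x w"
  using act_scale_left[of "-1" x w] by simp

lemma act_zero_left: "act 0 w = 0"
  using act_add_left[of 0 0 w] by simp

lemma act_ef: "j < N \<Longrightarrow> k < N \<Longrightarrow> act (e j) (act (f k) w) = act (f k) (act (e j) w) + (if j = k then act (\<iota> (coroot j)) w else 0)"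
  using act_brk[of "e j" "f k" w] by (auto simp: rel_ef act_zero_left algebra_simps)

lemma act_hf: "k < N \<Longrightarrow> act (\<iota> h) (act (f k) w) = act (f k) (act (\<iota> h) w) - scalev (\<alpha> k h) (act (f k) w)"
  using act_brk[of "\<iota> h" "f k" w] by (simp add: rel_hf act_minus_left act_scale_left algebra_simps)

lemma act_he: "k < N \<Longrightarrow> act (\<iota> h) (act (e k) w) = act (e k) (act (\<iota> h) w) + scalev (\<alpha> k h) (act (e k) w)"
  using act_brk[of "\<iota> h" "e k" w] by (simp add: rel_he act_scale_left algebra_simps)

lemma wsp_f: "w \<in> wsp \<mu> \<Longrightarrow> k < N \<Longrightarrow> act (f k) w \<in> wsp (\<lambda>h. \<mu> h - \<alpha> k h)"
  by (simp add: weight_space_def act_hf act_scale_right V.scale_left_diff_distrib)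

lemma wsp_e: "w \<in> wsp \<mu> \<Longrightarrow> k < N \<Longrightarrow> act (e k) w \<in> wsp (\<lambda>h. \<mu> h + \<alpha> k h)"
  by (simp add: weight_space_def act_he act_scale_right V.scale_left_distrib)

lemma subspace_wsp: "V.subspace (wsp \<mu>)"
  by (auto simp: V.subspace_def weight_space_def act_zero_right act_add_right act_scale_right V.scale_right_distrib mult.commute)

definition rootsum :: "nat list \<Rightarrow> 'h \<Rightarrow> complex" where
  "rootsum I h = (\<Sum>k\<leftarrow>I. \<alpha> k h)"

abbreviation FW :: "nat list \<Rightarrow> 'v \<Rightarrow> 'v" where "FW I \<equiv> foldr (\<lambda>k. act (f k)) I"

lemma wsp_FW: "w \<in> wsp \<mu> \<Longrightarrow> set I \<subseteq> {..<N} \<Longrightarrow> FW I w \<in> wsp (\<lambda>h. \<mu> h - rootsum I h)"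
proof (induction I)
  case (Cons k I)
  then show ?case using wsp_f[of "FW I w" "\<lambda>h. \<mu> h - rootsum I h" k] by (simp add: rootsum_def algebra_simps)
qed (simp add: rootsum_def)

lemma v0_wsp: "v0 \<in> wsp \<Lambda>"
  by (simp add: weight_space_def v0_wt)

text \<open>The elements of the algebra that preserve W form a subalgebra, so invariance has to be
  checked on the generators only.\<close>

lemma generated_submodule:
  assumes W: "V.subspace W" "\<And>h w. w \<in> W \<Longrightarrow> act (\<iota> h) w \<in> W"
    "\<And>j w. j < N \<Longrightarrow> w \<in> W \<Longrightarrow> act (e j) w \<in> W" "\<And>j w. j < N \<Longrightarrow> w \<in> W \<Longrightarrow> act (f j) w \<in> W"
  shows "submodule W"
proof -
  define S where "S = {x. \<forall>w\<in>W. act x w \<in> W}"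
  have "lie_subalgebra S"
    unfolding lie_subalgebra_def subspace_def S_def
    using W(1) by (auto simp: act_zero_left act_add_left act_scale_left act_brk V.subspace_0 V.subspace_add V.subspace_scale V.subspace_diff)
  then have "S = UNIV" by (rule generated) (use W in \<open>auto simp: S_def\<close>)
  then show ?thesis using W(1) by (auto simp: submodule_def S_def)
qed

sublocale hw: hw_words scalev N A "\<lambda>j. \<Lambda> (coroot j)" "\<lambda>j. act (e j)" "\<lambda>j. act (f j)" "\<lambda>j. act (\<iota> (coroot j))" v0
proof unfold_locales
  fix I j k assume "set I \<subseteq> {..<N}" and jk: "j < N" "k < N"
  show "act (e j) (act (f k) (FW I v0)) = act (f k) (act (e j) (FW I v0)) + (if j = k then act (\<iota> (coroot j)) (FW I v0) else 0)"
    by (rule act_ef[OF jk])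
  show "act (\<iota> (coroot j)) (act (f k) (FW I v0)) = act (f k) (act (\<iota> (coroot j)) (FW I v0)) - scalev (of_int (A j k)) (act (f k) (FW I v0))"
    by (simp add: act_hf[OF jk(2)] H.pairing[OF jk])
qed (auto simp: act_add_right act_scale_right v0_e v0_wt)

lemma span_words: "V.span {FW I v0 |I. set I \<subseteq> {..<N}} = UNIV"
proof (rule v0_gen)
  let ?B = "{FW I v0 |I. set I \<subseteq> {..<N}}"
  have closed: "act x w \<in> V.span ?B" if "\<And>I. set I \<subseteq> {..<N} \<Longrightarrow> act x (FW I v0) \<in> V.span ?B" "w \<in> V.span ?B" for x w
  proof -
    have "act x ` V.span ?B \<subseteq> V.span ?B"
      unfolding vpair.linear_span_image[OF linear_act, symmetric]
      by (rule V.span_minimal) (use that(1) in auto)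
    then show ?thesis using that(2) by blast
  qed
  show "submodule (V.span ?B)"
  proof (rule generated_submodule)
    fix h w assume w: "w \<in> V.span ?B"
    show "act (\<iota> h) w \<in> V.span ?B"
    proof (rule closed[OF _ w])
      fix I assume I: "set I \<subseteq> {..<N}"
      then have "act (\<iota> h) (FW I v0) = scalev (\<Lambda> h - rootsum I h) (FW I v0)"
        using wsp_FW[OF v0_wsp I] by (simp add: weight_space_def)
      then show "act (\<iota> h) (FW I v0) \<in> V.span ?B" using V.span_scale[OF V.span_base[of "FW I v0" ?B]] I by auto
    qed
  next
    fix j w assume j: "j < N" and w: "w \<in> V.span ?B"
    show "act (e j) w \<in> V.span ?B"
    proof (rule closed[OF _ w])
      fix I assume I: "set I \<subseteq> {..<N}"
      show "act (e j) (FW I v0) \<in> V.span ?B"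
      proof (cases I)
        case Nil
        then show ?thesis by (simp add: v0_e[OF j] V.span_zero)
      next
        case (Cons k K)
        have "hw.EW [j] (FW I v0) \<in> V.span {FW I' v0 |I'. length I' = length I - length [j] \<and> set I' \<subseteq> {..<N}}"
          by (rule hw.EW_span) (use I j Cons in auto)
        moreover have "V.span {FW I' v0 |I'. length I' = length I - length [j] \<and> set I' \<subseteq> {..<N}} \<subseteq> V.span ?B"
          by (rule V.span_mono) auto
        ultimately show ?thesis by (auto simp: hw.EW_def)
      qed
    qed
    show "act (f j) w \<in> V.span ?B"
    proof (rule closed[OF _ w])
      fix I assume I: "set I \<subseteq> {..<N}"
      have "act (f j) (FW I v0) = FW (j # I) v0" by simp
      then show "act (f j) (FW I v0) \<in> V.span ?B" using I j by (metis (mono_tags, lifting) V.span_base insert_subset lessThan_iff list.simps(15) mem_Collect_eq)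
    qed
  qed auto
  have "v0 = FW [] v0" by simp
  then show "v0 \<in> V.span ?B" by (metis (mono_tags, lifting) V.span_base empty_set empty_subsetI mem_Collect_eq)
qed

lemma weight_independent:
  "finite T \<Longrightarrow> (\<And>\<mu>. \<mu> \<in> T \<Longrightarrow> x \<mu> \<in> wsp \<mu>) \<Longrightarrow> (\<Sum>\<mu>\<in>T. x \<mu>) = 0 \<Longrightarrow> \<mu> \<in> T \<Longrightarrow> x \<mu> = 0"
proof (induction T arbitrary: x \<mu> rule: finite_induct)
  case (insert \<nu> T)
  have zero: "x \<mu> = 0" if \<mu>: "\<mu> \<in> T" for \<mu>
  proof -
    have "\<mu> \<noteq> \<nu>" using \<mu> insert.hyps by auto
    then obtain h where h: "\<mu> h \<noteq> \<nu> h" by (auto simp: fun_eq_iff)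
    \<comment> \<open>The action of h minus its eigenvalue at \<nu> removes the \<nu> component and
      rescales the others, by a nonzero factor at \<mu>.\<close>
    define y where "y \<rho> = scalev (\<rho> h - \<nu> h) (x \<rho>)" for \<rho>
    have act_x: "act (\<iota> h) (x \<rho>) = scalev (\<rho> h) (x \<rho>)" if "\<rho> \<in> insert \<nu> T" for \<rho>
      using insert.prems(1)[OF that] by (simp add: weight_space_def)
    have "act (\<iota> h) (\<Sum>\<rho>\<in>insert \<nu> T. x \<rho>) - scalev (\<nu> h) (\<Sum>\<rho>\<in>insert \<nu> T. x \<rho>) = (\<Sum>\<rho>\<in>insert \<nu> T. y \<rho>)"
      unfolding vpair.linear_sum[OF linear_act] V.scale_sum_right sum_subtractf[symmetric]
      by (rule sum.cong) (auto simp: act_x y_def V.scale_left_diff_distrib)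
    moreover have "y \<nu> = 0" by (simp add: y_def)
    ultimately have "(\<Sum>\<rho>\<in>T. y \<rho>) = 0"
      using insert.prems(2) insert.hyps by (simp add: act_zero_right)
    moreover have "y \<rho> \<in> wsp \<rho>" if "\<rho> \<in> T" for \<rho>
      unfolding y_def using insert.prems(1) that by (intro V.subspace_scale[OF subspace_wsp]) auto
    ultimately have "y \<mu> = 0" using insert.IH[of y \<mu>] \<mu> by blast
    then show ?thesis using h by (simp add: y_def)
  qed
  then have "(\<Sum>\<mu>\<in>T. x \<mu>) = 0" by (simp add: sum.neutral)
  then have "x \<nu> = 0" using insert.prems(2) insert.hyps by simp
  then show ?case using zero insert.prems(3) by auto
qed simp

lemma weight_extract:
  assumes g: "\<And>I. I \<in> D \<Longrightarrow> g I \<in> wsp (w I)" and x: "x \<in> V.span (g ` D)" "x \<in> wsp \<mu>"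
  shows "x \<in> V.span (g ` {I \<in> D. w I = \<mu>})"
proof -
  obtain t r where t: "finite t" "t \<subseteq> g ` D" "x = (\<Sum>b\<in>t. scalev (r b) b)"
    using x(1) unfolding V.span_explicit by blast
  obtain U where U: "U \<subseteq> D" "inj_on g U" "t = g ` U" using t(2) unfolding subset_image_inj by blast
  have finU: "finite U" using t(1) U finite_imageD by blast
  have xU: "x = (\<Sum>I\<in>U. scalev (r (g I)) (g I))" using t(3) U by (simp add: sum.reindex)
  define T where "T = insert \<mu> (w ` U)"
  \<comment> \<open>The difference of the \<nu> components in the two expressions for x. These
    differences add up to zero, so independence of weights makes each of them vanish.\<close>
  define y where "y \<nu> = (\<Sum>I | I \<in> U \<and> w I = \<nu>. scalev (r (g I)) (g I)) - (if \<nu> = \<mu> then x else 0)" for \<nu>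
  have finT: "finite T" using finU by (simp add: T_def)
  have yw: "y \<nu> \<in> wsp \<nu>" for \<nu>
    unfolding y_def using g U(1) x(2)
    by (intro V.subspace_diff[OF subspace_wsp] V.subspace_sum[OF subspace_wsp] V.subspace_scale[OF subspace_wsp])
      (auto simp: V.subspace_0[OF subspace_wsp])
  have "(\<Sum>\<nu>\<in>T. y \<nu>) = (\<Sum>\<nu>\<in>T. \<Sum>I | I \<in> U \<and> w I = \<nu>. scalev (r (g I)) (g I)) - x"
    unfolding y_def using finT by (simp add: sum_subtractf T_def)
  also have "(\<Sum>\<nu>\<in>T. \<Sum>I | I \<in> U \<and> w I = \<nu>. scalev (r (g I)) (g I)) = x"
    unfolding xU by (rule sum.group[OF finU finT]) (auto simp: T_def)
  finally have "(\<Sum>\<nu>\<in>T. y \<nu>) = 0" by simp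
  then have "y \<mu> = 0" using weight_independent[of T y \<mu>] finT yw by (simp add: T_def)
  then have "x = (\<Sum>I | I \<in> U \<and> w I = \<mu>. scalev (r (g I)) (g I))" by (simp add: y_def)
  also have "\<dots> \<in> V.span (g ` {I \<in> D. w I = \<mu>})"
    using U(1) by (intro V.span_sum V.span_scale V.span_base) auto
  finally show ?thesis .
qed

lemma rootsum_count:
  assumes "set I \<subseteq> {..<N}"
  shows "rootsum I h = (\<Sum>j<N. of_nat (count_list I j) * \<alpha> j h)"
  using assms
proof (induction I)
  case (Cons k I)
  have "(\<Sum>j<N. of_nat (count_list (k # I) j) * \<alpha> j h) = (\<Sum>j<N. (if j = k then \<alpha> k h else 0) + of_nat (count_list I j) * \<alpha> j h)"
    by (rule sum.cong) (auto simp: algebra_simps)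
  also have "\<dots> = \<alpha> k h + (\<Sum>j<N. of_nat (count_list I j) * \<alpha> j h)"
    using Cons.prems by (simp add: sum.distrib)
  finally show ?case using Cons by (simp add: rootsum_def)
qed (simp add: rootsum_def)

text \<open>The simple roots are independent, so a weight fixes how often each letter occurs.
  Consequently the words of a given weight are finitely many and of equal length.\<close>

lemma rootsum_inj:
  assumes "set I \<subseteq> {..<N}" "set I' \<subseteq> {..<N}" "rootsum I = rootsum I'"
  shows "mset I = mset I'"
proof (rule multiset_eqI)
  fix j :: nat
  have cnt: "count (mset K) j = count_list K j" for K by (induction K) auto
  show "count (mset I) j = count (mset I') j"
  proof (cases "j < N")
    case True
    have "(\<Sum>j<N. (of_nat (count_list I j) - of_nat (count_list I' j)) * \<alpha> j h) = 0" for h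
      using assms(3) rootsum_count[OF assms(1), of h] rootsum_count[OF assms(2), of h]
      by (simp add: left_diff_distrib sum_subtractf)
    then have "of_nat (count_list I j) - of_nat (count_list I' j) = (0 :: complex)"
      using H.roots_independent[of "\<lambda>j. of_nat (count_list I j) - of_nat (count_list I' j)" j] True by blast
    then show ?thesis by (simp add: cnt)
  next
    case False
    then have "count_list I j = 0" "count_list I' j = 0" using assms by (auto simp: count_list_0_iff)
    then show ?thesis by (simp add: cnt)
  qed
qed

lemma wsp_words: "wsp \<mu> = V.span ((\<lambda>I. FW I v0) ` {I. set I \<subseteq> {..<N} \<and> (\<lambda>h. \<Lambda> h - rootsum I h) = \<mu>})"
proof
  let ?D = "{I. set I \<subseteq> {..<N}}"
  have UN: "V.span ((\<lambda>I. FW I v0) ` ?D) = UNIV"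
    using span_words by (simp add: setcompr_eq_image)
  show "wsp \<mu> \<subseteq> V.span ((\<lambda>I. FW I v0) ` {I. set I \<subseteq> {..<N} \<and> (\<lambda>h. \<Lambda> h - rootsum I h) = \<mu>})"
    using weight_extract[of ?D "\<lambda>I. FW I v0" "\<lambda>I h. \<Lambda> h - rootsum I h" _ \<mu>] wsp_FW[OF v0_wsp] UN by auto
  show "V.span ((\<lambda>I. FW I v0) ` {I. set I \<subseteq> {..<N} \<and> (\<lambda>h. \<Lambda> h - rootsum I h) = \<mu>}) \<subseteq> wsp \<mu>"
    using wsp_FW[OF v0_wsp] by (intro V.span_minimal subspace_wsp) auto
qed

lemma v0_not_lower: "v0 \<notin> V.span ((\<lambda>I. FW I v0) ` {I. set I \<subseteq> {..<N} \<and> I \<noteq> []})"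
proof
  let ?D = "{I. set I \<subseteq> {..<N} \<and> I \<noteq> []}"
  assume "v0 \<in> V.span ((\<lambda>I. FW I v0) ` ?D)"
  then have "v0 \<in> V.span ((\<lambda>I. FW I v0) ` {I \<in> ?D. (\<lambda>h. \<Lambda> h - rootsum I h) = \<Lambda>})"
    using weight_extract[of ?D "\<lambda>I. FW I v0" "\<lambda>I h. \<Lambda> h - rootsum I h" v0 \<Lambda>] wsp_FW[OF v0_wsp] v0_wsp by auto
  moreover have "{I \<in> ?D. (\<lambda>h. \<Lambda> h - rootsum I h) = \<Lambda>} = {}"
  proof (intro equals0I)
    fix I assume I: "I \<in> {I \<in> ?D. (\<lambda>h. \<Lambda> h - rootsum I h) = \<Lambda>}"
    then have "rootsum I = rootsum []" by (auto simp: fun_eq_iff rootsum_def)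
    then have "mset I = mset []" using I by (intro rootsum_inj) auto
    then show False using I by simp
  qed
  ultimately have "v0 \<in> V.span {}" by (simp only: image_empty)
  then show False using v0_nz by simp
qed

lemma EW_append: "hw.EW (J @ [j]) x = act (e j) (hw.EW J x)"
  by (simp add: hw.EW_def)

lemma wsp_EW: "w \<in> wsp \<mu> \<Longrightarrow> set J \<subseteq> {..<N} \<Longrightarrow> hw.EW J w \<in> wsp (\<lambda>h. \<mu> h + rootsum J h)"
proof (induction J arbitrary: w \<mu>)
  case (Cons j J)
  have "hw.EW J (act (e j) w) \<in> wsp (\<lambda>h. (\<lambda>h. \<mu> h + \<alpha> j h) h + rootsum J h)"
    using Cons by (intro Cons.IH wsp_e) auto
  then show ?case by (simp add: hw.EW_def rootsum_def add.assoc)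
qed (simp add: hw.EW_def rootsum_def)

text \<open>The submodule generated by x stays inside the span of the nonempty words, which misses
  the highest weight vector. It is therefore proper, and irreducibility makes it zero.\<close>

lemma module_nondegenerate:
  assumes W: "\<And>I. I \<in> W \<Longrightarrow> set I \<subseteq> {..<N} \<and> length I = m \<and> rootsum I = \<beta>"
    and x: "x = (\<Sum>I\<in>W. scalev (c I) (FW I v0))"
    and ann: "\<And>J. set J \<subseteq> {..<N} \<Longrightarrow> length J = m \<Longrightarrow> hw.EW J x = 0"
  shows "x = 0"
proof -
  let ?S = "{FW K (hw.EW J x) |K J. set K \<subseteq> {..<N} \<and> set J \<subseteq> {..<N}}"
  have xw: "x \<in> wsp (\<lambda>h. \<Lambda> h - \<beta> h)"
    unfolding x using W wsp_FW[OF v0_wsp] by (intro V.subspace_sum[OF subspace_wsp] V.subspace_scale[OF subspace_wsp]) force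
  have yw: "\<exists>\<mu>. FW K (hw.EW J x) \<in> wsp \<mu>" if "set K \<subseteq> {..<N}" "set J \<subseteq> {..<N}" for K J
    using wsp_FW[OF wsp_EW[OF xw that(2)] that(1)] by blast
  have base: "FW K (hw.EW J x) \<in> V.span ?S" if "set K \<subseteq> {..<N}" "set J \<subseteq> {..<N}" for K J
    using that by (intro V.span_base) blast
  have closed: "act z w \<in> V.span ?S"
    if "\<And>K J. set K \<subseteq> {..<N} \<Longrightarrow> set J \<subseteq> {..<N} \<Longrightarrow> act z (FW K (hw.EW J x)) \<in> V.span ?S" "w \<in> V.span ?S" for z w
  proof -
    have "act z ` V.span ?S \<subseteq> V.span ?S"
      unfolding vpair.linear_span_image[OF linear_act, symmetric]
      by (rule V.span_minimal) (use that(1) in auto)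
    then show ?thesis using that(2) by blast
  qed
  have h_base: "act (\<iota> h) (FW K (hw.EW J x)) \<in> V.span ?S" if KJ: "set K \<subseteq> {..<N}" "set J \<subseteq> {..<N}" for h K J
  proof -
    obtain \<mu> where "FW K (hw.EW J x) \<in> wsp \<mu>" using yw[OF KJ] by blast
    then have "act (\<iota> h) (FW K (hw.EW J x)) = scalev (\<mu> h) (FW K (hw.EW J x))" by (simp add: weight_space_def)
    then show ?thesis using V.span_scale[OF base[OF KJ]] by simp
  qed
  have f_closed: "act (f k) w \<in> V.span ?S" if "k < N" "w \<in> V.span ?S" for k w
  proof (rule closed[OF _ that(2)])
    fix K J assume KJ: "set K \<subseteq> {..<N}" "set J \<subseteq> {..<N}"
    have "act (f k) (FW K (hw.EW J x)) = FW (k # K) (hw.EW J x)" by simp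
    also have "\<dots> \<in> V.span ?S" using KJ that(1) by (intro base) auto
    finally show "act (f k) (FW K (hw.EW J x)) \<in> V.span ?S" .
  qed
  have e_base: "act (e j) (FW K (hw.EW J x)) \<in> V.span ?S" if "j < N" "set K \<subseteq> {..<N}" "set J \<subseteq> {..<N}" for j K J
    using that
  proof (induction K)
    case Nil
    then show ?case using base[of "[]" "J @ [j]"] by (simp add: EW_append)
  next
    case (Cons k K)
    then have k: "k < N" "set K \<subseteq> {..<N}" by auto
    have "act (f k) (act (e j) (FW K (hw.EW J x))) \<in> V.span ?S" using Cons k f_closed by auto
    moreover have "act (\<iota> (coroot j)) (FW K (hw.EW J x)) \<in> V.span ?S" using h_base k Cons.prems by blast
    ultimately show ?case using act_ef[OF Cons.prems(1) k(1)] by (auto intro: V.span_add V.span_zero)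
  qed
  have sub: "submodule (V.span ?S)"
    by (rule generated_submodule) (auto intro: closed h_base e_base f_closed)
  let ?M = "V.span ((\<lambda>I. FW I v0) ` {I. set I \<subseteq> {..<N} \<and> I \<noteq> []})"
  have "?S \<subseteq> ?M"
  proof clarify
    fix K J assume KJ: "set K \<subseteq> {..<N}" "set J \<subseteq> {..<N}"
    have FWlin: "Vector_Spaces.linear scalev scalev (FW K)"
    proof (induction K)
      case Nil
      show ?case by unfold_locales auto
    next
      case (Cons k K)
      have "FW (k # K) = act (f k) \<circ> FW K" by auto
      moreover have "Vector_Spaces.linear scalev scalev (act (f k) \<circ> FW K)"
        by (intro Vector_Spaces.linear_compose[of scalev scalev _ scalev] Cons linear_act)
      ultimately show ?case by (simp only:)
    qed
    \<comment> \<open>Fewer than m raising operators leave nonempty words; with m or more, the first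
      m already give zero.\<close>
    show "FW K (hw.EW J x) \<in> ?M"
    proof (cases "length J < m")
      case True
      have "hw.EW J x \<in> V.span {FW I' v0 |I'. length I' = m - length J \<and> set I' \<subseteq> {..<N}}"
      proof -
        have "hw.EW J x = (\<Sum>I\<in>W. scalev (c I) (hw.EW J (FW I v0)))"
          unfolding x by (simp add: vpair.linear_sum[OF hw.linear_EW[OF KJ(2)]] vpair.linear_scale[OF hw.linear_EW[OF KJ(2)]])
        also have "\<dots> \<in> V.span {FW I' v0 |I'. length I' = m - length J \<and> set I' \<subseteq> {..<N}}"
        proof (intro V.span_sum V.span_scale)
          fix I assume "I \<in> W"
          then have "set I \<subseteq> {..<N}" "length I = m" using W by auto
          then show "hw.EW J (FW I v0) \<in> V.span {FW I' v0 |I'. length I' = m - length J \<and> set I' \<subseteq> {..<N}}"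
            using hw.EW_span[of I J] KJ True by auto
        qed
        finally show ?thesis .
      qed
      then have "FW K (hw.EW J x) \<in> V.span (FW K ` {FW I' v0 |I'. length I' = m - length J \<and> set I' \<subseteq> {..<N}})"
        unfolding vpair.linear_span_image[OF FWlin] by blast
      also have "\<dots> \<subseteq> ?M"
      proof (rule V.span_mono, clarify)
        fix I' assume I': "length I' = m - length J" "set I' \<subseteq> {..<N}"
        then have "FW K (FW I' v0) = FW (K @ I') v0" "K @ I' \<noteq> []" "set (K @ I') \<subseteq> {..<N}" using KJ True by auto
        then show "FW K (FW I' v0) \<in> (\<lambda>I. FW I v0) ` {I. set I \<subseteq> {..<N} \<and> I \<noteq> []}" by blast
      qed
      finally show ?thesis .
    next
      case False
      have "hw.EW J x = hw.EW (drop m J) (hw.EW (take m J) x)"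
        unfolding hw.EW_def by (metis append_take_drop_id comp_apply fold_append)
      also have "hw.EW (take m J) x = 0" using KJ False by (intro ann) (auto dest: in_set_takeD)
      also have "hw.EW (drop m J) 0 = 0" using KJ by (intro vpair.linear_0 hw.linear_EW) (auto dest: in_set_dropD)
      finally show ?thesis by (simp add: vpair.linear_0[OF FWlin] V.span_zero)
    qed
  qed
  then have "V.span ?S \<subseteq> ?M" by (rule V.span_minimal) simp
  then have "V.span ?S \<noteq> UNIV" using v0_not_lower by blast
  then have "V.span ?S = {0}" using irreducible sub by (auto simp: irreducible_module_def)
  moreover have "x \<in> V.span ?S" using base[of "[]" "[]"] by (simp add: hw.EW_def)
  ultimately show ?thesis by simp
qed

end

section \<open>Secondary-coloured integers as intervals\<close>

definition pos :: "nat \<Rightarrow> primary \<Rightarrow> int" where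
  "pos n a = 2 * int n * fst a + int (snd a)"

definition enc :: "nat \<Rightarrow> secondary \<Rightarrow> int \<times> int" where
  "enc n e = (pos n (zeta e), pos n (eta e))"

abbreviation primaries :: "nat \<Rightarrow> primary set" where
  "primaries n \<equiv> {a. snd a \<in> letters n}"

lemma mult_window:
  fixes M :: int
  assumes "M * k + x = M * k' + x'" "\<bar>x - x'\<bar> < M"
  shows "k = k' \<and> x = x'"
proof -
  have "M * (k' - k) = x - x'" using assms(1) by (simp add: algebra_simps)
  then have "\<bar>M\<bar> * \<bar>k' - k\<bar> < M" using assms(2) by (simp flip: abs_mult)
  have "k' - k = 0"
  proof (rule ccontr)
    assume "k' - k \<noteq> 0"
    then have "\<bar>M\<bar> * 1 \<le> \<bar>M\<bar> * \<bar>k' - k\<bar>" by (intro mult_left_mono) auto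
    then show False using \<open>\<bar>M\<bar> * \<bar>k' - k\<bar> < M\<close> by linarith
  qed
  then show ?thesis using assms(1) by simp
qed

lemma pos_inj: "a \<in> primaries n \<Longrightarrow> a' \<in> primaries n \<Longrightarrow> pos n a = pos n a' \<Longrightarrow> a = a'"
  using mult_window[of "2 * int n" "fst a" "int (snd a)" "fst a'" "int (snd a')"]
  by (auto simp: pos_def letters_def prod_eq_iff)

lemma pos_surj:
  assumes "n \<ge> 1"
  obtains a where "a \<in> primaries n" "pos n a = p"
proof -
  let ?M = "2 * int n"
  define a where "a = ((p - 1) div ?M, nat ((p - 1) mod ?M + 1))"
  have m: "0 \<le> (p - 1) mod ?M" "(p - 1) mod ?M < ?M" using assms by auto
  then have "a \<in> primaries n" by (auto simp: a_def letters_def)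
  moreover have "pos n a = p" using m mult_div_mod_eq[of ?M "p - 1"] by (simp add: a_def pos_def)
  ultimately show ?thesis using that by blast
qed

lemma zeta_eta_primaries: "e \<in> secondary_ints n \<Longrightarrow> zeta e \<in> primaries n \<and> eta e \<in> primaries n"
  by (auto simp: zeta_def eta_def secondary_ints_def)

text \<open>The parity cases of \<open>eta\<close> and \<open>zeta\<close> disappear in the sum of
  the ends, which therefore decides membership in \<open>Omega\<close> and in the positive
  part.\<close>

lemma enc_sum: "fst (enc n (k, x, y)) + snd (enc n (k, x, y)) = 2 * int n * k + int x + int y"
proof (cases "even k")
  case True
  then show ?thesis by (auto simp: enc_def pos_def zeta_def eta_def elim!: evenE)
next
  case False
  then show ?thesis by (auto simp: enc_def pos_def zeta_def eta_def algebra_simps elim!: oddE)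
qed

lemma enc_interval: "e \<in> secondary_ints n \<Longrightarrow> fst (enc n e) \<le> snd (enc n e) \<and> snd (enc n e) \<le> fst (enc n e) + 2 * int n"
proof -
  assume e: "e \<in> secondary_ints n"
  obtain k x y where k: "e = (k, x, y)" by (cases e)
  show ?thesis
  proof (cases "even k")
    case True
    then show ?thesis using e k by (auto simp: enc_def pos_def zeta_def eta_def secondary_ints_def letters_def)
  next
    case False
    then show ?thesis using e k by (auto simp: enc_def pos_def zeta_def eta_def secondary_ints_def letters_def algebra_simps)
  qed
qed

lemma zeta_eta_inj: "zeta e = zeta e' \<Longrightarrow> eta e = eta e' \<Longrightarrow> e = e'"
proof -
  assume ze: "zeta e = zeta e'" "eta e = eta e'"
  obtain k x y where k: "e = (k, x, y)" by (cases e)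
  obtain k' x' y' where k': "e' = (k', x', y')" by (cases e')
  show ?thesis
    using ze unfolding k k' by (cases "even k"; cases "even k'") (auto simp: zeta_def eta_def elim!: evenE oddE)
qed

lemma enc_eqD:
  assumes "e \<in> secondary_ints n" "a \<in> primaries n" "b \<in> primaries n" "enc n e = (pos n a, pos n b)"
  shows "zeta e = a" "eta e = b"
proof -
  have "pos n (zeta e) = pos n a" "pos n (eta e) = pos n b" using assms(4) by (auto simp: enc_def)
  then show "zeta e = a" "eta e = b" using zeta_eta_primaries[OF assms(1)] assms(2,3) pos_inj by blast+
qed

lemma enc_inj: "inj_on (enc n) (secondary_ints n)"
proof (rule inj_onI)
  fix e e' assume e: "e \<in> secondary_ints n" "e' \<in> secondary_ints n" "enc n e = enc n e'"
  have "zeta e = zeta e'" "eta e = eta e'"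
    using enc_eqD[OF e(1), of "zeta e'" "eta e'"] zeta_eta_primaries[OF e(2)] e(3) by (simp_all add: enc_def)
  then show "e = e'" by (rule zeta_eta_inj)
qed

lemma enc_surj:
  assumes n: "n \<ge> 1" and ba: "b \<le> a" "a \<le> b + 2 * int n"
  obtains e where "e \<in> secondary_ints n" "enc n e = (b, a)"
proof -
  obtain p where p: "p \<in> primaries n" "pos n p = b" using pos_surj[OF n] by blast
  obtain r where r: "r \<in> primaries n" "pos n r = a" using pos_surj[OF n] by blast
  obtain k1 u1 where p': "p = (k1, u1)" by force
  obtain k2 u2 where r': "r = (k2, u2)" by force
  have u: "1 \<le> u1" "u1 \<le> 2 * n" "1 \<le> u2" "u2 \<le> 2 * n" using p r p' r' by (auto simp: letters_def)
  have b: "b = 2 * int n * k1 + int u1" and a: "a = 2 * int n * k2 + int u2" using p r p' r' by (auto simp: pos_def)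
  \<comment> \<open>The two ends lie in the same period or in consecutive ones; these are the even
    and the odd case of the decomposition.\<close>
  have k: "k2 = k1 \<or> k2 = k1 + 1"
  proof -
    have "2 * int n * (k2 - k1) > 2 * int n * (-1)" using ba u unfolding a b by (simp add: algebra_simps)
    moreover have "2 * int n * (k2 - k1) < 2 * int n * 2" using ba u unfolding a b by (simp add: algebra_simps)
    moreover have "2 * int n > 0" using n by simp
    ultimately have "-1 < k2 - k1" "k2 - k1 < 2" by (metis mult_less_cancel_left_pos)+
    then show ?thesis by linarith
  qed
  show ?thesis
  proof (cases "k2 = k1")
    case True
    then have "u1 \<le> u2" using ba a b by simp
    then have "(2 * k1, u1, u2) \<in> secondary_ints n" "enc n (2 * k1, u1, u2) = (b, a)"
      using True u a b by (auto simp: secondary_ints_def letters_def enc_def pos_def zeta_def eta_def)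
    then show ?thesis using that by blast
  next
    case False
    then have k2: "k2 = k1 + 1" using k by simp
    then have "u2 \<le> u1" using ba a b by (simp add: algebra_simps)
    then have "(2 * k1 + 1, u2, u1) \<in> secondary_ints n" "enc n (2 * k1 + 1, u2, u1) = (b, a)"
      using k2 u a b by (auto simp: secondary_ints_def letters_def enc_def pos_def zeta_def eta_def)
    then show ?thesis using that by blast
  qed
qed

lemma succ_pos: "a \<in> primaries n \<Longrightarrow> n \<ge> 1 \<Longrightarrow> succ n a \<in> primaries n \<and> pos n (succ n a) = pos n a + 1"
  by (cases a) (auto simp: succ_def pos_def letters_def bar_def algebra_simps)

lemma pred_pos: "a \<in> primaries n \<Longrightarrow> n \<ge> 1 \<Longrightarrow> pred n a \<in> primaries n \<and> pos n (pred n a) = pos n a - 1"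
  by (cases a) (auto simp: pred_def pos_def letters_def bar_def algebra_simps)

lemma succ_funpow_pos: "a \<in> primaries n \<Longrightarrow> n \<ge> 1 \<Longrightarrow> (succ n ^^ u) a \<in> primaries n \<and> pos n ((succ n ^^ u) a) = pos n a + int u"
proof (induction u)
  case (Suc u)
  then show ?case using succ_pos[of "(succ n ^^ u) a" n] by simp
qed simp

lemma df_defined_enc:
  assumes n: "n \<ge> 1"
  shows "df_defined n e \<longleftrightarrow> e \<in> secondary_ints n \<and> snd (enc n e) - fst (enc n e) \<le> 2 * int n - 1"
proof
  assume "df_defined n e"
  then obtain u where u: "e \<in> secondary_ints n" "u \<le> 2 * n - 1" "eta e = (succ n ^^ u) (zeta e)" by (auto simp: df_defined_def)
  then have "pos n (eta e) = pos n (zeta e) + int u" using succ_funpow_pos[of "zeta e" n u] zeta_eta_primaries[OF u(1)] n by auto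
  then show "e \<in> secondary_ints n \<and> snd (enc n e) - fst (enc n e) \<le> 2 * int n - 1" using u n by (auto simp: enc_def)
next
  assume e: "e \<in> secondary_ints n \<and> snd (enc n e) - fst (enc n e) \<le> 2 * int n - 1"
  define u where "u = nat (pos n (eta e) - pos n (zeta e))"
  have "pos n (eta e) \<ge> pos n (zeta e)" using enc_interval[of e n] e by (simp add: enc_def)
  then have "pos n ((succ n ^^ u) (zeta e)) = pos n (eta e)"
    using succ_funpow_pos[of "zeta e" n u] zeta_eta_primaries[of e n] e n by (auto simp: u_def)
  then have "eta e = (succ n ^^ u) (zeta e)"
    using succ_funpow_pos[of "zeta e" n u] zeta_eta_primaries[of e n] e n pos_inj[of "eta e" n "(succ n ^^ u) (zeta e)"] by auto
  moreover have "u \<le> 2 * n - 1" using e n by (auto simp: u_def enc_def)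
  ultimately show "df_defined n e" using e by (auto simp: df_defined_def)
qed

text \<open>A length of at most 2n - 1 leaves room for one more unit at either end, so an element as
  described exists, and injectivity makes it unique.\<close>

lemma steps_enc:
  assumes n: "n \<ge> 1" and df: "df_defined n e"
  shows "d_step n e \<in> secondary_ints n" "enc n (d_step n e) = (fst (enc n e) - 1, snd (enc n e))"
    "f_step n e \<in> secondary_ints n" "enc n (f_step n e) = (fst (enc n e), snd (enc n e) + 1)"
proof -
  have e: "e \<in> secondary_ints n" and len: "snd (enc n e) - fst (enc n e) \<le> 2 * int n - 1"
    using df df_defined_enc[OF n] by auto
  note iv = enc_interval[OF e]
  note pr = zeta_eta_primaries[OF e]
  have "(\<exists>e'. e' \<in> secondary_ints n \<and> eta e' = eta e \<and> zeta e' = pred n (zeta e) \<and> enc n e' = (fst (enc n e) - 1, snd (enc n e)))"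
  proof -
    obtain e' where e': "e' \<in> secondary_ints n" "enc n e' = (fst (enc n e) - 1, snd (enc n e))"
      by (rule enc_surj[OF n, of "fst (enc n e) - 1" "snd (enc n e)"]) (use iv len in auto)
    have pp: "pred n (zeta e) \<in> primaries n" "pos n (pred n (zeta e)) = pos n (zeta e) - 1" using pred_pos[of "zeta e" n] pr n by blast+
    have "enc n e' = (pos n (pred n (zeta e)), pos n (eta e))" unfolding e'(2) pp(2) by (simp add: enc_def)
    then have "eta e' = eta e" "zeta e' = pred n (zeta e)" using enc_eqD[OF e'(1) pp(1)] pr by blast+
    then show ?thesis using e' by blast
  qed
  then obtain e1 where e1: "e1 \<in> secondary_ints n" "eta e1 = eta e" "zeta e1 = pred n (zeta e)" "enc n e1 = (fst (enc n e) - 1, snd (enc n e))" by blast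
  have "d_step n e = e1" unfolding d_step_def
    by (rule the_equality) (use e1 in \<open>auto intro!: zeta_eta_inj\<close>)
  then show "d_step n e \<in> secondary_ints n" "enc n (d_step n e) = (fst (enc n e) - 1, snd (enc n e))" using e1 by auto
  have "(\<exists>e'. e' \<in> secondary_ints n \<and> eta e' = succ n (eta e) \<and> zeta e' = zeta e \<and> enc n e' = (fst (enc n e), snd (enc n e) + 1))"
  proof -
    obtain e' where e': "e' \<in> secondary_ints n" "enc n e' = (fst (enc n e), snd (enc n e) + 1)"
      by (rule enc_surj[OF n, of "fst (enc n e)" "snd (enc n e) + 1"]) (use iv len in auto)
    have pp: "succ n (eta e) \<in> primaries n" "pos n (succ n (eta e)) = pos n (eta e) + 1" using succ_pos[of "eta e" n] pr n by blast+
    have "enc n e' = (pos n (zeta e), pos n (succ n (eta e)))" unfolding e'(2) pp(2) by (simp add: enc_def)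
    then have "eta e' = succ n (eta e)" "zeta e' = zeta e" using enc_eqD[OF e'(1) _ pp(1)] pr by blast+
    then show ?thesis using e' by blast
  qed
  then obtain e2 where e2: "e2 \<in> secondary_ints n" "eta e2 = succ n (eta e)" "zeta e2 = zeta e" "enc n e2 = (fst (enc n e), snd (enc n e) + 1)" by blast
  have "f_step n e = e2" unfolding f_step_def
    by (rule the_equality) (use e2 in \<open>auto intro!: zeta_eta_inj\<close>)
  then show "f_step n e \<in> secondary_ints n" "enc n (f_step n e) = (fst (enc n e), snd (enc n e) + 1)" using e2 by auto
qed

abbreviation esum :: "nat \<Rightarrow> secondary \<Rightarrow> int" where
  "esum n e \<equiv> fst (enc n e) + snd (enc n e)"

text \<open>Since 2 \<le> x + y \<le> 4n, the end sum 2nk + x + y is at least 2n + 2 for positive k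
  and at most 2n for negative k; for k = 0 the comparison with the bar is the stated bound.\<close>

lemma positive_secondary_enc: "n \<ge> 1 \<Longrightarrow> e \<in> positive_secondary n \<longleftrightarrow> e \<in> secondary_ints n \<and> esum n e \<ge> 2 * int n + 2"
proof -
  assume n: "n \<ge> 1"
  obtain k x y where k: "e = (k, x, y)" by (cases e)
  have "(k = 0 \<and> bar n y < x) \<or> k > 0 \<longleftrightarrow> 2 * int n * k + int x + int y \<ge> 2 * int n + 2" if "e \<in> secondary_ints n"
  proof -
    have xy: "1 \<le> x" "x \<le> 2 * n" "1 \<le> y" "y \<le> 2 * n" using that k by (auto simp: secondary_ints_def letters_def)
    consider "k = 0" | "k \<ge> 1" | "k \<le> -1" by linarith
    then show ?thesis
    proof cases
      case 1
      then show ?thesis using xy by (auto simp: bar_def)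
    next
      case 2
      then have "2 * int n * 1 \<le> 2 * int n * k" by (intro mult_left_mono) auto
      then have "2 * int n * k + int x + int y \<ge> 2 * int n + 2" using xy by linarith
      then show ?thesis using 2 by simp
    next
      case 3
      then have "2 * int n * k \<le> 2 * int n * (-1)" by (intro mult_left_mono) auto
      then have "\<not> 2 * int n * k + int x + int y \<ge> 2 * int n + 2" using xy by linarith
      then show ?thesis using 3 by simp
    qed
  qed
  then show ?thesis unfolding k enc_sum by (auto simp: positive_secondary_def)
qed

lemma omega_enc: "n \<ge> 1 \<Longrightarrow> j \<le> n \<Longrightarrow> omega n j \<in> secondary_ints n \<and> enc n (omega n j) = (int j, 2 * int n - int j)"
  by (auto simp: omega_def secondary_ints_def letters_def bar_def enc_def pos_def zeta_def eta_def)

text \<open>These are the two layers directly below the positive part, of heights -1 and 0. For k =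
  -1 only x = y = 2n reaches them, which is the exceptional element
  \<open>omega n 0\<close>.\<close>

lemma Omega_enc: "n \<ge> 1 \<Longrightarrow> e \<in> Omega n \<longleftrightarrow> e \<in> secondary_ints n \<and> esum n e \<in> {2 * int n, 2 * int n + 1}"
proof
  assume n: "n \<ge> 1" and "e \<in> Omega n"
  then consider j where "j \<le> n" "e = omega n j" | u where "1 \<le> u" "u \<le> n" "e = (0, u, bar n u)" by (auto simp: Omega_def)
  then show "e \<in> secondary_ints n \<and> esum n e \<in> {2 * int n, 2 * int n + 1}"
  proof cases
    case 1
    then show ?thesis using omega_enc[OF n 1(1)] by auto
  next
    case 2
    then show ?thesis unfolding 2(3) enc_sum by (auto simp: secondary_ints_def letters_def bar_def)
  qed
next
  assume n: "n \<ge> 1" and e: "e \<in> secondary_ints n \<and> esum n e \<in> {2 * int n, 2 * int n + 1}"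
  obtain k x y where k: "e = (k, x, y)" by (cases e)
  have xy: "1 \<le> x" "x \<le> 2 * n" "1 \<le> y" "y \<le> 2 * n" "x \<le> y" using e k by (auto simp: secondary_ints_def letters_def)
  have s: "2 * int n * k + int x + int y \<in> {2 * int n, 2 * int n + 1}" using e unfolding k enc_sum by blast
  consider "k = 0" | "k \<ge> 1" | "k = -1" | "k \<le> -2" by linarith
  then show "e \<in> Omega n"
  proof cases
    case 1
    show ?thesis
    proof (cases "x + y = 2 * n")
      case True
      then have "e = omega n x" "x \<le> n" using 1 k xy by (auto simp: omega_def bar_def)
      then show ?thesis by (auto simp: Omega_def)
    next
      case False
      then have "e = (0, x, bar n x)" "x \<in> {1..n}" using 1 k xy s by (auto simp: bar_def)
      then show ?thesis by (auto simp: Omega_def)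
    qed
  next
    case 2
    then have "2 * int n * 1 \<le> 2 * int n * k" by (intro mult_left_mono) auto
    then have "2 * int n * k + int x + int y > 2 * int n + 1" using xy by linarith
    then show ?thesis using s by simp
  next
    case 3
    then have "e = omega n 0" using k xy s by (auto simp: omega_def bar_def)
    then show ?thesis by (auto simp: Omega_def)
  next
    case 4
    then have "2 * int n * k \<le> 2 * int n * (-2)" by (intro mult_left_mono) auto
    then have "2 * int n * k + int x + int y < 2 * int n" using xy n by linarith
    then show ?thesis using s by simp
  qed
qed

lemma region_enc: "n \<ge> 1 \<Longrightarrow> e \<in> Omega n \<union> positive_secondary n \<longleftrightarrow> e \<in> secondary_ints n \<and> esum n e \<ge> 2 * int n"
  by (auto simp: Omega_enc positive_secondary_enc)

lemma path_in_enc: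
  assumes n: "n \<ge> 1" and p: "path_in n X p"
  shows "j \<le> j' \<Longrightarrow> j' \<le> 2 * n \<Longrightarrow> fst (enc n (p j')) \<le> fst (enc n (p j)) \<and> snd (enc n (p j)) \<le> snd (enc n (p j'))
    \<and> snd (enc n (p j')) - fst (enc n (p j')) = snd (enc n (p j)) - fst (enc n (p j)) + int (j' - j)"
proof (induction j' rule: dec_induct)
  case base
  show ?case by simp
next
  case (step j')
  then have "j' < 2 * n" by simp
  then have "df_defined n (p j')" "p (Suc j') \<in> {d_step n (p j'), f_step n (p j')}" using p by (auto simp: path_in_def)
  then show ?case using step steps_enc[OF n, of "p j'"] by auto
qed

lemma nested_path:
  assumes n: "n \<ge> 1" and e: "e \<in> secondary_ints n" "e' \<in> secondary_ints n" "esum n e \<ge> 2 * int n" "esum n e' \<ge> 2 * int n"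
    and nest: "fst (enc n e') \<le> fst (enc n e)" "snd (enc n e) \<le> snd (enc n e')"
  obtains p where "path_in n (Omega n \<union> positive_secondary n) p"
    "p (nat (snd (enc n e) - fst (enc n e))) = e" "p (nat (snd (enc n e') - fst (enc n e'))) = e'"
proof -
  obtain b a where ba: "enc n e = (b, a)" by force
  obtain b' a' where ba': "enc n e' = (b', a')" by force
  have iv: "b \<le> a" "a \<le> b + 2 * int n" "b' \<le> a'" "a' \<le> b' + 2 * int n" using enc_interval[OF e(1)] enc_interval[OF e(2)] ba ba' by auto
  have nst: "b' \<le> b" "a \<le> a'" "a + b \<ge> 2 * int n" "a' + b' \<ge> 2 * int n" using nest e ba ba' by auto
  \<comment> \<open>Indexed by length, the chain grows from [a, a] down to [b, a], up to [b, a'],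
    down to [b', a'], and finally upwards to length 2n. Raising the upper end before lowering to b'
    keeps every end sum at least 2n, so the path stays in the allowed set.\<close>
  define Q where "Q j = (if int j \<le> a - b then (a - int j, a) else if int j \<le> a' - b then (b, b + int j)
    else if int j \<le> a' - b' then (a' - int j, a') else (b', b' + int j))" for j :: nat
  have Qiv: "fst (Q j) \<le> snd (Q j) \<and> snd (Q j) \<le> fst (Q j) + 2 * int n \<and> snd (Q j) - fst (Q j) = int j \<and> fst (Q j) + snd (Q j) \<ge> 2 * int n"
    if "j \<le> 2 * n" for j
    using that nst iv by (auto simp: Q_def)
  define p where "p j = inv_into (secondary_ints n) (enc n) (Q j)" for j
  have pQ: "p j \<in> secondary_ints n" "enc n (p j) = Q j" if jn: "j \<le> 2 * n" for j
  proof -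
    obtain e where "e \<in> secondary_ints n" "enc n e = (fst (Q j), snd (Q j))"
      by (rule enc_surj[OF n, of "fst (Q j)" "snd (Q j)"]) (use Qiv[OF jn] in auto)
    then have "Q j \<in> enc n ` secondary_ints n" by (metis image_eqI prod.collapse)
    then show "p j \<in> secondary_ints n" "enc n (p j) = Q j"
      unfolding p_def by (rule inv_into_into, rule f_inv_into_f)
  qed
  have "path_in n (Omega n \<union> positive_secondary n) p"
    unfolding path_in_def
  proof (intro conjI allI impI)
    fix j assume j: "j \<le> 2 * n"
    show "p j \<in> (Omega n \<union> positive_secondary n) \<inter> secondary_ints n"
      using pQ[OF j] Qiv[OF j] region_enc[OF n, of "p j"] by auto
  next
    fix j assume j: "j < 2 * n"
    then have j': "j \<le> 2 * n" "Suc j \<le> 2 * n" by auto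
    show df: "df_defined n (p j)" using df_defined_enc[OF n] pQ[OF j'(1)] Qiv[OF j'(1)] j by auto
    have "Q (Suc j) = (fst (Q j) - 1, snd (Q j)) \<or> Q (Suc j) = (fst (Q j), snd (Q j) + 1)"
      using nst iv by (auto simp: Q_def)
    then have "enc n (p (Suc j)) = enc n (d_step n (p j)) \<or> enc n (p (Suc j)) = enc n (f_step n (p j))"
      using steps_enc[OF n df] pQ[OF j'(1)] pQ[OF j'(2)] by auto
    then show "p (Suc j) \<in> {d_step n (p j), f_step n (p j)}"
      using inj_onD[OF enc_inj _ pQ(1)[OF j'(2)] steps_enc(1)[OF n df]] inj_onD[OF enc_inj _ pQ(1)[OF j'(2)] steps_enc(3)[OF n df]] by blast
  qed
  moreover have "p (nat (a - b)) = e"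
  proof -
    have l: "nat (a - b) \<le> 2 * n" using iv by auto
    have "Q (nat (a - b)) = (b, a)" using iv by (auto simp: Q_def)
    then show ?thesis using inj_onD[OF enc_inj _ pQ(1)[OF l] e(1)] pQ(2)[OF l] ba by simp
  qed
  moreover have "p (nat (a' - b')) = e'"
  proof -
    have l: "nat (a' - b') \<le> 2 * n" using iv by auto
    have "Q (nat (a' - b')) = (b', a')" using iv nst by (auto simp: Q_def)
    then show ?thesis using inj_onD[OF enc_inj _ pQ(1)[OF l] e(2)] pQ(2)[OF l] ba' by simp
  qed
  ultimately show ?thesis using that ba ba' by auto
qed

lemma sum_le_oneI:
  fixes c :: "nat \<Rightarrow> nat"
  assumes "finite F" "\<And>j. j \<in> F \<Longrightarrow> c j \<le> 1" "\<And>j j'. j \<in> F \<Longrightarrow> j' \<in> F \<Longrightarrow> j < j' \<Longrightarrow> c j = 0 \<or> c j' = 0"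
  shows "sum c F \<le> 1"
proof (cases "\<exists>j\<in>F. c j \<noteq> 0")
  case True
  then obtain j where j: "j \<in> F" "c j \<noteq> 0" by blast
  have "c j' = 0" if "j' \<in> F - {j}" for j'
    using assms(3)[of j j'] assms(3)[of j' j] that j by (metis DiffE linorder_neqE_nat singletonI)
  then have "sum c F = c j" using assms(1) j by (simp add: sum.remove[of F j])
  then show ?thesis using assms(2)[OF j(1)] by simp
qed simp

lemma sorted_wrt_mset_pair:
  "sorted_wrt P xs \<Longrightarrow> mset xs = {#e, e'#} + r \<Longrightarrow> P e e' \<or> P e' e"
proof (induction xs arbitrary: r)
  case (Cons x xs)
  show ?case
  proof (cases "x = e \<or> x = e'")
    case True
    then have "(x = e \<and> mset xs = add_mset e' r) \<or> (x = e' \<and> mset xs = add_mset e r)"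
      using Cons.prems(2) by (auto simp: add_mset_commute)
    then have "(x = e \<and> e' \<in># mset xs) \<or> (x = e' \<and> e \<in># mset xs)" by (metis insertI1 set_mset_add_mset_insert)
    then show ?thesis using Cons.prems(1) by auto
  next
    case False
    have "x \<in># {#e, e'#} + r" unfolding Cons.prems(2)[symmetric] by simp
    then have "x \<in># r" using False by auto
    then obtain r' where r': "r = add_mset x r'" by (meson multi_member_split)
    then have "mset xs = {#e, e'#} + r'" using Cons.prems(2) by simp
    then show ?thesis using Cons by auto
  qed
qed simp

section \<open>Weights and counting\<close>

context symplectic_fock
begin

lemma admissible_partitions_list:
  assumes adm: "\<pi> \<in> admissible_partitions n (omega n i)"
  obtains lp where "mset lp = \<pi>" "set lp \<subseteq> secondary_ints n" "admissible_list (map (enc n) lp)"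
proof -
  let ?w = "omega n i"
  note n = n_pos
  \<comment> \<open>With the fictitious part included, extended frequencies are multiplicities in a
    single multiset, and the path condition says that no two of its members are nested.\<close>
  define T where "T = add_mset ?w \<pi>"
  have sub: "set_mset \<pi> \<subseteq> positive_secondary n"
    and path: "\<And>p. path_in n (Omega n \<union> positive_secondary n) p \<Longrightarrow> (\<Sum>j \<le> 2 * n. ext_freq n ?w \<pi> (p j)) \<le> 1"
    using adm by (auto simp: admissible_partitions_def)
  have w: "?w \<in> secondary_ints n" "enc n ?w = (int i, 2 * int n - int i)" using omega_enc[OF n i_le] by auto
  have wO: "?w \<in> Omega n" using w Omega_enc[OF n, of ?w] by simp
  have disj: "e \<notin> Omega n" if "e \<in># \<pi>" for e
    using that sub positive_secondary_enc[OF n, of e] Omega_enc[OF n, of e] by auto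
  have freq: "ext_freq n ?w \<pi> e = count T e" for e
  proof (cases "e \<in> Omega n")
    case True
    then have "e \<notin># \<pi>" using disj[of e] by auto
    then have "count \<pi> e = 0" by (simp only: not_in_iff)
    then show ?thesis using True by (simp add: ext_freq_def T_def)
  next
    case False
    then show ?thesis using wO by (auto simp: ext_freq_def T_def)
  qed
  have reg: "e \<in> secondary_ints n" "esum n e \<ge> 2 * int n" if "e \<in># T" for e
    using that sub w positive_secondary_enc[OF n, of e] by (auto simp: T_def)
  have unn: "\<not> nested (enc n e) (enc n e')" if T: "T = {#e, e'#} + r" for e e' r
  proof
    assume nest: "nested (enc n e) (enc n e')"
    have mem: "e \<in># T" "e' \<in># T" using T by auto
    obtain p where p: "path_in n (Omega n \<union> positive_secondary n) p"
      "p (nat (snd (enc n e) - fst (enc n e))) = e" "p (nat (snd (enc n e') - fst (enc n e'))) = e'"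
      using nested_path[OF n reg(1)[OF mem(1)] reg(1)[OF mem(2)] reg(2)[OF mem(1)] reg(2)[OF mem(2)]] nest
      by (auto simp: nested_def)
    define j where "j = nat (snd (enc n e) - fst (enc n e))"
    define j' where "j' = nat (snd (enc n e') - fst (enc n e'))"
    have jj: "j \<le> 2 * n" "j' \<le> 2 * n"
      using enc_interval[OF reg(1)[OF mem(1)]] enc_interval[OF reg(1)[OF mem(2)]] by (auto simp: j_def j'_def)
    have le: "(\<Sum>k\<in>{j, j'}. count T (p k)) \<le> 1"
    proof -
      have "(\<Sum>k\<in>{j, j'}. count T (p k)) \<le> (\<Sum>k\<le>2 * n. count T (p k))"
        using jj by (intro sum_mono2) auto
      then show ?thesis using path[OF p(1)] by (simp add: freq)
    qed
    have pj: "p j = e" "p j' = e'" unfolding j_def j'_def by (rule p(2), rule p(3))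
    show False
    proof (cases "j = j'")
      case True
      then have "e = e'" using pj by simp
      then have "count T e \<ge> 2" using T by simp
      then show False using le True pj by simp
    next
      case False
      have "count T e \<ge> 1" "count T e' \<ge> 1" using mem by (auto simp: Suc_le_eq)
      moreover have "count T e + count T e' \<le> 1" using le False pj by simp
      ultimately show False by linarith
    qed
  qed
  obtain l0 where l0: "mset l0 = \<pi>" using ex_mset by blast
  define lp where "lp = sort_key (\<lambda>e. fst (enc n e)) l0"
  have lp: "mset lp = \<pi>" by (simp add: lp_def l0)
  have set: "set lp = set_mset \<pi>" using lp by (metis set_mset_mset)
  have "sorted_wrt (\<lambda>e e'. fst (enc n e) < fst (enc n e') \<and> snd (enc n e) < snd (enc n e')) lp"
  proof (rule unnested_sorted)
    fix e e' r assume "mset lp = {#e, e'#} + r"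
    then have "T = {#e, e'#} + add_mset ?w r" by (simp add: T_def lp)
    then show "\<not> nested (enc n e) (enc n e')" by (rule unn)
  qed (simp add: lp_def)
  \<comment> \<open>Neither this interval nor that of the fictitious part contains the other, and
    its end sum is larger; hence both of its ends are larger.\<close>
  moreover have "fst (enc n e) > int i \<and> snd (enc n e) > per - int i" if e: "e \<in> set lp" for e
  proof -
    have "e \<in># \<pi>" using e set by simp
    then obtain r where r: "\<pi> = add_mset e r" by (meson multi_member_split)
    have "\<not> nested (enc n e) (enc n ?w)" by (rule unn[of _ _ r]) (simp add: T_def r add_mset_commute)
    moreover have "\<not> nested (enc n ?w) (enc n e)" by (rule unn[of _ _ r]) (simp add: T_def r)
    moreover have "esum n e \<ge> 2 * int n + 2" using sub \<open>e \<in># \<pi>\<close> positive_secondary_enc[OF n, of e] by auto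
    ultimately show ?thesis unfolding w(2) by (auto simp: nested_def per_def)
  qed
  moreover have sec: "set lp \<subseteq> secondary_ints n"
    using sub set positive_secondary_enc[OF n] by auto
  ultimately have "admissible_list (map (enc n) lp)"
    using enc_interval[of _ n] by (auto simp: admissible_list_def sorted_wrt_map per_def)
  then show ?thesis using that lp sec by blast
qed

lemma list_admissible_partitions:
  assumes sec: "set lp \<subseteq> secondary_ints n" and adm: "admissible_list (map (enc n) lp)"
  shows "mset lp \<in> admissible_partitions n (omega n i)"
proof -
  let ?w = "omega n i" and ?\<pi> = "mset lp"
  note n = n_pos
  have w: "?w \<in> secondary_ints n" "enc n ?w = (int i, 2 * int n - int i)" using omega_enc[OF n i_le] by auto
  have wO: "?w \<in> Omega n" using w Omega_enc[OF n, of ?w] by simp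
  have bd: "fst (enc n e) > int i \<and> snd (enc n e) > per - int i" if "e \<in> set lp" for e
    using adm that by (auto simp: admissible_list_def)
  have sub: "set lp \<subseteq> positive_secondary n"
    using bd sec positive_secondary_enc[OF n] by (fastforce simp: per_def)
  have disj: "e \<notin> Omega n" if "e \<in> set lp" for e
    using that sub positive_secondary_enc[OF n, of e] Omega_enc[OF n, of e] by auto
  define T where "T = add_mset ?w ?\<pi>"
  have freq: "ext_freq n ?w ?\<pi> e = count T e" for e
  proof (cases "e \<in> Omega n")
    case True
    then have "e \<notin># ?\<pi>" using disj[of e] by auto
    then have "count ?\<pi> e = 0" by (simp only: not_in_iff)
    then show ?thesis using True by (simp add: ext_freq_def T_def)
  next
    case False
    then show ?thesis using wO by (auto simp: ext_freq_def T_def)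
  qed
  have srt: "sorted_wrt (\<lambda>e e'. fst (enc n e) < fst (enc n e') \<and> snd (enc n e) < snd (enc n e')) (?w # lp)"
    using adm bd w by (auto simp: admissible_list_def sorted_wrt_map per_def)
  have unn: "\<not> nested (enc n e) (enc n e')" if T: "T = {#e, e'#} + r" for e e' r
    using sorted_wrt_mset_pair[OF srt, of e e' r] T by (auto simp: nested_def T_def)
  have "(\<Sum>j \<le> 2 * n. ext_freq n ?w ?\<pi> (p j)) \<le> 1" if p: "path_in n (Omega n \<union> positive_secondary n) p" for p
    unfolding freq
  proof (rule sum_le_oneI)
    fix j assume "j \<in> {..2 * n}"
    show "count T (p j) \<le> 1"
    proof (rule ccontr)
      assume "\<not> count T (p j) \<le> 1"
      then have c2: "count T (p j) \<ge> 2" by simp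
      have "{#p j, p j#} \<subseteq># T"
      proof (rule mset_subset_eqI)
        fix a show "count {#p j, p j#} a \<le> count T a" using c2 by (cases "a = p j") auto
      qed
      then obtain r where "T = {#p j, p j#} + r" by (metis subset_mset.add_diff_inverse)
      then show False using unn[of "p j" "p j" r] by (simp add: nested_def)
    qed
  next
    fix j j' assume j: "j \<in> {..2 * n}" "j' \<in> {..2 * n}" "j < j'"
    then have pe: "nested (enc n (p j)) (enc n (p j'))"
      "snd (enc n (p j')) - fst (enc n (p j')) = snd (enc n (p j)) - fst (enc n (p j)) + int (j' - j)"
      using path_in_enc[OF n p, of j j'] by (auto simp: nested_def)
    then have ne: "p j \<noteq> p j'" using j by auto
    show "count T (p j) = 0 \<or> count T (p j') = 0"
    proof (rule ccontr)
      assume "\<not> (count T (p j) = 0 \<or> count T (p j') = 0)"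
      then have c1: "count T (p j) \<ge> 1" "count T (p j') \<ge> 1" by (auto simp del: count_eq_zero_iff)
      have "{#p j, p j'#} \<subseteq># T"
      proof (rule mset_subset_eqI)
        fix a show "count {#p j, p j'#} a \<le> count T a" using c1 ne by (cases "a = p j"; cases "a = p j'") auto
      qed
      then obtain r where "T = {#p j, p j'#} + r" by (metis subset_mset.add_diff_inverse)
      then show False using unn pe(1) by blast
    qed
  qed simp
  then show ?thesis using sub by (auto simp: admissible_partitions_def)
qed

section \<open>Weights of fermion modes, words and currents\<close>

definition cw :: "(nat \<Rightarrow> 'h \<Rightarrow> complex) \<Rightarrow> int \<Rightarrow> 'h \<Rightarrow> complex" where
  "cw \<alpha> x = (if x \<le> int n then colour_weight n \<alpha> (nat x) else - colour_weight n \<alpha> (nat (per + 1 - x)))"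

text \<open>The weight added by a fermion at position p: the weight of its letter, lowered by one
  null root for each period, in accordance with q being the exponential of minus the null
  root.\<close>

definition pw :: "(nat \<Rightarrow> 'h \<Rightarrow> complex) \<Rightarrow> int \<Rightarrow> 'h \<Rightarrow> complex" where
  "pw \<alpha> p = (\<lambda>h. cw \<alpha> (letter p) h - of_int (period p) * null_root n \<alpha> h)"

lemma letter_unique:
  assumes "1 \<le> x" "x \<le> per"
  shows "letter (x + per * k) = x" "period (x + per * k) = k"
proof -
  have "per * period (x + per * k) + letter (x + per * k) = per * k + x"
    using letter_period[of "x + per * k"] by simp
  moreover have "\<bar>letter (x + per * k) - x\<bar> < per" using letter_bounds[of "x + per * k"] assms by linarith
  ultimately show "letter (x + per * k) = x" "period (x + per * k) = k"
    using mult_window[of per "period (x + per * k)" "letter (x + per * k)" k x] by auto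
qed

lemma pw_letter: "1 \<le> x \<Longrightarrow> x \<le> per \<Longrightarrow> pw \<alpha> (x + per * k) = (\<lambda>h. cw \<alpha> x h - of_int k * null_root n \<alpha> h)"
  by (simp add: pw_def letter_unique)

lemma pw_cases:
  obtains x k where "1 \<le> x" "x \<le> per" "p = x + per * k"
  using letter_period[of p] letter_bounds[of p] by blast

lemma pw_shift: "pw \<alpha> (p + per * t) h = pw \<alpha> p h - of_int t * null_root n \<alpha> h"
proof -
  obtain x k where x: "1 \<le> x" "x \<le> per" "p = x + per * k" by (rule pw_cases)
  have "p + per * t = x + per * (k + t)" by (simp add: x algebra_simps)
  then show ?thesis using x by (simp only: pw_letter) (simp add: algebra_simps)
qed

lemma pw_dual: "pw \<alpha> (per + 1 - p) h = - pw \<alpha> p h"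
proof -
  obtain x k where x: "1 \<le> x" "x \<le> per" "p = x + per * k" by (rule pw_cases)
  have e: "per + 1 - p = (per + 1 - x) + per * (- k)" by (simp add: x)
  have "cw \<alpha> (per + 1 - x) h = - cw \<alpha> x h"
    using x(1,2) by (auto simp: cw_def per_def)
  moreover have "pw \<alpha> (per + 1 - p) = (\<lambda>h. cw \<alpha> (per + 1 - x) h - of_int (- k) * null_root n \<alpha> h)"
    unfolding e by (rule pw_letter) (use x in auto)
  moreover have "pw \<alpha> p = (\<lambda>h. cw \<alpha> x h - of_int k * null_root n \<alpha> h)"
    unfolding x(3) by (rule pw_letter[OF x(1,2)])
  ultimately show ?thesis by simp
qed

lemma colour_weight_step: "j < n \<Longrightarrow> colour_weight n \<alpha> j h = \<alpha> j h + colour_weight n \<alpha> (Suc j) h"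
  by (simp add: colour_weight_def sum.atLeast_Suc_lessThan)

lemma null_root_colour: "null_root n \<alpha> h = \<alpha> 0 h + 2 * colour_weight n \<alpha> 1 h"
  by (simp add: null_root_def colour_weight_def)

text \<open>Neighbouring colours differ by one simple root, run through forwards below n and
  backwards above it. At x = n a colour meets its inverse, which gives \<alpha> n; at x = 2n the
  period changes and the null root turns the step into \<alpha> 0.\<close>

lemma pw_step: "pw \<alpha> (q + 1) h - pw \<alpha> q h = - \<alpha> (res q) h"
proof -
  obtain x k where x: "1 \<le> x" "x \<le> per" "q = x + per * k" by (rule pw_cases)
  have q: "pw \<alpha> q h = cw \<alpha> x h - of_int k * null_root n \<alpha> h" unfolding x(3) by (simp add: pw_letter[OF x(1,2)])
  have rx: "res q = res x" by (rule res_cong) (simp add: x(3))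
  show ?thesis
  proof (cases "x = per")
    case True
    have "q + 1 = 1 + per * (k + 1)" by (simp add: x(3) True algebra_simps)
    then have "pw \<alpha> (q + 1) h = cw \<alpha> 1 h - of_int (k + 1) * null_root n \<alpha> h"
      using per_pos by (simp only: pw_letter)
    moreover have "cw \<alpha> 1 h = colour_weight n \<alpha> 1 h" "cw \<alpha> per h = - colour_weight n \<alpha> 1 h"
      using n_pos by (auto simp: cw_def per_def)
    moreover have r0: "res x = 0" using res_period[of 0] res_int[of 0] True by simp
    ultimately have "pw \<alpha> (q + 1) h - pw \<alpha> q h = (colour_weight n \<alpha> 1 h - of_int (k + 1) * null_root n \<alpha> h)
        - (- colour_weight n \<alpha> 1 h - of_int k * null_root n \<alpha> h)" using q True by (simp only:)
    also have "\<dots> = 2 * colour_weight n \<alpha> 1 h - null_root n \<alpha> h" by (simp add: algebra_simps)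
    also have "\<dots> = - \<alpha> (res q) h" using null_root_colour[of \<alpha> h] rx r0 by simp
    finally show ?thesis .
  next
    case False
    have "q + 1 = (x + 1) + per * k" by (simp add: x(3))
    then have q1: "pw \<alpha> (q + 1) h = cw \<alpha> (x + 1) h - of_int k * null_root n \<alpha> h"
      using x False by (simp only: pw_letter)
    consider "x < int n" | "x = int n" | "x > int n" by linarith
    then have "cw \<alpha> (x + 1) h - cw \<alpha> x h = - \<alpha> (res x) h"
    proof cases
      case 1
      have "res x = nat x" using res_int[of "nat x"] 1 x by simp
      moreover have "nat (x + 1) = Suc (nat x)" using x by simp
      ultimately show ?thesis using 1 x colour_weight_step[of "nat x" \<alpha> h] by (simp add: cw_def)
    next
      case 2
      then have "res x = n" using res_int[of n] by simp
      moreover have "2 * colour_weight n \<alpha> n h = \<alpha> n h" by (simp add: colour_weight_def)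
      ultimately show ?thesis using 2 by (simp add: cw_def per_def)
    next
      case 3
      define j where "j = nat (per - x)"
      have j: "j < n" "x = per - int j" "j \<ge> 1" using 3 x False by (auto simp: j_def per_def)
      have "res x = res (int j)" unfolding res_eq_iff by (simp add: j(2))
      then have "res x = j" using res_int[of j] j by simp
      moreover have "nat (per + 1 - x) = Suc j" "nat (per + 1 - (x + 1)) = j" using j by auto
      ultimately show ?thesis using 3 j colour_weight_step[of j \<alpha> h] by (simp add: cw_def)
    qed
    then show ?thesis using q q1 rx by simp
  qed
qed

lemma graded_fop: "graded (pw \<alpha>) \<mu> \<phi> \<Longrightarrow> graded (pw \<alpha>) (\<mu> + - \<alpha> j) (fop j \<phi>)"
  unfolding fop_def
  by (rule graded_Z) (auto simp: fcol_def fun_eq_iff pw_step)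

lemma graded_fw: "graded (pw \<alpha>) (\<lambda>h. - (\<Sum>k\<leftarrow>I. \<alpha> k h)) (fw I vac)"
proof (induction I)
  case Nil
  show ?case using graded_vac[of "pw \<alpha>"] by (simp add: zero_fun_def)
next
  case (Cons j I)
  have "(\<lambda>h. - (\<Sum>k\<leftarrow>j # I. \<alpha> k h)) = (\<lambda>h. - (\<Sum>k\<leftarrow>I. \<alpha> k h)) + - \<alpha> j" by (auto simp: fun_eq_iff)
  then show ?case using graded_fop[OF Cons, of j] by simp
qed

lemma pw_pair:
  assumes "per dvd q + r - 1"
  shows "pw \<alpha> (q + (p + r - per - 1)) - pw \<alpha> q = pw \<alpha> p + pw \<alpha> r"
proof -
  obtain t where t: "q + r - 1 = per * t" using assms by (elim dvdE)
  have q: "q = per + 1 - (r + per * (1 - t))" using t by (simp add: algebra_simps)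
  have qp: "q + (p + r - per - 1) = p + per * (t - 1)" using t by (simp add: algebra_simps)
  have e1: "pw \<alpha> q h = - (pw \<alpha> r h - of_int (1 - t) * null_root n \<alpha> h)" for h
    unfolding q by (simp only: pw_dual pw_shift)
  have e2: "pw \<alpha> (q + (p + r - per - 1)) h = pw \<alpha> p h - of_int (t - 1) * null_root n \<alpha> h" for h
    unfolding qp by (rule pw_shift)
  show ?thesis
  proof (rule ext)
    fix h
    have "(pw \<alpha> (q + (p + r - per - 1)) - pw \<alpha> q) h
      = (pw \<alpha> p h - of_int (t - 1) * null_root n \<alpha> h) - (- (pw \<alpha> r h - of_int (1 - t) * null_root n \<alpha> h))"
      by (simp only: minus_apply e1 e2)
    also have "\<dots> = (pw \<alpha> p + pw \<alpha> r) h" by (simp add: algebra_simps)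
    finally show "(pw \<alpha> (q + (p + r - per - 1)) - pw \<alpha> q) h = (pw \<alpha> p + pw \<alpha> r) h" .
  qed
qed

definition ewt :: "(nat \<Rightarrow> 'h \<Rightarrow> complex) \<Rightarrow> int \<times> int \<Rightarrow> 'h \<Rightarrow> complex" where
  "ewt \<alpha> e = pw \<alpha> (fst e) + pw \<alpha> (snd e)"

lemma graded_X: "graded (pw \<alpha>) \<mu> \<phi> \<Longrightarrow> graded (pw \<alpha>) (\<mu> + ewt \<alpha> (p, r)) (X p r \<phi>)"
  unfolding X_def
proof (rule graded_Z)
  fix q assume "Jcol p r q \<noteq> 0"
  then consider "per dvd q + r - 1" | "per dvd q + p - 1"
    by (cases "per dvd q + r - 1 \<or> per dvd q + p - 1") (force simp: Jcol_def)+
  then show "pw \<alpha> (q + (p + r - per - 1)) - pw \<alpha> q = ewt \<alpha> (p, r)"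
  proof cases
    case 1
    then show ?thesis by (simp add: pw_pair ewt_def)
  next
    case 2
    then have "pw \<alpha> (q + (r + p - per - 1)) - pw \<alpha> q = pw \<alpha> r + pw \<alpha> p" by (rule pw_pair)
    then show ?thesis by (simp add: ewt_def add.commute)
  qed
qed

lemma graded_Xs: "graded (pw \<alpha>) (sum_list (map (ewt \<alpha>) l)) (Xs l vac)"
proof (induction l)
  case Nil
  show ?case using graded_vac[of "pw \<alpha>"] by (simp only: list.map sum_list.Nil Xs_simps)
next
  case (Cons e l)
  have eq: "sum_list (map (ewt \<alpha>) (e # l)) = sum_list (map (ewt \<alpha>) l) + ewt \<alpha> (fst e, snd e)"
    by (simp only: list.map sum_list.Cons prod.collapse add.commute)
  show ?case unfolding eq Xs_simps by (rule graded_X[OF Cons])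
qed

text \<open>Restricting a function to the states of weight \<mu> is linear; it fixes y and either
  fixes or kills each generator.\<close>

lemma graded_extract:
  assumes g: "\<And>I. I \<in> D \<Longrightarrow> graded w (\<nu> I) (g I)" and y: "y \<in> fv.span (g ` D)" "graded w \<mu> y"
  shows "y \<in> fv.span (g ` {I \<in> D. \<nu> I = \<mu>})"
proof -
  define P where "P \<phi> = (\<lambda>S. if state_weight w S = \<mu> then \<phi> S else 0)" for \<phi> :: fock
  have lin: "flinear P" by (rule flinearI) (auto simp: P_def fpt)
  have "P y = y" using y(2) by (auto simp: P_def graded_def fun_eq_iff)
  moreover have "P y \<in> fv.span (P ` g ` D)" using y(1) unfolding fvp.linear_span_image[OF lin] by blast
  moreover have "fv.span (P ` g ` D) \<subseteq> fv.span (g ` {I \<in> D. \<nu> I = \<mu>})"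
  proof (rule fv.span_minimal[OF _ fv.subspace_span], clarify)
    fix I assume I: "I \<in> D"
    show "P (g I) \<in> fv.span (g ` {I \<in> D. \<nu> I = \<mu>})"
    proof (cases "\<nu> I = \<mu>")
      case True
      then have "P (g I) = g I" using g[OF I] by (auto simp: P_def graded_def fun_eq_iff)
      moreover have "g I \<in> fv.span (g ` {I \<in> D. \<nu> I = \<mu>})" using True I by (intro fv.span_base) auto
      ultimately show ?thesis by simp
    next
      case False
      then have "P (g I) = 0" using g[OF I] by (auto simp: P_def graded_def fun_eq_iff)
      then show ?thesis by (simp add: fv.span_zero)
    qed
  qed
  ultimately show ?thesis by auto
qed

text \<open>Straightening puts words into the span of admissible products and \<open>Xs_Mf\<close>
  gives the converse. Both families are homogeneous, so the comparison restricts to one weight,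
  where the admissible products form a basis.\<close>

lemma fock_dimension:
  fixes \<alpha> :: "nat \<Rightarrow> 'h \<Rightarrow> complex" and \<mu> :: "'h \<Rightarrow> complex"
  defines "D \<equiv> {I. set I \<subseteq> {..n} \<and> (\<lambda>h. - (\<Sum>k\<leftarrow>I. \<alpha> k h)) = \<mu>}"
    and "E \<equiv> {l. admissible_list l \<and> sum_list (map (ewt \<alpha>) l) = \<mu>}"
  assumes "finite D"
  shows "finite E" "fv.dim (fv.span ((\<lambda>I. fw I vac) ` D)) = card E"
proof -
  have "fv.span ((\<lambda>I. fw I vac) ` D) = fv.span ((\<lambda>l. Xs l vac) ` E)"
  proof (intro antisym fv.span_minimal fv.subspace_span)
    show "(\<lambda>I. fw I vac) ` D \<subseteq> fv.span ((\<lambda>l. Xs l vac) ` E)"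
    proof clarify
      fix I assume I: "I \<in> D"
      have "fw I vac \<in> Adm (int (length I))" by (rule fw_Adm)
      also have "\<dots> \<subseteq> fv.span ((\<lambda>l. Xs l vac) ` {l. admissible_list l})"
        unfolding Adm_def by (rule fv.span_mono) auto
      finally have "fw I vac \<in> fv.span ((\<lambda>l. Xs l vac) ` {l \<in> {l. admissible_list l}. sum_list (map (ewt \<alpha>) l) = \<mu>})"
        using graded_Xs graded_fw[of \<alpha> I] I by (intro graded_extract[of _ "pw \<alpha>"]) (auto simp: D_def)
      then show "fw I vac \<in> fv.span ((\<lambda>l. Xs l vac) ` E)" by (simp add: E_def)
    qed
    show "(\<lambda>l. Xs l vac) ` E \<subseteq> fv.span ((\<lambda>I. fw I vac) ` D)"
    proof clarify
      fix l assume l: "l \<in> E"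
      then have "Xs l vac \<in> Mf" using admissible_ht by (intro Xs_Mf) (auto simp: E_def)
      also have "Mf = fv.span ((\<lambda>I. fw I vac) ` {I. set I \<subseteq> {..n}})"
        unfolding Mf_def by (rule arg_cong[of _ _ fv.span]) auto
      finally have "Xs l vac \<in> fv.span ((\<lambda>I. fw I vac) ` {I \<in> {I. set I \<subseteq> {..n}}. (\<lambda>h. - (\<Sum>k\<leftarrow>I. \<alpha> k h)) = \<mu>})"
        using graded_fw[of \<alpha>] graded_Xs[of \<alpha> l] l by (intro graded_extract[of _ "pw \<alpha>"]) (auto simp: E_def)
      then show "Xs l vac \<in> fv.span ((\<lambda>I. fw I vac) ` D)" by (simp add: D_def)
    qed
  qed
  moreover have ind: "fv.independent ((\<lambda>l. Xs l vac) ` E)"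
    using independent_admissible by (rule fv.independent_mono) (auto simp: E_def)
  moreover have inj: "inj_on (\<lambda>l. Xs l vac) E"
    using inj_admissible by (rule inj_on_subset) (auto simp: E_def)
  ultimately show "fv.dim (fv.span ((\<lambda>I. fw I vac) ` D)) = card E"
    using fv.dim_span_eq_card_independent[OF ind] card_image[OF inj] by metis
  have "finite ((\<lambda>l. Xs l vac) ` E)"
  proof -
    have "(\<lambda>l. Xs l vac) ` E \<subseteq> fv.span ((\<lambda>I. fw I vac) ` D)"
      using \<open>fv.span ((\<lambda>I. fw I vac) ` D) = _\<close> fv.span_superset by simp
    then show ?thesis using fv.independent_span_bound[OF finite_imageI[OF assms(3)] ind] by blast
  qed
  then show "finite E" using inj finite_imageD by blast
qed

section \<open>Partitions as monomials and as admissible lists\<close>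

lemma pw_pos: "a \<in> primaries n \<Longrightarrow> pw \<alpha> (pos n a) = (\<lambda>h. cw \<alpha> (int (snd a)) h - of_int (fst a) * null_root n \<alpha> h)"
  using pw_letter[of "int (snd a)" \<alpha> "fst a"] by (simp add: pos_def letters_def per_def add.commute)

lemma ewt_enc:
  assumes "(k, x, y) \<in> secondary_ints n"
  shows "ewt \<alpha> (enc n (k, x, y)) = (\<lambda>h. cw \<alpha> (int x) h + cw \<alpha> (int y) h - of_int k * null_root n \<alpha> h)"
proof -
  have pr: "zeta (k, x, y) \<in> primaries n" "eta (k, x, y) \<in> primaries n" using zeta_eta_primaries[OF assms] by auto
  have e: "ewt \<alpha> (enc n (k, x, y)) = (\<lambda>h. (cw \<alpha> (int (snd (zeta (k, x, y)))) h - of_int (fst (zeta (k, x, y))) * null_root n \<alpha> h)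
     + (cw \<alpha> (int (snd (eta (k, x, y)))) h - of_int (fst (eta (k, x, y))) * null_root n \<alpha> h))"
    by (simp add: ewt_def enc_def pw_pos[OF pr(1)] pw_pos[OF pr(2)] plus_fun_def)
  show ?thesis
  proof (cases "even k")
    case True
    then obtain m where "k = 2 * m" by (elim evenE)
    then show ?thesis unfolding e by (simp add: zeta_def eta_def fun_eq_iff algebra_simps)
  next
    case False
    then obtain m where "k = 2 * m + 1" by (elim oddE)
    then show ?thesis unfolding e by (simp add: zeta_def eta_def fun_eq_iff algebra_simps)
  qed
qed

lemma fexp_add: "fexp a * fexp b = fexp (a + b)"
  by (simp add: fexp_def mult_single)

lemma fexp_zero: "fexp 0 = 1"
  by (simp add: fexp_def)

lemma fexp_power: "fexp (a :: 'h \<Rightarrow> complex) ^ m = fexp (\<lambda>h. of_nat m * a h)"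
proof (induction m)
  case 0
  have "(\<lambda>h. of_nat 0 * a h) = 0" by (simp add: fun_eq_iff)
  then show ?case by (simp only: fexp_zero power_0)
next
  case (Suc m)
  have "a + (\<lambda>h. of_nat m * a h) = (\<lambda>h. of_nat (Suc m) * a h)" by (simp add: fun_eq_iff algebra_simps)
  then show ?case by (simp only: power_Suc Suc fexp_add)
qed

lemma colour1_fexp: "x \<in> letters n \<Longrightarrow> colour1 n \<alpha> x = fexp (cw \<alpha> (int x))"
proof -
  assume x: "x \<in> letters n"
  have "nat (per + 1 - int x) = bar n x" using x by (auto simp: per_def bar_def letters_def)
  then show ?thesis by (simp add: colour1_def cw_def)
qed

lemma part_fexp:
  assumes "e \<in> positive_secondary n" and q: "q = fexp (- null_root n \<alpha>)"
  shows "colour n \<alpha> e * q ^ part_size e = fexp (ewt \<alpha> (enc n e))"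
proof -
  obtain k x y where e: "e = (k, x, y)" by (cases e)
  have sec: "(k, x, y) \<in> secondary_ints n" and k: "k \<ge> 0" using assms(1) by (auto simp: positive_secondary_def e)
  then have xy: "x \<in> letters n" "y \<in> letters n" by (auto simp: secondary_ints_def)
  have "colour n \<alpha> e * q ^ part_size e = fexp (cw \<alpha> (int x) + cw \<alpha> (int y) + (\<lambda>h. of_nat (nat k) * (- null_root n \<alpha>) h))"
    by (simp only: e colour_def part_size_def q split_conv colour1_fexp[OF xy(1)] colour1_fexp[OF xy(2)] fexp_power fexp_add)
  also have "cw \<alpha> (int x) + cw \<alpha> (int y) + (\<lambda>h. of_nat (nat k) * (- null_root n \<alpha>) h) = ewt \<alpha> (enc n e)"
    unfolding e ewt_enc[OF sec] using k by (simp add: fun_eq_iff)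
  finally show ?thesis .
qed

lemma partition_monomial_fexp:
  assumes "set_mset \<pi> \<subseteq> positive_secondary n" and q: "q = fexp (- null_root n \<alpha>)"
  shows "partition_monomial n \<alpha> q \<pi> = fexp (sum_mset (image_mset (\<lambda>e. ewt \<alpha> (enc n e)) \<pi>))"
proof -
  have "partition_monomial n \<alpha> q \<pi> = prod_mset (image_mset (\<lambda>e. colour n \<alpha> e * q ^ part_size e) \<pi>)"
    by (simp add: partition_monomial_def image_prod_mset_multiplicity)
  also have "\<dots> = prod_mset (image_mset (\<lambda>e. fexp (ewt \<alpha> (enc n e))) \<pi>)"
    using assms by (intro arg_cong[of _ _ prod_mset] image_mset_cong part_fexp) auto
  also have "\<dots> = fexp (sum_mset (image_mset (\<lambda>e. ewt \<alpha> (enc n e)) \<pi>))"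
    by (induction \<pi>) (simp_all only: image_mset_empty image_mset_add_mset prod_mset.empty sum_mset.empty prod_mset.add_mset sum_mset.add_mset fexp_zero fexp_add)
  finally show ?thesis .
qed

lemma admissible_count:
  fixes \<alpha> :: "nat \<Rightarrow> 'h \<Rightarrow> complex" and \<mu> :: "'h \<Rightarrow> complex"
  defines "E \<equiv> {l. admissible_list l \<and> sum_list (map (ewt \<alpha>) l) = \<mu>}"
    and "Ap \<equiv> {\<pi> \<in> admissible_partitions n (omega n i). sum_mset (image_mset (\<lambda>e. ewt \<alpha> (enc n e)) \<pi>) = \<mu>}"
  shows "\<exists>F. bij_betw F Ap E"
proof -
  have "\<forall>\<pi>\<in>admissible_partitions n (omega n i). \<exists>lp. mset lp = \<pi> \<and> set lp \<subseteq> secondary_ints n \<and> admissible_list (map (enc n) lp)"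
    using admissible_partitions_list by metis
  then obtain L where L: "\<And>\<pi>. \<pi> \<in> admissible_partitions n (omega n i) \<Longrightarrow>
      mset (L \<pi>) = \<pi> \<and> set (L \<pi>) \<subseteq> secondary_ints n \<and> admissible_list (map (enc n) (L \<pi>))"
    by (metis bchoice)
  define F where "F \<pi> = map (enc n) (L \<pi>)" for \<pi>
  have wt: "sum_list (map (ewt \<alpha>) (map (enc n) lp)) = sum_mset (image_mset (\<lambda>e. ewt \<alpha> (enc n e)) (mset lp))" for lp
    unfolding mset_map[symmetric] sum_mset_sum_list by (simp add: o_def)
  have inj: "inj_on F Ap"
  proof (rule inj_onI)
    fix \<pi> \<pi>' assume p: "\<pi> \<in> Ap" "\<pi>' \<in> Ap" "F \<pi> = F \<pi>'"
    then have l: "mset (L \<pi>) = \<pi>" "set (L \<pi>) \<subseteq> secondary_ints n" "mset (L \<pi>') = \<pi>'" "set (L \<pi>') \<subseteq> secondary_ints n"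
      using L by (auto simp: Ap_def)
    have "L \<pi> = L \<pi>'"
      using p(3) unfolding F_def by (rule map_inj_on) (rule inj_on_subset[OF enc_inj], use l in auto)
    then show "\<pi> = \<pi>'" using l by metis
  qed
  have "F ` Ap \<subseteq> E"
  proof clarify
    fix \<pi> assume "\<pi> \<in> Ap"
    then have "mset (L \<pi>) = \<pi>" "admissible_list (map (enc n) (L \<pi>))" "sum_mset (image_mset (\<lambda>e. ewt \<alpha> (enc n e)) \<pi>) = \<mu>"
      using L by (auto simp: Ap_def)
    then show "F \<pi> \<in> E" unfolding E_def F_def using wt[of "L \<pi>"] by simp
  qed
  moreover have "E \<subseteq> F ` Ap"
  proof
    fix l assume l: "l \<in> E"
    define lp where "lp = map (inv_into (secondary_ints n) (enc n)) l"
    have img: "e \<in> enc n ` secondary_ints n" if "e \<in> set l" for e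
    proof -
      have "fst e \<le> snd e" "snd e \<le> fst e + 2 * int n" using l that by (auto simp: E_def admissible_list_def per_def)
      then obtain e' where "e' \<in> secondary_ints n" "enc n e' = (fst e, snd e)" by (rule enc_surj[OF n_pos])
      then show ?thesis by (metis image_eqI prod.collapse)
    qed
    have lp: "map (enc n) lp = l" using img by (simp add: lp_def o_def f_inv_into_f map_idI)
    have sec: "set lp \<subseteq> secondary_ints n" unfolding lp_def set_map using inv_into_into[OF img] by blast
    have adm: "mset lp \<in> admissible_partitions n (omega n i)"
      using l lp by (intro list_admissible_partitions[OF sec]) (simp add: E_def)
    then have "mset lp \<in> Ap" using wt[of lp] lp l by (simp add: Ap_def E_def)
    moreover have "F (mset lp) = l"
    proof -
      have a1: "admissible_list (F (mset lp))" "mset (L (mset lp)) = mset lp" using L[OF adm] by (auto simp: F_def)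
      have "mset (F (mset lp)) = mset l" unfolding F_def mset_map a1(2) by (simp add: lp[symmetric])
      moreover have "admissible_list l" using l by (simp add: E_def)
      ultimately show ?thesis using a1(1)
      proof -
        assume m: "mset (F (mset lp)) = mset l" and al: "admissible_list l"
        \<comment> \<open>The state depends only on the set of intervals, so
          \<open>state_inj\<close> shows that an admissible list is determined by its
          multiset.\<close>
        have "state (F (mset lp)) = state l"
          using mset_eq_setD[OF m] by (intro fset_inject[THEN iffD1]) (simp add: fset_state)
        then show ?thesis using state_inj[OF a1(1) al] by blast
      qed
    qed
    ultimately show "l \<in> F ` Ap" by blast
  qed
  ultimately have "bij_betw F Ap E" using inj by (auto simp: bij_betw_def)
  then show ?thesis by blast
qed

text \<open>Words applied to the vacuum are finitely supported, so the commutators established for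
  such vectors hold on all of them. The highest weight is that of \<Lambda>_i because only
  \<open>fop i\<close> moves the vacuum.\<close>

lemma hw_words_fock:
  assumes lam: "\<And>j. j \<le> n \<Longrightarrow> lam j = of_bool (j = i)"
  obtains hop where "hw_words fscale (n + 1) (cartan_C1 n) lam eop fop hop vac"
proof -
  have "\<forall>j. \<exists>hop. j \<le> n \<longrightarrow> flinear hop \<and> (\<forall>\<phi>. finsupp \<phi> \<longrightarrow> eop j (fop j \<phi>) = fop j (eop j \<phi>) + hop \<phi>) \<and>
     hop vac = fscale (of_bool (j = i)) vac \<and>
     (\<forall>k \<phi>. k \<le> n \<longrightarrow> finsupp \<phi> \<longrightarrow> hop (fop k \<phi>) = fop k (hop \<phi>) - fscale (of_int (cartan_C1 n j k)) (fop k \<phi>))"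
    using cartan_relations by metis
  then obtain hop where hop: "\<And>j. j \<le> n \<Longrightarrow> flinear (hop j)"
    "\<And>j \<phi>. j \<le> n \<Longrightarrow> finsupp \<phi> \<Longrightarrow> eop j (fop j \<phi>) = fop j (eop j \<phi>) + hop j \<phi>"
    "\<And>j. j \<le> n \<Longrightarrow> hop j vac = fscale (of_bool (j = i)) vac"
    "\<And>j k \<phi>. j \<le> n \<Longrightarrow> k \<le> n \<Longrightarrow> finsupp \<phi> \<Longrightarrow> hop j (fop k \<phi>) = fop k (hop j \<phi>) - fscale (of_int (cartan_C1 n j k)) (fop k \<phi>)"
    by metis
  have fs: "finsupp (foldr fop I vac)" for I using finsupp_fw[of vac I] by (simp add: fw_def)
  have "hw_words fscale (n + 1) (cartan_C1 n) lam eop fop hop vac"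
  proof unfold_locales
    fix I j k assume "set I \<subseteq> {..<n + 1}" "j < n + 1" "k < n + 1"
    then show "eop j (fop k (foldr fop I vac)) = fop k (eop j (foldr fop I vac)) + (if j = k then hop j (foldr fop I vac) else 0)"
      using hop(2)[OF _ fs, of j I] eop_fop_commute[OF _ fs, of j k I] by auto
    show "hop j (fop k (foldr fop I vac)) = fop k (hop j (foldr fop I vac)) - fscale (of_int (cartan_C1 n j k)) (fop k (foldr fop I vac))"
      using hop(4)[OF _ _ fs, of j k I] \<open>j < n + 1\<close> \<open>k < n + 1\<close> by simp
  qed (auto simp: flinear_simps[OF flinear_eop] flinear_simps[OF flinear_fop] flinear_simps[OF hop(1)] eop_vac hop(3) lam)
  then show ?thesis using that by blast
qed

end

theorem theorem1p13:
  fixes n i :: nat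
    and scaleh :: "complex \<Rightarrow> 'h::ab_group_add \<Rightarrow> 'h"
    and \<alpha> :: "nat \<Rightarrow> 'h \<Rightarrow> complex"
    and coroot :: "nat \<Rightarrow> 'h"
    and scaleg :: "complex \<Rightarrow> 'g::ab_group_add \<Rightarrow> 'g"
    and brk :: "'g \<Rightarrow> 'g \<Rightarrow> 'g"
    and \<iota> :: "'h \<Rightarrow> 'g"
    and e f :: "nat \<Rightarrow> 'g"
    and scalev :: "complex \<Rightarrow> 'v::ab_group_add \<Rightarrow> 'v"
    and act :: "'g \<Rightarrow> 'v \<Rightarrow> 'v"
    and \<Lambda> :: "'h \<Rightarrow> complex"
    and q :: "('h \<Rightarrow> complex) group_ring"
  assumes "n \<ge> 1" and "i \<le> n"
    and "kac_moody_algebra scaleh (n + 1) (cartan_C1 n) \<alpha> coroot scaleg brk \<iota> e f"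
    and "cartan_realization.fundamental_weight scaleh (n + 1) coroot i \<Lambda>"
    and "irreducible_highest_weight_module scaleh (n + 1) (cartan_C1 n) \<alpha> coroot
           scaleg brk \<iota> e f scalev act \<Lambda>"
    and "q = fexp (- null_root n \<alpha>)"
  shows "has_formal_sum (partition_monomial n \<alpha> q)
           (fexp_times (- \<Lambda>) (character scalev act \<iota>))
           (admissible_partitions n (omega n i))"
proof -
  interpret L: irreducible_highest_weight_module scaleh "n + 1" "cartan_C1 n" \<alpha> coroot scaleg brk \<iota> e f scalev act \<Lambda>
    by fact
  obtain v0 where v0: "v0 \<noteq> 0" "\<forall>i<n + 1. act (e i) v0 = 0" "\<forall>h. act (\<iota> h) v0 = scalev (\<Lambda> h) v0"
    "\<forall>W. L.submodule W \<longrightarrow> v0 \<in> W \<longrightarrow> W = UNIV"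
    using L.highest_weight_vector by blast
  interpret M: hw_module scaleh "n + 1" "cartan_C1 n" \<alpha> coroot scaleg brk \<iota> e f scalev act \<Lambda> v0
    by unfold_locales (use v0 in auto)
  interpret S: symplectic_fock n i by unfold_locales (use assms in auto)
  have lam: "\<Lambda> (coroot j) = of_bool (j = i)" if "j \<le> n" for j
    using assms(4) that unfolding L.H.fundamental_weight_def by auto
  obtain hop where "hw_words fscale (n + 1) (cartan_C1 n) (\<lambda>j. \<Lambda> (coroot j)) S.eop S.fop hop vac"
    using S.hw_words_fock[of "\<lambda>j. \<Lambda> (coroot j)", OF lam] by blast
  then interpret F: hw_words fscale "n + 1" "cartan_C1 n" "\<lambda>j. \<Lambda> (coroot j)" S.eop S.fop hop vac .
  interpret P: vector_space_pair scalev fscale ..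
  show ?thesis
    unfolding has_formal_sum_def
  proof
    fix \<mu> :: "'h \<Rightarrow> complex"
    \<comment> \<open>Words of weight \<mu> relative to the highest weight. Multiplication by the
      exponential of - \<Lambda> shifts weights, so this corresponds to the weight \<mu> + \<Lambda>
      of the module.\<close>
    define D where "D = {I. set I \<subseteq> {..n} \<and> (\<lambda>h. - (\<Sum>k\<leftarrow>I. \<alpha> k h)) = \<mu>}"
    have D_sub: "set I \<subseteq> {..<n + 1}" if "I \<in> D" for I using that by (auto simp: D_def)
    have D_wt: "M.rootsum I = - \<mu>" if "I \<in> D" for I
    proof
      fix h
      have "- (\<Sum>k\<leftarrow>I. \<alpha> k h) = \<mu> h" using that by (auto simp: D_def)
      show "M.rootsum I h = (- \<mu>) h" by (simp add: M.rootsum_def flip: \<open>- (\<Sum>k\<leftarrow>I. \<alpha> k h) = \<mu> h\<close>)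
    qed
    \<comment> \<open>All words in D are rearrangements of one another, which gives finiteness and
      the common length m at which Gram matrices are compared.\<close>
    have D_mset: "mset I = mset I'" if "I \<in> D" "I' \<in> D" for I I'
      using that D_sub D_wt by (intro M.rootsum_inj) auto
    have finD: "finite D"
    proof (cases "D = {}")
      case False
      then obtain I0 where "I0 \<in> D" by blast
      then have "D \<subseteq> {I. mset I = mset I0}" using D_mset by blast
      then show ?thesis using mset_eq_finite finite_subset by blast
    qed simp
    obtain m where m: "\<And>I. I \<in> D \<Longrightarrow> length I = m"
    proof (cases "D = {}")
      case False
      then obtain I0 where "I0 \<in> D" by blast
      then show ?thesis using that[of "length I0"] D_mset mset_eq_length by blast
    qed simp
    have "M.wsp (\<mu> + \<Lambda>) = L.V.span ((\<lambda>I. M.FW I v0) ` D)"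
    proof -
      have "{I. set I \<subseteq> {..<n + 1} \<and> (\<lambda>h. \<Lambda> h - M.rootsum I h) = \<mu> + \<Lambda>} = D"
        by (auto simp: D_def M.rootsum_def fun_eq_iff algebra_simps neg_eq_iff_add_eq_0)
      then show ?thesis unfolding M.wsp_words by simp
    qed
    moreover have "L.V.dim (L.V.span ((\<lambda>I. M.FW I v0) ` D)) = fv.dim (fv.span ((\<lambda>I. S.fw I vac) ` D))"
    proof (rule P.dim_eq_of_same_relations[OF finD])
      fix c
      have "(\<Sum>I\<in>D. scalev (c I) (M.FW I v0)) = 0 \<longleftrightarrow>
        (\<forall>J. set J \<subseteq> {..<n + 1} \<longrightarrow> length J = m \<longrightarrow> (\<Sum>I\<in>D. c I * gram (cartan_C1 n) (\<lambda>j. \<Lambda> (coroot j)) J I) = 0)"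
      proof (rule M.hw.relation_iff_gram[OF finD])
        show "set I \<subseteq> {..<n + 1} \<and> length I = m" if "I \<in> D" for I using D_sub m that by blast
        show "v0 \<noteq> 0" by (rule M.v0_nz)
        fix c assume ann: "\<And>J. set J \<subseteq> {..<n + 1} \<Longrightarrow> length J = m \<Longrightarrow> M.hw.EW J (\<Sum>I\<in>D. scalev (c I) (M.FW I v0)) = 0"
        show "(\<Sum>I\<in>D. scalev (c I) (M.FW I v0)) = 0"
        proof (rule M.module_nondegenerate[OF _ refl ann])
          show "set I \<subseteq> {..<n + 1} \<and> length I = m \<and> M.rootsum I = - \<mu>" if "I \<in> D" for I
            using D_sub D_wt m that by blast
        qed
      qed
      also have "\<dots> \<longleftrightarrow> (\<Sum>I\<in>D. fscale (c I) (foldr S.fop I vac)) = 0"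
      proof (rule F.relation_iff_gram[OF finD, symmetric])
        show "set I \<subseteq> {..<n + 1} \<and> length I = m" if "I \<in> D" for I using D_sub m that by blast
        show "vac \<noteq> 0" by (auto simp: ket_def fun_eq_iff)
        fix c assume ann: "\<And>J. set J \<subseteq> {..<n + 1} \<Longrightarrow> length J = m \<Longrightarrow> F.EW J (\<Sum>I\<in>D. fscale (c I) (foldr S.fop I vac)) = 0"
        have ew: "S.ew J x = F.EW J x" for J x
          by (induction J arbitrary: x) (auto simp: F.EW_def)
        show "(\<Sum>I\<in>D. fscale (c I) (foldr S.fop I vac)) = 0"
          unfolding S.fw_def[symmetric]
          by (rule S.fock_gram_nondegenerate[OF finD, where P = "\<lambda>J. set J \<subseteq> {..<n + 1} \<and> length J = m"])
            (use D_sub m ann in \<open>auto simp: ew S.fw_def\<close>)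
      qed
      finally show "(\<Sum>I\<in>D. scalev (c I) (M.FW I v0)) = 0 \<longleftrightarrow> (\<Sum>I\<in>D. fscale (c I) (S.fw I vac)) = 0"
        by (simp add: S.fw_def)
    qed
    moreover define E where "E = {l. S.admissible_list l \<and> sum_list (map (S.ewt \<alpha>) l) = \<mu>}"
    moreover define B where "B = {\<pi> \<in> admissible_partitions n (omega n i). sum_mset (image_mset (\<lambda>e. S.ewt \<alpha> (enc n e)) \<pi>) = \<mu>}"
    have dimE: "finite E" "fv.dim (fv.span ((\<lambda>I. S.fw I vac) ` D)) = card E"
      unfolding E_def D_def by (rule S.fock_dimension, use finD in \<open>simp add: D_def\<close>)+
    obtain G where G: "bij_betw G B E" unfolding B_def E_def using S.admissible_count by blast
    have finB: "finite B" using bij_betw_finite[OF G] dimE(1) by simp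
    have cardB: "card B = card E" using bij_betw_same_card[OF G] .
    ultimately have dim: "L.V.dim (M.wsp (\<mu> + \<Lambda>)) = card B" using dimE by simp
    \<comment> \<open>Each partition contributes a single exponential with coefficient 1, so the
      coefficient of \<mu> in the sum counts the partitions in B.\<close>
    have mono: "Poly_Mapping.lookup (partition_monomial n \<alpha> q \<pi>) \<mu> = of_bool (\<pi> \<in> B)" if "\<pi> \<in> admissible_partitions n (omega n i)" for \<pi>
    proof -
      have "set_mset \<pi> \<subseteq> positive_secondary n" using that by (auto simp: admissible_partitions_def)
      from S.partition_monomial_fexp[OF this assms(6)] show ?thesis
        using that by (simp add: fexp_def lookup_single B_def when_def)
    qed
    have "((\<lambda>\<pi>. of_bool (\<pi> \<in> B) :: int) has_sum (\<Sum>\<pi>\<in>B. of_bool (\<pi> \<in> B))) B" by (rule has_sum_finite[OF finB])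
    then have "((\<lambda>\<pi>. of_bool (\<pi> \<in> B) :: int) has_sum int (card B)) B" by simp
    then have "((\<lambda>\<pi>. Poly_Mapping.lookup (partition_monomial n \<alpha> q \<pi>) \<mu>) has_sum int (card B)) (admissible_partitions n (omega n i))"
      by (rule has_sum_cong_neutral[THEN iffD1, rotated -1]) (auto simp: mono, auto simp: B_def)
    moreover have "fexp_times (- \<Lambda>) (character scalev act \<iota>) \<mu> = int (card B)"
      using dim by (simp add: fexp_times_def character_def)
    ultimately show "((\<lambda>a. Poly_Mapping.lookup (partition_monomial n \<alpha> q a) \<mu>) has_sum fexp_times (- \<Lambda>) (character scalev act \<iota>) \<mu>) (admissible_partitions n (omega n i))"
      by simp
  qed
qed

end
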